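(* Let $\mathbf V$ be a periodic commutative semigroup variety. The following are equivalent: (a) $\mathbf V$ is a cancellable element of the lattice $\mathbf{EPI}$ of all epigroup varieties; (b) $\mathbf V$ is a modular element of the lattice $\mathbf{EPI}$; (c) $\mathbf V$ is a cancellable element of the lattice $\mathbf{SEM}$ of all semigroup varieties; (d) $\mathbf V$ is a modular element of the lattice $\mathbf{SEM}$.
   Context: Epigroups. A semigroup $S$ is an epigroup if for every $x\in S$ there is a natural number $n\ge 1$ such that $x^n$ lies in some subgroup of $S$. For an element $x$ of an epigroup, let $G$ be the maximal subgroup of $S$ containing some power of $x$ and let $e_x$ be its unit element. Then $xe_x=e_xx\in G$, and the pseudoinverse $\overline{x}$ of $x$ is the inverse of $xe_x$ in the group $G$. Epigroups are regarded as algebras with two operations: the binary multiplication and the unary operation $x\mapsto\overline{x}$. Lattices of varieties. An epigroup variety is a variety (in the sense of universal algebra, in the signature consisting of multiplication and the unary operation) all of whose members are epigroups with $\overline{\phantom{x}}$ being the pseudoinversion. $\mathbf{EPI}$ is the lattice of all epigroup varieties, and $\mathbf{SEM}$ is the lattice of all semigroup varieties (signature: multiplication only), both ordered by inclusion; in each, the meet is intersection and the join is the variety generated by the union. Periodic varieties. A semigroup variety is periodic if all its members are periodic semigroups (every element generates a finite subsemigroup); equivalently, it satisfies an identity $x^n\approx x^{n+m}$ for some $n,m\ge 1$. Every periodic semigroup is an epigroup, and in a periodic variety the pseudoinversion is expressible by a term in multiplication; hence a periodic semigroup variety is identified with the epigroup variety obtained by equipping each of its members with the pseudoinversion. In this way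 $\mathbf V$ is viewed as an element of both $\mathbf{SEM}$ and $\mathbf{EPI}$. Special elements. An element $x$ of a lattice $\langle L;\vee,\wedge\rangle$ is modular if for all $y,z\in L$, $y\le z$ implies $(x\vee y)\wedge z=(x\wedge z)\vee y$. It is cancellable if for all $y,z\in L$, the equalities $x\vee y=x\vee z$ and $x\wedge y=x\wedge z$ together imply $y=z$. *)

theory Defs
  imports "HOL-Algebra.Lattice" "HOL-Algebra.Group" "HOL-Library.Infinite_Typeclass"
begin

section \<open>Algebras with one binary and at most one unary operation\<close>

record 'a magma = "'a partial_object" +
  mul :: "['a, 'a] \<Rightarrow> 'a"  (infixl \<open>\<cdot>\<index>\<close> 70)

record 'a unary_magma = "'a magma" +
  pinv :: "'a \<Rightarrow> 'a"

definition magma_closed :: "('a, 'b) magma_scheme \<Rightarrow> bool" where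
  "magma_closed S \<longleftrightarrow>
     carrier S \<noteq> {} \<and> (\<forall>x\<in>carrier S. \<forall>y\<in>carrier S. x \<cdot>\<^bsub>S\<^esub> y \<in> carrier S)"

definition unary_magma_closed :: "('a, 'b) unary_magma_scheme \<Rightarrow> bool" where
  "unary_magma_closed S \<longleftrightarrow> magma_closed S \<and> (\<forall>x\<in>carrier S. pinv S x \<in> carrier S)"

definition is_semigroup :: "('a, 'b) magma_scheme \<Rightarrow> bool" where
  "is_semigroup S \<longleftrightarrow> magma_closed S \<and>
     (\<forall>x\<in>carrier S. \<forall>y\<in>carrier S. \<forall>z\<in>carrier S.
        (x \<cdot>\<^bsub>S\<^esub> y) \<cdot>\<^bsub>S\<^esub> z = x \<cdot>\<^bsub>S\<^esub> (y \<cdot>\<^bsub>S\<^esub> z))"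

definition commutative :: "('a, 'b) magma_scheme \<Rightarrow> bool" where
  "commutative S \<longleftrightarrow> (\<forall>x\<in>carrier S. \<forall>y\<in>carrier S. x \<cdot>\<^bsub>S\<^esub> y = y \<cdot>\<^bsub>S\<^esub> x)"

text \<open>The power of \<open>x\<close> with exponent \<open>n\<close>, meaningful only for \<open>n \<ge> 1\<close>
  (there is no unit element; the value at \<open>n = 0\<close> is \<open>x\<close> and is never used).\<close>

definition spow :: "('a, 'b) magma_scheme \<Rightarrow> 'a \<Rightarrow> nat \<Rightarrow> 'a" where
  "spow S x n = ((\<lambda>y. y \<cdot>\<^bsub>S\<^esub> x) ^^ (n - 1)) x"

definition subsemigroup :: "('a, 'b) magma_scheme \<Rightarrow> 'a set \<Rightarrow> bool" where
  "subsemigroup S T \<longleftrightarrow> T \<subseteq> carrier S \<and> (\<forall>x\<in>T. \<forall>y\<in>T. x \<cdot>\<^bsub>S\<^esub> y \<in> T)"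

definition periodic :: "('a, 'b) magma_scheme \<Rightarrow> bool" where
  "periodic S \<longleftrightarrow> (\<forall>x\<in>carrier S. finite (subsemigroup S hull {x}))"


section \<open>Epigroups\<close>

definition group_on :: "('a, 'b) magma_scheme \<Rightarrow> 'a set \<Rightarrow> 'a \<Rightarrow> 'a monoid" where
  "group_on S G e = \<lparr>carrier = G, mult = mul S, one = e\<rparr>"

text \<open>\<open>G\<close> is a subgroup of the semigroup \<open>S\<close>, with unit element \<open>e\<close>.\<close>

definition sg_subgroup :: "('a, 'b) magma_scheme \<Rightarrow> 'a set \<Rightarrow> 'a \<Rightarrow> bool" where
  "sg_subgroup S G e \<longleftrightarrow> G \<subseteq> carrier S \<and> group (group_on S G e)"

definition maximal_subgroup :: "('a, 'b) magma_scheme \<Rightarrow> 'a set \<Rightarrow> 'a \<Rightarrow> bool" where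
  "maximal_subgroup S G e \<longleftrightarrow>
     sg_subgroup S G e \<and> (\<forall>H f. sg_subgroup S H f \<and> G \<subseteq> H \<longrightarrow> H = G)"

definition epigroup :: "('a, 'b) magma_scheme \<Rightarrow> bool" where
  "epigroup S \<longleftrightarrow> is_semigroup S \<and>
     (\<forall>x\<in>carrier S. \<exists>n\<ge>1. \<exists>G e. sg_subgroup S G e \<and> spow S x n \<in> G)"

text \<open>\<open>y\<close> is the pseudoinverse of \<open>x\<close>. In an epigroup the pair \<open>G, e\<close> is uniquely determined
  by \<open>x\<close>, so this relation is the graph of a function there.\<close>

definition is_pseudoinverse :: "('a, 'b) magma_scheme \<Rightarrow> 'a \<Rightarrow> 'a \<Rightarrow> bool" where
  "is_pseudoinverse S x y \<longleftrightarrow>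
     (\<exists>G e. maximal_subgroup S G e \<and> (\<exists>n\<ge>1. spow S x n \<in> G) \<and>
        y = inv\<^bsub>group_on S G e\<^esub> (x \<cdot>\<^bsub>S\<^esub> e))"

definition pinv_is_pseudoinversion :: "('a, 'b) unary_magma_scheme \<Rightarrow> bool" where
  "pinv_is_pseudoinversion S \<longleftrightarrow> (\<forall>x\<in>carrier S. is_pseudoinverse S x (pinv S x))"


section \<open>Identities and varieties\<close>

datatype mterm = MVar nat | MMul mterm mterm

datatype uterm = UVar nat | UMul uterm uterm | UInv uterm

primrec meval :: "('a, 'b) magma_scheme \<Rightarrow> (nat \<Rightarrow> 'a) \<Rightarrow> mterm \<Rightarrow> 'a" where
  "meval S \<rho> (MVar i) = \<rho> i"
| "meval S \<rho> (MMul s t) = meval S \<rho> s \<cdot>\<^bsub>S\<^esub> meval S \<rho> t"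

primrec ueval :: "('a, 'b) unary_magma_scheme \<Rightarrow> (nat \<Rightarrow> 'a) \<Rightarrow> uterm \<Rightarrow> 'a" where
  "ueval S \<rho> (UVar i) = \<rho> i"
| "ueval S \<rho> (UMul s t) = ueval S \<rho> s \<cdot>\<^bsub>S\<^esub> ueval S \<rho> t"
| "ueval S \<rho> (UInv s) = pinv S (ueval S \<rho> s)"

definition msatisfies :: "('a, 'b) magma_scheme \<Rightarrow> mterm \<times> mterm \<Rightarrow> bool" where
  "msatisfies S st \<longleftrightarrow>
     (\<forall>\<rho>. range \<rho> \<subseteq> carrier S \<longrightarrow> meval S \<rho> (fst st) = meval S \<rho> (snd st))"

definition usatisfies :: "('a, 'b) unary_magma_scheme \<Rightarrow> uterm \<times> uterm \<Rightarrow> bool" where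
  "usatisfies S st \<longleftrightarrow>
     (\<forall>\<rho>. range \<rho> \<subseteq> carrier S \<longrightarrow> ueval S \<rho> (fst st) = ueval S \<rho> (snd st))"

text \<open>A variety is the class of all algebras of the given signature that satisfy a given set of
  identities. Algebras have their carriers inside a type \<open>'a\<close>; whenever \<open>'a\<close> is infinite, every
  countable algebra has a copy in \<open>'a\<close>. A variety is determined by its countable members, and being
  a semigroup, being periodic, and being an epigroup with pseudoinversion can all be tested on
  countable subalgebras. So for infinite \<open>'a\<close> the varieties below correspond, bijectively and
  preserving inclusion, to varieties in the unrestricted sense.\<close>

definition magma_variety :: "'a magma set \<Rightarrow> bool" where
  "magma_variety V \<longleftrightarrow>
     (\<exists>\<Sigma>. V = {S. magma_closed S \<and> (\<forall>st\<in>\<Sigma>. msatisfies S st)})"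

definition unary_magma_variety :: "'a unary_magma set \<Rightarrow> bool" where
  "unary_magma_variety V \<longleftrightarrow>
     (\<exists>\<Sigma>. V = {S. unary_magma_closed S \<and> (\<forall>st\<in>\<Sigma>. usatisfies S st)})"

definition semigroup_variety :: "'a magma set \<Rightarrow> bool" where
  "semigroup_variety V \<longleftrightarrow> magma_variety V \<and> (\<forall>S\<in>V. is_semigroup S)"

definition epigroup_variety :: "'a unary_magma set \<Rightarrow> bool" where
  "epigroup_variety V \<longleftrightarrow>
     unary_magma_variety V \<and> (\<forall>S\<in>V. epigroup S \<and> pinv_is_pseudoinversion S)"

definition periodic_variety :: "'a magma set \<Rightarrow> bool" where
  "periodic_variety V \<longleftrightarrow> semigroup_variety V \<and> (\<forall>S\<in>V. periodic S)"

definition commutative_variety :: "'a magma set \<Rightarrow> bool" where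
  "commutative_variety V \<longleftrightarrow> semigroup_variety V \<and> (\<forall>S\<in>V. commutative S)"

text \<open>The epigroup variety with which a periodic semigroup variety is identified: every member is
  equipped with its pseudoinversion. (\<open>magma.truncate\<close> forgets the unary operation.)\<close>

definition as_epigroup_variety :: "'a magma set \<Rightarrow> 'a unary_magma set" where
  "as_epigroup_variety V = {E. magma.truncate E \<in> V \<and> pinv_is_pseudoinversion E}"


section \<open>The two lattices and special elements\<close>

text \<open>Join and meet are the supremum and infimum for inclusion: the meet of two varieties is
  their intersection, the join is the least variety (of the respective kind) containing both.\<close>

definition SEM :: "'a magma set gorder" where
  "SEM = \<lparr>carrier = {V. semigroup_variety V}, eq = (=), le = (\<subseteq>)\<rparr>"

definition EPI :: "'a unary_magma set gorder" where
  "EPI = \<lparr>carrier = {V. epigroup_variety V}, eq = (=), le = (\<subseteq>)\<rparr>"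

definition modular_element :: "('a, 'b) gorder_scheme \<Rightarrow> 'a \<Rightarrow> bool" where
  "modular_element L x \<longleftrightarrow> x \<in> carrier L \<and>
     (\<forall>y\<in>carrier L. \<forall>z\<in>carrier L. y \<sqsubseteq>\<^bsub>L\<^esub> z \<longrightarrow>
        (x \<squnion>\<^bsub>L\<^esub> y) \<sqinter>\<^bsub>L\<^esub> z = (x \<sqinter>\<^bsub>L\<^esub> z) \<squnion>\<^bsub>L\<^esub> y)"

definition cancellable_element :: "('a, 'b) gorder_scheme \<Rightarrow> 'a \<Rightarrow> bool" where
  "cancellable_element L x \<longleftrightarrow> x \<in> carrier L \<and>
     (\<forall>y\<in>carrier L. \<forall>z\<in>carrier L.
        x \<squnion>\<^bsub>L\<^esub> y = x \<squnion>\<^bsub>L\<^esub> z \<and> x \<sqinter>\<^bsub>L\<^esub> y = x \<sqinter>\<^bsub>L\<^esub> z \<longrightarrow> y = z)"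

end

theory Submission
  imports Defs "HOL-Library.Multiset" "HOL-Library.Countable"
begin

text \<open>By Birkhoff duality a variety is replaced by its equational theory, a fully invariant congruence
  on unary terms; joins become intersections and meets become joins of congruences, which are
  transitive closures of unions. Semigroup varieties are embedded as the theories containing
  \<open>UInv s \<approx> s\<close>, and a periodic variety gives an epigroup theory by reading \<open>UInv s\<close>
  as a fixed power of \<open>s\<close>. Cancellable elements are always modular, so it suffices that, for a
  commutative theory \<open>\<nu>\<close>, modularity forces the identity \<open>x\<^sup>2y \<approx> x\<^sup>2y\<^sup>2\<close>, and
  that this identity implies cancellability.

  If \<open>\<nu>\<close> is modular, two pentagons built from \<open>xxy\<close>, \<open>xyx\<close> and \<open>yxy\<close>, which \<open>\<nu>\<close> partly
  identifies by commutativity, yield first \<open>x\<^sup>2y \<approx> y\<^sup>2x\<close> and then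
  \<open>x\<^sup>2y \<approx> x\<^sup>2y\<^sup>2\<close>.

  Conversely, modulo \<open>\<nu>\<close> every term is idempotent, linear, or a square of a letter. Let \<open>A\<close> and
  \<open>B\<close> have the same meet and the same join with \<open>\<nu>\<close>. On idempotent terms they agree, because
  there \<open>\<nu>\<close> depends only on the set of letters. If a linear word \<open>x\<^sub>1\<dots>x\<^sub>m\<close> is related to
  a term outside its \<open>\<nu>\<close>-class, a theorem of Golubov-Sapir type shows that
  \<open>x\<^sub>1\<dots>x\<^sub>m \<approx> x\<^sub>1\<dots>(x\<^sub>i\<dots>x\<^sub>j)\<^sup>\<omega>\<^sup>+\<^sup>1\<dots>x\<^sub>m\<close> holds
  in the theory concerned; the insertions coming from \<open>A\<close> and from \<open>B\<close> can be performed in either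
  order, so the word is related in both theories to one and the same idempotent term.\<close>

text \<open>Both lattices are served by one argument on unary terms, but inserting \<omega>-powers
  presupposes laws of pseudoinversion that a semigroup theory may lack. The way out: a linear word
  is examined only if each of \<open>A\<close> and \<open>B\<close> relates it to a term outside its
  class under \<open>\<nu>\<close>. As \<open>\<nu>\<close> is commutative, such a semigroup
  identity changes the multiplicities of letters and hence forces periodicity; one exponent is then
  chosen for both theories and \<open>UInv\<close> is reread as that power. The right side of
  \<open>x^2 y = x^2 y^2\<close> is symmetric, so \<open>x^2 y = x^4 y^2\<close>; this makes every
  proper multiple of a square idempotent and explains the shapes left over. The blocks found for
  \<open>A\<close> and for \<open>B\<close> may be disjoint, nested or overlapping. Agreement on
  idempotent terms is what allows each theory to imitate the insertion of the other once its own has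
  been made. The congruences for the necessity part identify all words of length at least 4 with the
  same first two letters. They satisfy \<open>x^4 = x^5\<close> and therefore live in both
  lattices.\<close>

section \<open>Products, powers and evaluation of terms\<close>

text \<open>Exponents are shifted: \<open>pwr f x n\<close> is the power of \<open>x\<close> with exponent \<open>n + 1\<close>.\<close>

primrec pwr :: "('s \<Rightarrow> 's \<Rightarrow> 's) \<Rightarrow> 's \<Rightarrow> nat \<Rightarrow> 's" where
  "pwr f x 0 = x"
| "pwr f x (Suc n) = f (pwr f x n) x"

fun lprod :: "('s \<Rightarrow> 's \<Rightarrow> 's) \<Rightarrow> 's list \<Rightarrow> 's" where
  "lprod f [] = undefined"
| "lprod f [x] = x"
| "lprod f (x # y # ys) = f x (lprod f (y # ys))"

primrec uev :: "('s \<Rightarrow> 's \<Rightarrow> 's) \<Rightarrow> ('s \<Rightarrow> 's) \<Rightarrow> (nat \<Rightarrow> 's) \<Rightarrow> uterm \<Rightarrow> 's" where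
  "uev f g \<rho> (UVar i) = \<rho> i"
| "uev f g \<rho> (UMul s t) = f (uev f g \<rho> s) (uev f g \<rho> t)"
| "uev f g \<rho> (UInv s) = g (uev f g \<rho> s)"

primrec uvars :: "uterm \<Rightarrow> nat set" where
  "uvars (UVar i) = {i}"
| "uvars (UMul s t) = uvars s \<union> uvars t"
| "uvars (UInv s) = uvars s"

primrec flat :: "uterm \<Rightarrow> uterm list" where
  "flat (UVar i) = [UVar i]"
| "flat (UMul s t) = flat s @ flat t"
| "flat (UInv s) = [UInv s]"

lemma flat_ne [simp]: "flat t \<noteq> []" by (induction t) auto

lemma finite_uvars [simp]: "finite (uvars t)" by (induction t) auto
lemma uvars_ne [simp]: "uvars t \<noteq> {}" by (induction t) auto

lemma uvars_flat: "(\<Union>a\<in>set (flat t). uvars a) = uvars t" by (induction t) auto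

lemma flat_atom: "a \<in> set (flat t) \<Longrightarrow> (\<exists>i. a = UVar i) \<or> (\<exists>w. a = UInv w)"
  by (induction t) auto

lemma uev_cong: "(\<And>i. i \<in> uvars t \<Longrightarrow> \<rho> i = \<rho>' i) \<Longrightarrow> uev f g \<rho> t = uev f g \<rho>' t"
  by (induction t) auto

locale semigrp =
  fixes mul :: "'s \<Rightarrow> 's \<Rightarrow> 's"  (infixl \<open>\<odot>\<close> 70)
  assumes assoc: "(x \<odot> y) \<odot> z = x \<odot> (y \<odot> z)"
begin

abbreviation "pw \<equiv> pwr (\<odot>)"
abbreviation "lp \<equiv> lprod (\<odot>)"

lemma lp_Cons: "xs \<noteq> [] \<Longrightarrow> lp (x # xs) = x \<odot> lp xs"
  by (cases xs) auto

lemma lp_append: "xs \<noteq> [] \<Longrightarrow> ys \<noteq> [] \<Longrightarrow> lp (xs @ ys) = lp xs \<odot> lp ys"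
proof (induction xs)
  case (Cons x xs)
  then show ?case by (cases "xs = []") (auto simp: lp_Cons assoc)
qed simp

lemma lp_mid: "ys \<noteq> [] \<Longrightarrow> lp (xs @ ys @ zs) = lp (xs @ [lp ys] @ zs)"
  by (cases "xs = []"; cases "zs = []") (auto simp: lp_append lp_Cons assoc)

lemma lp_replace: "ys \<noteq> [] \<Longrightarrow> ys' \<noteq> [] \<Longrightarrow> lp ys = lp ys' \<Longrightarrow> lp (xs @ ys @ zs) = lp (xs @ ys' @ zs)"
  by (metis lp_mid)

lemma pw_comm: "pw x n \<odot> x = x \<odot> pw x n"
  by (induction n) (auto simp: assoc)

lemma pw_add: "pw x m \<odot> pw x n = pw x (Suc (m + n))"
  by (induction n) (auto simp: assoc[symmetric])

lemma pw_mult: "pw (pw x m) n = pw x (m + n * Suc m)"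
proof (induction n)
  case (Suc n)
  then show ?case by (simp add: pw_add algebra_simps)
qed simp

lemma lp_replicate: "lp (replicate (Suc n) x) = pw x n"
proof (induction n)
  case (Suc n)
  have "lp (replicate (Suc (Suc n)) x) = x \<odot> lp (replicate (Suc n) x)" by simp
  then show ?case using Suc by (simp add: pw_comm)
qed simp

definition rS :: "'s \<Rightarrow> 's set" where "rS x = insert x (range (\<lambda>y. x \<odot> y))"

lemma rS_refl [simp]: "x \<in> rS x" by (simp add: rS_def)
lemma rS_mul: "x \<in> rS y \<Longrightarrow> x \<odot> z \<in> rS y" by (auto simp: rS_def assoc)
lemma rS_lmul: "x \<in> rS y \<Longrightarrow> z \<odot> x \<in> rS (z \<odot> y)" by (auto simp: rS_def assoc[symmetric])
lemma rS_trans: "x \<in> rS y \<Longrightarrow> y \<in> rS z \<Longrightarrow> x \<in> rS z" by (auto simp: rS_def assoc)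
lemma rS_self_mul [simp]: "x \<odot> y \<in> rS x" by (auto simp: rS_def)
lemma rS_lp: "lp (x # xs) \<in> rS x" by (cases xs) auto

end

text \<open>A pseudoinverse \<open>c\<close> can be stretched to \<open>c^(k+2) a^(k+1)\<close> for
  every \<open>k\<close>, and \<open>a b\<close> acts as a unit on a high power of \<open>a\<close>,
  so \<open>c = c a b\<close>; stretching \<open>b\<close> in the same way, with \<open>a c\<close>
  as the unit, gives \<open>c a b = b\<close>. The two exponents may differ, so pseudoinverses
  obtained in different ways can be compared.\<close>

lemma (in semigrp) pinv_unique:
  assumes "a \<odot> b = b \<odot> a" "b \<odot> a \<odot> b = b" "pw a n \<odot> (a \<odot> b) = pw a n"
    and "a \<odot> c = c \<odot> a" "c \<odot> a \<odot> c = c" "pw a m \<odot> (a \<odot> c) = pw a m"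
  shows "b = c"
proof -
  have key: "b = b \<odot> a \<odot> c" if b: "a \<odot> b = b \<odot> a" "b \<odot> a \<odot> b = b"
      and c: "pw a m \<odot> (a \<odot> c) = pw a m" for b c m
  proof -
    have ab: "a \<odot> (b \<odot> x) = b \<odot> (a \<odot> x)" for x using b(1) by (metis assoc)
    have p: "pw b m \<odot> a = a \<odot> pw b m" for m
      by (induction m) (auto simp: assoc b(1)[symmetric], metis assoc)
    have e: "b \<odot> (a \<odot> b) = b" using b by (simp add: assoc)
    have r: "b = pw b (Suc m) \<odot> pw a m" for m
    proof (induction m)
      case 0 show ?case using b by (simp add: assoc)
    next
      case (Suc m)
      have "pw b (Suc (Suc m)) \<odot> pw a (Suc m) = pw b m \<odot> (b \<odot> (b \<odot> (a \<odot> pw a m)))"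
        by (simp add: assoc pw_comm[of a])
      also have "b \<odot> (b \<odot> (a \<odot> pw a m)) = b \<odot> pw a m" using e ab by (metis assoc)
      also have "pw b m \<odot> (b \<odot> pw a m) = pw b (Suc m) \<odot> pw a m" by (simp add: assoc)
      finally show ?case using Suc by simp
    qed
    have "b = pw b (Suc m) \<odot> (pw a m \<odot> (a \<odot> c))" using r[of m] c by simp
    also have "\<dots> = pw b (Suc m) \<odot> pw a m \<odot> a \<odot> c" by (simp add: assoc)
    also have "\<dots> = b \<odot> a \<odot> c" using r[of m] by simp
    finally show ?thesis .
  qed
  have 2: "c = c \<odot> a \<odot> b" using key assms by blast
  have ac: "pw a m \<odot> (a \<odot> c) = (a \<odot> c) \<odot> pw a m" for m
  proof (induction m)
    case 0 show ?case using assms(4) by (metis assoc pwr.simps(1))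
  next
    case (Suc k)
    have "pw a (Suc k) \<odot> (a \<odot> c) = pw a k \<odot> (a \<odot> c) \<odot> a" using assms(4) by (metis assoc pwr.simps(2))
    then show ?case using Suc by (simp add: assoc)
  qed
  have r: "b = pw a k \<odot> pw b (Suc k)" for k
  proof (induction k)
    case 0 show ?case using assms(1,2) by (simp add: assoc[symmetric])
  next
    case (Suc k)
    have "pw a (Suc k) \<odot> pw b (Suc (Suc k)) = pw a k \<odot> (a \<odot> (b \<odot> (b \<odot> pw b k)))"
      by (simp add: assoc pw_comm[of b])
    also have "a \<odot> (b \<odot> (b \<odot> pw b k)) = b \<odot> pw b k" using assms(1,2) by (metis assoc)
    also have "pw a k \<odot> (b \<odot> pw b k) = pw a k \<odot> pw b (Suc k)" by (simp add: pw_comm)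
    finally show ?case using Suc by simp
  qed
  have "c \<odot> a \<odot> b = c \<odot> a \<odot> (pw a m \<odot> pw b (Suc m))" using r[of m] by simp
  also have "\<dots> = (a \<odot> c) \<odot> pw a m \<odot> pw b (Suc m)" using assms(4) by (simp add: assoc)
  also have "\<dots> = b" using ac[of m] assms(6) r[of m] by simp
  finally show ?thesis using 2 by simp
qed

section \<open>Left and right factors of linear words\<close>

text \<open>The laws characterise pseudoinversion in semigroups whose elements have index at most \<open>N + 1\<close>.\<close>

locale epi_semigrp = semigrp +
  fixes iv :: "'a \<Rightarrow> 'a" and N :: nat
  assumes ic: "x \<odot> iv x = iv x \<odot> x"
    and ir: "iv x \<odot> x \<odot> iv x = iv x"
    and ip: "pw x N \<odot> (x \<odot> iv x) = pw x N"
begin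

abbreviation om :: "'a \<Rightarrow> 'a" where "om x \<equiv> x \<odot> iv x"
abbreviation ue :: "(nat \<Rightarrow> 'a) \<Rightarrow> uterm \<Rightarrow> 'a" where "ue \<equiv> uev (\<odot>) iv"

lemma om_idem: "om x \<odot> om x = om x"
  by (metis assoc ir)

lemma iv_idem: "e \<odot> e = e \<Longrightarrow> iv e = e"
  by (rule pinv_unique[where a=e and n=N and m=0]) (auto simp: ic[symmetric] ip, metis ic ir)

lemma iv_expand: "iv x = x \<odot> (iv x \<odot> iv x)"
  by (metis assoc ic ir)

lemma iv_rS: "w \<in> rS z \<Longrightarrow> iv w \<in> rS z"
  by (subst iv_expand) (rule rS_mul)

lemma om_pw_comm: "om x \<odot> pw x n = pw x n \<odot> om x"
proof (induction n)
  case 0 show ?case by (metis assoc ic pwr.simps(1))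
next
  case (Suc n)
  have "om x \<odot> pw x (Suc n) = pw x n \<odot> om x \<odot> x" using Suc by (simp add: assoc[symmetric])
  also have "\<dots> = pw x n \<odot> (x \<odot> om x)" by (metis assoc ic)
  finally show ?case by (simp add: assoc)
qed

lemma pw_om: "n \<ge> N \<Longrightarrow> pw x n \<odot> om x = pw x n"
proof (induction n rule: dec_induct)
  case base show ?case by (rule ip)
next
  case (step n)
  have "pw x (Suc n) \<odot> om x = x \<odot> (pw x n \<odot> om x)" using pw_comm[of x n] by (simp add: assoc)
  then show ?case using step pw_comm[of x n] by simp
qed

lemma om_pw: "n \<ge> N \<Longrightarrow> om x \<odot> pw x n = pw x n"
  by (simp add: om_pw_comm pw_om)

lemma om_rS: "u \<in> rS (pw x n) \<Longrightarrow> n \<ge> N \<Longrightarrow> om x \<odot> u = u"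
  using om_pw[of n x] by (auto simp: rS_def assoc[symmetric])

text \<open>Iteration gives \<open>u = t^(n+1) u\<close> for all \<open>n\<close>, so
  \<open>u\<close> is a right multiple of a power of \<open>t\<close> high enough to absorb
  \<open>om t\<close>.\<close>

lemma left_fix: assumes "u = t \<odot> u" shows "om t \<odot> u = u"
proof -
  have "u = pw t n \<odot> u" for n by (induction n) (use assms in \<open>auto simp: assoc\<close>)
  then have "u \<in> rS (pw t N)" unfolding rS_def by blast
  then show ?thesis by (rule om_rS) simp
qed

text \<open>This and \<open>eval_cyclic_letter\<close> control the left factor of an identity
  \<open>U = t U\<close> once all letters but one are collapsed to an idempotent left unit of
  \<open>u\<close>. In the second lemma the idempotent is itself a right multiple of
  \<open>u\<close>, which pushes the value towards multiples of \<open>u^2\<close>.\<close>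

lemma eval_unit_letter:
  assumes "e \<odot> e = e" "e \<odot> u = u" and "\<And>i. i \<in> uvars t \<Longrightarrow> \<rho> i = (if i = j then u else e)"
  shows "(j \<notin> uvars t \<and> ue \<rho> t = e) \<or> ue \<rho> t \<in> rS u"
  using assms(3)
proof (induction t)
  case (UVar i) then show ?case by auto
next
  case (UMul s t)
  have "e \<odot> x \<in> rS u" if "x \<in> rS u" for x using that assms rS_lmul by metis
  moreover have "(j \<notin> uvars s \<and> ue \<rho> s = e) \<or> ue \<rho> s \<in> rS u" "(j \<notin> uvars t \<and> ue \<rho> t = e) \<or> ue \<rho> t \<in> rS u"
    using UMul by auto
  ultimately show ?case
    by (elim disjE conjE) (simp_all add: assms(1,2) rS_mul)
next
  case (UInv t)
  then show ?case using iv_idem[OF assms(1)] iv_rS by auto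
qed

lemma eval_cyclic_letter:
  assumes "e \<odot> e = e" "e \<odot> u = u" "e = u \<odot> k"
    and "\<And>i. i \<in> uvars t \<Longrightarrow> \<rho> i = (if i = j then u else e)"
  shows "(j \<notin> uvars t \<and> ue \<rho> t = e) \<or> ue \<rho> t = u \<or> ue \<rho> t \<in> rS (u \<odot> u)"
  using assms(4)
proof (induction t)
  case (UVar i) then show ?case by auto
next
  case (UMul s t)
  have 1: "e \<odot> x \<in> rS (u \<odot> u)" if "x \<in> rS (u \<odot> u)" for x
    using that rS_lmul[OF that, of e] assms(2) by (simp add: assoc[symmetric])
  have 2: "u \<odot> x \<in> rS (u \<odot> u)" if "x \<in> rS (u \<odot> u)" for x
    using that by (auto simp: rS_def assoc[symmetric]) (auto simp: assoc)
  have 3: "u \<odot> e \<in> rS (u \<odot> u)" using assms(3) by (auto simp: rS_def assoc)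
  have "(j \<notin> uvars s \<and> ue \<rho> s = e) \<or> ue \<rho> s = u \<or> ue \<rho> s \<in> rS (u \<odot> u)"
    "(j \<notin> uvars t \<and> ue \<rho> t = e) \<or> ue \<rho> t = u \<or> ue \<rho> t \<in> rS (u \<odot> u)"
    using UMul by auto
  then show ?case using 1 2 3 assms(1,2)
    by (elim disjE conjE) (simp_all add: rS_mul)
next
  case (UInv t)
  have "iv u = u \<odot> u \<odot> (iv u \<odot> iv u \<odot> iv u)" using iv_expand by (metis assoc)
  then have "iv u \<in> rS (u \<odot> u)" by (metis rS_self_mul)
  with UInv show ?case using iv_idem[OF assms(1)] iv_rS by auto
qed

lemma pw_ge: obtains k where "2 ^ k - 1 \<ge> (n::nat)"
  by (metis Suc_leI less_exp order_refl diff_Suc_1 diff_le_mono)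

lemma lp_idem: "e \<odot> e = e \<Longrightarrow> lp (replicate (Suc n) e) = e"
  unfolding lp_replicate by (induction n) auto

lemma lp_idem_left: "e \<odot> e = e \<Longrightarrow> e \<odot> u = u \<Longrightarrow> lp (replicate n e @ [u]) = u"
  by (induction n) (auto simp: lp_Cons)

text \<open>Replacing all letters but the last by an idempotent that fixes \<open>u\<close> turns the identity into an
  equation between \<open>u\<close> and a right multiple of \<open>u\<^sup>2\<close>; iterating, \<open>u\<close> becomes a right multiple of
  all its powers.\<close>

lemma left_open_power:
  assumes id: "\<And>\<rho>. lp (map \<rho> [0..<Suc j]) = ue \<rho> t \<odot> lp (map \<rho> [0..<Suc j])"
    and vars: "uvars t \<subseteq> {..j}" "j \<in> uvars t"
  shows "om (lp (map \<rho> [0..<Suc j])) \<odot> lp (map \<rho> [0..<Suc j]) = lp (map \<rho> [0..<Suc j])"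
proof -
  define U where "U \<rho> = lp (map \<rho> [0..<Suc j])" for \<rho>
  have U_id: "U \<rho> = ue \<rho> t \<odot> U \<rho>" for \<rho> using id unfolding U_def .
  have U_spec: "U (\<lambda>i. if i = j then u else e) = u" if "e \<odot> e = e" "e \<odot> u = u" for e u
  proof -
    have "map (\<lambda>i. if i = j then u else e) [0..<Suc j] = replicate j e @ [u]"
      by (auto intro!: nth_equalityI simp: nth_append)
    then show ?thesis unfolding U_def using lp_idem_left that by simp
  qed
  have step: "U \<rho> \<in> rS (U \<rho> \<odot> U \<rho>)" for \<rho>
  proof -
    define u where "u = U \<rho>"
    define e where "e = om (ue \<rho> t)"
    have e: "e \<odot> e = e" "e \<odot> u = u" unfolding e_def u_def using om_idem left_fix U_id by metis+
    define \<rho>1 where "\<rho>1 = (\<lambda>i. if i = j then u else e)"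
    have U1: "U \<rho>1 = u" unfolding \<rho>1_def by (rule U_spec[OF e])
    have v1: "ue \<rho>1 t \<in> rS u" using eval_unit_letter[OF e, of t \<rho>1 j] vars by (auto simp: \<rho>1_def)
    \<comment> \<open>A second specialisation: after the first one the value of \<open>t\<close>
      starts with \<open>u\<close>, because the letter \<open>j\<close> occurs in \<open>t\<close>.
      Its idempotent therefore has the form \<open>u k\<close> that
      \<open>eval_cyclic_letter\<close> asks for.\<close>
    define e' where "e' = om (ue \<rho>1 t)"
    have e': "e' \<odot> e' = e'" "e' \<odot> u = u" unfolding e'_def using om_idem left_fix U_id U1 by metis+
    obtain k where k: "e' = u \<odot> k" using v1 unfolding e'_def rS_def by (auto simp: assoc)
    define \<rho>2 where "\<rho>2 = (\<lambda>i. if i = j then u else e')"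
    have U2: "U \<rho>2 = u" unfolding \<rho>2_def by (rule U_spec[OF e'])
    have "ue \<rho>2 t = u \<or> ue \<rho>2 t \<in> rS (u \<odot> u)"
      using eval_cyclic_letter[OF e' k, of t \<rho>2 j] vars by (auto simp: \<rho>2_def)
    then have "ue \<rho>2 t \<odot> u \<in> rS (u \<odot> u)" by (auto intro: rS_mul)
    then show ?thesis using U_id[of \<rho>2] U2 unfolding u_def by simp
  qed
  define u where "u = U \<rho>"
  have pow: "pw u n \<in> rS (pw u (Suc (n + n)))" for n
  proof (cases n)
    case 0 then show ?thesis using step[of \<rho>] by (simp add: u_def)
  next
    case (Suc k)
    \<comment> \<open>Multiplying the value of the last letter by a power of \<open>u\<close> turns
      the value of the word into a higher power of \<open>u\<close>, so that \<open>step\<close>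
      applies to powers as well.\<close>
    define \<rho>' where "\<rho>' = (\<lambda>i. if i = j then \<rho> j \<odot> pw u k else \<rho> i)"
    have 1: "map \<rho>' [0..<j] = map \<rho> [0..<j]" by (auto simp: \<rho>'_def)
    have 2: "\<rho>' j = \<rho> j \<odot> pw u k" by (simp add: \<rho>'_def)
    have 3: "map \<rho>' [0..<Suc j] = map \<rho> [0..<j] @ [\<rho> j \<odot> pw u k]"
      by (simp only: upt_Suc le0 if_True map_append list.map 1 2)
    have "U \<rho>' = U \<rho> \<odot> pw u k"
      unfolding U_def 3 by (cases "j = 0") (auto simp: lp_append assoc)
    then have "U \<rho>' = pw u n" by (simp add: Suc u_def pw_comm)
    then show ?thesis using step[of \<rho>'] by (simp add: pw_add)
  qed
  \<comment> \<open>With shifted exponents this is divisibility by the power \<open>2^k\<close>;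
    each use of \<open>pow\<close> doubles the exponent.\<close>
  have "u \<in> rS (pw u (2 ^ k - 1))" for k
  proof (induction k)
    case (Suc k)
    have "Suc ((2 ^ k - 1) + (2 ^ k - 1)) = 2 ^ Suc k - (1::nat)"
      using one_le_power[of "2::nat" k] by (simp only: power_Suc) arith
    then show ?case using Suc pow[of "2 ^ k - 1"] rS_trans by metis
  qed simp
  then have "om u \<odot> u = u" using pw_ge[of N] om_rS by metis
  then show ?thesis unfolding u_def U_def .
qed

text \<open>Meant for \<open>u = g h\<close> with the idempotent \<open>f\<close> in between.
  Prefixing a value by \<open>g\<close> gives a multiple of \<open>g^2\<close> if it starts with
  \<open>g\<close> or \<open>f g\<close>; if it starts with \<open>h\<close> and the letter
  \<open>a\<close> occurs, a later \<open>g\<close> follows and \<open>u\<close> acquires a right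
  factor that it can absorb.\<close>

lemma eval_two_letters:
  assumes f: "f \<odot> f = f" "g \<odot> f = g" "f \<odot> h = h" and "a \<noteq> b"
    and "\<And>i. i \<in> uvars t \<Longrightarrow> \<rho> i = (if i = a then g else if i = b then h else f)"
  shows "(a \<notin> uvars t \<and> b \<notin> uvars t \<and> ue \<rho> t = f) \<or> ue \<rho> t \<in> rS g \<union> rS (f \<odot> g) \<or>
    (ue \<rho> t \<in> rS h \<and> (a \<in> uvars t \<longrightarrow> (\<exists>p\<in>rS h. \<exists>y\<in>rS g. ue \<rho> t = p \<odot> y)))"
  using assms(5)
proof (induction t)
  case (UVar i) then show ?case using \<open>a \<noteq> b\<close> by auto
next
  case (UMul s t)
  let ?A = "\<lambda>t. a \<notin> uvars t \<and> b \<notin> uvars t \<and> ue \<rho> t = f"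
  let ?B = "\<lambda>t. ue \<rho> t \<in> rS g \<union> rS (f \<odot> g)"
  let ?C = "\<lambda>t. ue \<rho> t \<in> rS h \<and> (a \<in> uvars t \<longrightarrow> (\<exists>p\<in>rS h. \<exists>y\<in>rS g. ue \<rho> t = p \<odot> y))"
  have fB: "f \<odot> x \<in> rS g \<union> rS (f \<odot> g)" if "x \<in> rS g \<union> rS (f \<odot> g)" for x
    using that rS_lmul[of x g f] rS_lmul[of x "f \<odot> g" f] f by (auto simp: assoc[symmetric])
  have fh: "f \<odot> x = x" if "x \<in> rS h" for x using that f by (auto simp: rS_def assoc[symmetric])
  have s: "?A s \<or> ?B s \<or> ?C s" and t: "?A t \<or> ?B t \<or> ?C t" using UMul by auto
  from s consider "?A s" | "?B s" | "?C s" by blast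
  then show ?case
  proof cases
    case 1
    then have e: "ue \<rho> (UMul s t) = f \<odot> ue \<rho> t" by simp
    from t consider "?A t" | "?B t" | "?C t" by blast
    then show ?thesis
    proof cases
      case 3
      then have "ue \<rho> (UMul s t) = ue \<rho> t" using e fh by simp
      then show ?thesis using 3 \<open>?A s\<close> by simp
    qed (use e f fB 1 in auto)
  next
    case 2
    then have "?B (UMul s t)" by (auto intro: rS_mul)
    then show ?thesis by blast
  next
    case 3
    have "?C (UMul s t)"
    proof (intro conjI impI)
      show "ue \<rho> (UMul s t) \<in> rS h" using 3 by (auto intro: rS_mul)
      assume a: "a \<in> uvars (UMul s t)"
      show "\<exists>p\<in>rS h. \<exists>y\<in>rS g. ue \<rho> (UMul s t) = p \<odot> y"
      proof (cases "a \<in> uvars s")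
        case True
        with 3 obtain p y where "p \<in> rS h" "y \<in> rS g" "ue \<rho> s = p \<odot> y" by blast
        then show ?thesis by (intro bexI[of _ p] bexI[of _ "y \<odot> ue \<rho> t"]) (auto simp: assoc intro: rS_mul)
      next
        case False
        with a have "a \<in> uvars t" by simp
        with t consider "ue \<rho> t \<in> rS g" | "ue \<rho> t \<in> rS (f \<odot> g)"
          | p y where "p \<in> rS h" "y \<in> rS g" "ue \<rho> t = p \<odot> y" by blast
        then show ?thesis
        proof cases
          case 1 then show ?thesis using 3 by auto
        next
          case 2
          then have "\<exists>y\<in>rS g. ue \<rho> t = f \<odot> y" unfolding rS_def by (auto simp: assoc)
          then obtain y where "y \<in> rS g" "ue \<rho> t = f \<odot> y" by blast
          then show ?thesis using 3 by (intro bexI[of _ "ue \<rho> s \<odot> f"] bexI[of _ y]) (auto simp: assoc intro: rS_mul)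
        next
          case k3: (3 p y)
          then show ?thesis using 3
            by (intro bexI[of _ "ue \<rho> s \<odot> p"] bexI[of _ y]) (auto simp: assoc intro: rS_mul)
        qed
      qed
    qed
    then show ?thesis by blast
  qed
next
  case (UInv t)
  have "\<exists>p\<in>rS h. \<exists>y\<in>rS g. iv (ue \<rho> t) = p \<odot> y" if "\<exists>p\<in>rS h. \<exists>y\<in>rS g. ue \<rho> t = p \<odot> y"
  proof -
    from that obtain p y where "p \<in> rS h" "y \<in> rS g" "ue \<rho> t = p \<odot> y" by blast
    then show ?thesis using iv_expand[of "ue \<rho> t"]
      by (intro bexI[of _ p] bexI[of _ "y \<odot> (iv (ue \<rho> t) \<odot> iv (ue \<rho> t))"]) (auto simp: assoc intro: rS_mul)
  qed
  with UInv show ?case using iv_idem[OF f(1)] iv_rS by auto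
qed

section \<open>Products of a prescribed number of factors\<close>

definition T :: "nat \<Rightarrow> 'a set" where "T n = {lp xs |xs. length xs = n}"

lemma T_add: "x \<in> T n \<Longrightarrow> y \<in> T m \<Longrightarrow> n \<ge> 1 \<Longrightarrow> m \<ge> 1 \<Longrightarrow> x \<odot> y \<in> T (n + m)"
  unfolding T_def by (auto, rule_tac x="xs @ xsa" in exI) (auto simp: lp_append Suc_le_eq)

lemma T_split: assumes "x \<in> T (n + m)" "n \<ge> 1" "m \<ge> 1"
  obtains y z where "x = y \<odot> z" "y \<in> T n" "z \<in> T m"
proof -
  obtain xs where "x = lp xs" "length xs = n + m" using assms by (auto simp: T_def)
  moreover have "lp (take n xs @ drop n xs) = lp (take n xs) \<odot> lp (drop n xs)"
    using calculation assms by (intro lp_append) auto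
  ultimately have "x = lp (take n xs) \<odot> lp (drop n xs)" "lp (take n xs) \<in> T n" "lp (drop n xs) \<in> T m"
    unfolding T_def by auto
  then show thesis using that by blast
qed

lemma T_1: "T (Suc 0) = UNIV"
proof -
  have "x \<in> T (Suc 0)" for x unfolding T_def by (intro CollectI exI[of _ "[x]"]) auto
  then show ?thesis by auto
qed

lemma T_down: "x \<in> T n \<Longrightarrow> 1 \<le> k \<Longrightarrow> k \<le> n \<Longrightarrow> x \<in> T k"
proof (induction n)
  case (Suc n)
  show ?case
  proof (cases "k = Suc n")
    case True then show ?thesis using Suc by simp
  next
    case False
    have "x \<in> T n"
    proof (cases "n = 1")
      case True then show ?thesis by (simp add: T_1)
    next
      case n: False
      have "x \<in> T (2 + (n - 1))" "1 \<le> n - 1" using Suc False n by auto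
      then obtain y z where "x = y \<odot> z" "y \<in> T 2" "z \<in> T (n - 1)"
        by (metis T_split one_le_numeral)
      moreover have "y \<in> T 1" by (simp add: T_1)
      ultimately show ?thesis using T_add[of y 1 z "n - 1"] Suc False n by simp
    qed
    then show ?thesis using Suc False by simp
  qed
qed simp

end

abbreviation "ucat \<equiv> lprod UMul"

lemma ucat_Cons: "xs \<noteq> [] \<Longrightarrow> ucat (x # xs) = UMul x (ucat xs)" by (cases xs) auto

lemma uvars_ucat: "as \<noteq> [] \<Longrightarrow> uvars (ucat as) = (\<Union>a\<in>set as. uvars a)"
  by (induction UMul as rule: lprod.induct) auto

context semigrp begin
lemma uev_ucat: "as \<noteq> [] \<Longrightarrow> uev (\<odot>) g \<rho> (ucat as) = lp (map (uev (\<odot>) g \<rho>) as)"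
  by (induction UMul as rule: lprod.induct) auto
end

text \<open>An identity \<open>x\<^sub>0\<dots>x\<^sub>m\<^sub>-\<^sub>1 \<approx> L\<close> whose sides have longest common prefix of length
  \<open>lam\<close>. The assumption \<open>zero\<close> is achieved by discarding the initial letters that occur nowhere else in
  \<open>L\<close>.\<close>

locale epi_semigrp_ident = epi_semigrp +
  fixes m :: nat and L t :: "uterm list" and lam :: nat
  assumes H: "length ys = m \<Longrightarrow> lp ys = lp (map (ue ((!) ys)) L)"
    and L_def: "L = map UVar [0..<lam] @ t"
    and t: "t \<noteq> []" "hd t \<noteq> UVar lam"
    and lam: "lam < m"
    and vars: "a \<in> set L \<Longrightarrow> uvars a \<subseteq> {..<m}"
    and long: "(\<exists>w. UInv w \<in> set L) \<or> length L > m"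
    and atoms: "a \<in> set L \<Longrightarrow> (\<exists>i. a = UVar i) \<or> (\<exists>w. a = UInv w)"
    and zero: "lam = 0 \<or> (\<exists>a\<in>set t. 0 \<in> uvars a)"
begin

lemma H': "lp (map \<rho> [0..<m]) = lp (map (ue \<rho>) L)"
proof -
  have "ue ((!) (map \<rho> [0..<m])) a = ue \<rho> a" if "a \<in> set L" for a
    using vars[OF that] by (intro uev_cong) auto
  then have *: "map (ue ((!) (map \<rho> [0..<m]))) L = map (ue \<rho>) L" by simp
  have l: "length (map \<rho> [0..<m]) = m" by simp
  show ?thesis using H[OF l] unfolding * .
qed

lemma om_iv: "om a \<odot> iv a = iv a" by (metis ic ir)

lemma iv_lengthen: "lp (replicate n (om a) @ [iv a]) = iv a"
  by (rule lp_idem_left) (auto simp: om_idem om_iv)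

text \<open>An inverse can be preceded by any number of copies of its idempotent, and a word longer
  than \<open>m\<close> has more factors anyway; merging leaves exactly \<open>m + 1\<close>. Hence
  every product of \<open>m\<close> factors has factorisations of any greater length, which later
  supplies as much context as wanted.\<close>

lemma T_up1: assumes "x \<in> T m" shows "x \<in> T (Suc m)"
proof -
  obtain ys where ys: "x = lp ys" "length ys = m" using assms by (auto simp: T_def)
  let ?f = "map (ue ((!) ys))"
  have x: "x = lp (?f L)" using H ys by simp
  have "\<exists>k\<ge>Suc m. x \<in> T k"
  proof (cases "\<exists>w. UInv w \<in> set L")
    case True
    then obtain w L1 L2 where L: "L = L1 @ UInv w # L2" by (metis split_list)
    define a where "a = ue ((!) ys) w"
    have "x = lp (?f L1 @ [iv a] @ ?f L2)" using x L by (simp add: a_def)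
    also have "\<dots> = lp (?f L1 @ (replicate m (om a) @ [iv a]) @ ?f L2)"
      by (rule lp_replace) (auto simp: iv_lengthen)
    finally show ?thesis unfolding T_def
      by (intro exI[of _ "length L1 + Suc m + length L2"] conjI CollectI exI) auto
  next
    case False
    then have "length (?f L) \<ge> Suc m" using long by simp
    then show ?thesis using x unfolding T_def by blast
  qed
  then show ?thesis using T_down by (metis le_add1 plus_1_eq_Suc)
qed

lemma T_up: assumes "x \<in> T m" shows "x \<in> T (m + k)"
proof (induction k)
  case (Suc k)
  show ?case
  proof (cases k)
    case 0 then show ?thesis using T_up1 assms by simp
  next
    case (Suc j)
    then obtain y z where "x = y \<odot> z" "y \<in> T m" "z \<in> T k"
      using T_split[of x m k] lam \<open>x \<in> T (m + k)\<close> by auto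
    then show ?thesis using T_add[of y "Suc m" z k] T_up1 Suc by simp
  qed
qed (use assms in simp)

lemma split_into_blocks: assumes "x \<in> T m" "n \<ge> 1"
  obtains bs where "length bs = n" "set bs \<subseteq> T m" "lp bs = x"
proof -
  have "\<exists>bs. length bs = n \<and> set bs \<subseteq> T m \<and> lp bs = x"
    using assms(2,1)
  proof (induction n arbitrary: x rule: dec_induct)
    case base then show ?case by (intro exI[of _ "[x]"]) auto
  next
    case (step n)
    obtain y z where yz: "x = y \<odot> z" "y \<in> T m" "z \<in> T m"
      using T_split[OF T_up[OF step.prems, of m]] lam by auto
    obtain bs where "length bs = n" "set bs \<subseteq> T m" "lp bs = z" using step.IH[OF yz(3)] by blast
    moreover from this have "bs \<noteq> []" using step.hyps by auto
    ultimately show ?case using yz step.hyps by (intro exI[of _ "y # bs"]) (auto simp: lp_Cons)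
  qed
  then show thesis using that by blast
qed

lemma T_lp: "length xs \<ge> m \<Longrightarrow> lp xs \<in> T m"
  using T_down[of "lp xs" "length xs" m] lam by (auto simp: T_def)

lemma regroup: assumes "length Ps \<ge> m" "n \<ge> 1"
  obtains bs where "length bs = n" "set bs \<subseteq> T m" "lp (Xs @ Ps @ Ys) = lp (Xs @ bs @ Ys)"
proof -
  obtain bs where "length bs = n" "set bs \<subseteq> T m" "lp bs = lp Ps" using split_into_blocks[OF T_lp] assms by metis
  moreover from this have "lp (Xs @ Ps @ Ys) = lp (Xs @ bs @ Ys)"
    using assms lam by (intro lp_replace) auto
  ultimately show thesis using that by blast
qed

text \<open>When \<open>L\<close> is a word, the identity shifts letters, so that any factor \<open>z\<close> deep inside a long product
  can be doubled; repeating this produces the idempotent power of \<open>z\<close>.\<close>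

definition W :: "'a \<Rightarrow> 'a set" where
  "W z = {lp (Ps @ z # Qs) |Ps Qs. length Ps \<ge> m \<and> length Qs \<ge> m}"

lemma W_sq: assumes "length Ps \<ge> m" "length Qs \<ge> m" shows "lp (Ps @ z # z # Qs) \<in> W (z \<odot> z)"
proof -
  have "lp (Ps @ [z, z] @ Qs) = lp (Ps @ [z \<odot> z] @ Qs)" by (rule lp_replace) auto
  then show ?thesis using assms unfolding W_def by auto
qed

context
  fixes w assumes w: "L = map UVar w" and lw: "length w > m"
begin

lemma w_split: obtains s w' where "w = [0..<lam] @ s # w'" "s \<noteq> lam" "s < m"
proof -
  have "take lam w = [0..<lam]"
    using arg_cong[OF w[unfolded L_def], of "take lam"]
    by (auto simp: take_map intro!: map_injective[of UVar] injI)
  moreover have tt: "t = map UVar (drop lam w)" using arg_cong[OF w[unfolded L_def], of "drop lam"] by (simp add: drop_map)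
  moreover obtain s w' where sw: "drop lam w = s # w'" using t tt by (cases "drop lam w") auto
  moreover have "s \<noteq> lam" using t tt sw by auto
  moreover have "w = [0..<lam] @ s # w'" using calculation by (metis append_take_drop_id)
  moreover have "s < m" using vars[of "UVar s"] w calculation(5) by auto
  ultimately show thesis using that by blast
qed

lemma ident_word: "length ys = m \<Longrightarrow> lp ys = lp (map ((!) ys) w)"
  using H[of ys] w by (simp add: comp_def)

text \<open>The first deviating letter of the right side comes from further to the right in the
  word. With \<open>z\<close> in its place the identity brings \<open>z\<close> forward, directly
  behind the common prefix.\<close>

lemma pull_right:
  assumes "w = [0..<lam] @ s # w'" "s > lam" "s < m"
    and "length Xs \<ge> lam" "length Ps \<ge> s - lam" "length Qs \<ge> m - 1 - s"
  obtains R where "lp (Xs @ Ps @ z # Qs) = lp (Xs @ z # R)"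
proof -
  define X1 X2 where "X1 = take (length Xs - lam) Xs" "X2 = drop (length Xs - lam) Xs"
  define P1 P2 where "P1 = take (s - lam - 1) Ps" "P2 = drop (s - lam - 1) Ps"
  define Q1 Q2 where "Q1 = take (m - 1 - s) Qs" "Q2 = drop (m - 1 - s) Qs"
  have len: "length X2 = lam" "length P1 = s - lam - 1" "P2 \<noteq> []" "length Q1 = m - 1 - s"
    using assms by (auto simp: X1_X2_def P1_P2_def Q1_Q2_def)
  have sp: "Xs = X1 @ X2" "Ps = P1 @ P2" "Qs = Q1 @ Q2" by (auto simp: X1_X2_def P1_P2_def Q1_Q2_def)
  define ys where "ys = X2 @ P1 @ [lp P2] @ z # Q1"
  have l: "length ys = m" using len assms by (auto simp: ys_def)
  have 1: "map ((!) ys) [0..<lam] = X2" using len by (auto intro!: nth_equalityI simp: ys_def nth_append)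
  have "length (X2 @ P1 @ [lp P2]) = s" using len assms by simp
  moreover have "ys = (X2 @ P1 @ [lp P2]) @ z # Q1" by (simp add: ys_def)
  ultimately have 2: "ys ! s = z" by (metis nth_append_length)
  have 3: "lp ys = lp (X2 @ z # map ((!) ys) w')" using ident_word[OF l] assms(1) 1 2 by simp
  have "lp (Xs @ Ps @ z # Qs) = lp ((X1 @ X2 @ P1) @ P2 @ (z # Q1 @ Q2))" using sp by simp
  also have "\<dots> = lp ((X1 @ X2 @ P1) @ [lp P2] @ (z # Q1 @ Q2))" using len by (intro lp_mid)
  also have "\<dots> = lp (X1 @ ys @ Q2)" by (simp add: ys_def)
  also have "\<dots> = lp (X1 @ (X2 @ z # map ((!) ys) w') @ Q2)" using 3 by (intro lp_replace) (auto simp: ys_def)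
  finally have "lp (Xs @ Ps @ z # Qs) = lp (Xs @ z # map ((!) ys) w' @ Q2)" using sp by simp
  then show thesis using that by blast
qed

text \<open>The first deviating letter of the right side already stands in the common prefix, so
  \<open>z\<close> put in its place occurs again right after the prefix. \<open>Ps\<close> must be
  compressed to the \<open>lam - 1 - s\<close> letters between the two occurrences; if there are
  none, it has to be empty, whence the conditional hypothesis.\<close>

lemma pull_left:
  assumes "w = [0..<lam] @ s # w'" "s < lam"
    and "length Xs \<ge> s" "if lam = Suc s then Ps = [] else length Ps \<ge> lam - 1 - s" "length Qs \<ge> m - lam"
  obtains R where "lp (Xs @ z # Ps @ Qs) = lp (Xs @ z # Ps @ z # R)"
proof -
  define X1 X2 where "X1 = take (length Xs - s) Xs" "X2 = drop (length Xs - s) Xs"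
  define Q1 Q2 where "Q1 = take (m - lam) Qs" "Q2 = drop (m - lam) Qs"
  obtain P where P: "length P = lam - 1 - s" and PP: "\<And>As Bs. lp (As @ Ps @ Bs) = lp (As @ P @ Bs)"
  proof (cases "lam = Suc s")
    case True then show ?thesis using assms that[of Ps] by simp
  next
    case False
    define P1 P2 where "P1 = take (lam - s - 2) Ps" "P2 = drop (lam - s - 2) Ps"
    have "lp (As @ Ps @ Bs) = lp (As @ (P1 @ [lp P2]) @ Bs)" for As Bs
    proof -
      have "Ps = P1 @ P2" "P2 \<noteq> []" using assms False by (auto simp: P1_P2_def)
      then show ?thesis using lp_mid[of P2 "As @ P1" Bs] by simp
    qed
    moreover have "length (P1 @ [lp P2]) = lam - 1 - s" using assms False by (auto simp: P1_P2_def)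
    ultimately show ?thesis using that by blast
  qed
  have len: "length X2 = s" "length Q1 = m - lam" using assms by (auto simp: X1_X2_def Q1_Q2_def)
  have sp: "Xs = X1 @ X2" "Qs = Q1 @ Q2" by (auto simp: X1_X2_def Q1_Q2_def)
  define ys where "ys = (X2 @ z # P) @ Q1"
  have l: "length ys = m" using len assms P lam by (auto simp: ys_def)
  have "map ((!) ys) [0..<lam] = take lam ys" using l lam by (auto intro!: nth_equalityI)
  moreover have "length (X2 @ z # P) = lam" using len P assms by simp
  ultimately have 1: "map ((!) ys) [0..<lam] = X2 @ z # P" unfolding ys_def by (metis append_eq_conv_conj)
  have 2: "ys ! s = z" using len assms by (simp add: ys_def nth_append)
  have 3: "lp ys = lp ((X2 @ z # P) @ z # map ((!) ys) w')" using ident_word[OF l] assms(1) 1 2 by simp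
  have "lp (Xs @ z # Ps @ Qs) = lp (X1 @ ys @ Q2)" using PP[of "Xs @ [z]" Qs] sp by (simp add: ys_def)
  also have "\<dots> = lp (X1 @ ((X2 @ z # P) @ z # map ((!) ys) w') @ Q2)"
    using 3 by (intro lp_replace) (auto simp: ys_def)
  also have "\<dots> = lp (Xs @ z # Ps @ z # map ((!) ys) w' @ Q2)"
    using PP[of "Xs @ [z]" "z # map ((!) ys) w' @ Q2"] sp by simp
  finally show thesis using that by blast
qed

lemma square: assumes z: "z \<in> T m" and u: "u \<in> W z" shows "u \<in> W (z \<odot> z)"
proof -
  obtain s w' where ws: "w = [0..<lam] @ s # w'" "s \<noteq> lam" "s < m" by (rule w_split)
  obtain Ps Qs where PQ: "u = lp (Ps @ z # Qs)" "length Ps \<ge> m" "length Qs \<ge> m"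
    using u by (auto simp: W_def)
  show ?thesis
  proof (cases "s < lam")
    case False
    then have s: "s > lam" using ws by simp
    have "set w \<subseteq> {..<m}"
    proof
      fix x assume "x \<in> set w"
      then show "x \<in> {..<m}" using vars[of "UVar x"] w by auto
    qed
    then have "card (set w) \<le> m" by (metis card_lessThan card_mono finite_lessThan)
    \<comment> \<open>More than \<open>m\<close> places but at most \<open>m\<close> letters: some
      letter \<open>d\<close> is repeated, and \<open>z\<close> is put in its place.\<close>
    then have "\<not> distinct w" using lw distinct_card by fastforce
    then obtain C B D d where wd: "w = C @ [d] @ B @ [d] @ D" by (metis not_distinct_decomp)
    have dm: "d < m" using \<open>set w \<subseteq> {..<m}\<close> wd by auto
    obtain P' where P': "length P' = m + d" "set P' \<subseteq> T m" "u = lp (P' @ z # Qs)"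
      using regroup[of Ps "m + d" "[]" "z # Qs"] PQ lam by auto
    obtain Q' where Q': "length Q' = (m - 1 - d) + (m + m)" "set Q' \<subseteq> T m" "u = lp (P' @ z # Q')"
      using regroup[of Qs "(m - 1 - d) + (m + m)" "P' @ [z]" "[]"] P' PQ lam by auto
    define ys where "ys = drop m P' @ z # take (m - 1 - d) Q'"
    have l: "length ys = m" using P' Q' dm by (simp add: ys_def)
    have yd: "ys ! d = z" using P' by (simp add: ys_def nth_append)
    have yT: "y \<in> T m" if "y \<in> set ys" for y
      using that P' Q' z by (auto simp: ys_def dest: in_set_dropD in_set_takeD)
    let ?f = "map ((!) ys)"
    define Qa Qb where "Qa = take m (drop (m - 1 - d) Q')" "Qb = drop m (drop (m - 1 - d) Q')"
    have "Q' = take (m - 1 - d) Q' @ drop (m - 1 - d) Q'" "drop (m - 1 - d) Q' = Qa @ Qb"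
      by (simp_all only: append_take_drop_id Qa_Qb_def)
    then have Qab: "Q' = take (m - 1 - d) Q' @ Qa @ Qb" by metis
    have Qlen: "length Qa = m" "length Qb = m" using Q' by (simp_all add: Qa_Qb_def)
    define Pa where "Pa = take m P'"
    have Pa: "length Pa = m" using P' by (simp add: Pa_def)
    have "u = lp (Pa @ ys @ Qa @ Qb)"
      using Q'(3) Qab by (simp add: ys_def Pa_def) (metis append_assoc append_take_drop_id)
    also have "\<dots> = lp (Pa @ ?f w @ Qa @ Qb)"
      using ident_word[OF l] l lam wd by (intro lp_replace) auto
    also have "\<dots> = lp (Pa @ ?f C @ z # ?f B @ z # ?f D @ Qa @ Qb)" using wd yd by simp
    finally have u1: "u = lp (Pa @ ?f C @ z # ?f B @ z # ?f D @ Qa @ Qb)" .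
    show ?thesis
    proof (cases B)
      case Nil
      then show ?thesis using u1 W_sq[of "Pa @ ?f C" "?f D @ Qa @ Qb" z] Pa Qlen by simp
    next
      case (Cons b B')
      have "b \<in> set w" using wd Cons by auto
      then have bT: "ys ! b \<in> T m" using yT \<open>set w \<subseteq> {..<m}\<close> l by auto
      \<comment> \<open>The first factor between the two copies of \<open>z\<close> is split into
        \<open>m\<close> factors, enough for \<open>pull_right\<close> to bring the second copy next
        to the first.\<close>
      then obtain bb where bb: "ys ! b = lp bb" "length bb = m" by (auto simp: T_def)
      have "u = lp ((Pa @ ?f C @ [z]) @ [lp bb] @ (?f B' @ z # ?f D @ Qa @ Qb))"
        using u1 Cons bb by simp
      also have "\<dots> = lp ((Pa @ ?f C @ [z]) @ (bb @ ?f B') @ z # (?f D @ Qa) @ Qb)"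
        using lp_mid[of bb "Pa @ ?f C @ [z]" "?f B' @ z # ?f D @ Qa @ Qb", symmetric] bb lam by fastforce
      finally have u2: "u = lp ((Pa @ ?f C @ [z]) @ (bb @ ?f B') @ z # (?f D @ Qa) @ Qb)" .
      obtain R where R: "lp ((Pa @ ?f C @ [z]) @ (bb @ ?f B') @ z # (?f D @ Qa)) = lp ((Pa @ ?f C @ [z]) @ z # R)"
      proof (rule pull_right[OF ws(1) s ws(3)])
        show "lam \<le> length (Pa @ ?f C @ [z])" "s - lam \<le> length (bb @ ?f B')" "m - 1 - s \<le> length (?f D @ Qa)"
          using ws(3) Pa lam bb Qlen by auto
      qed
      have "u = lp ([] @ ((Pa @ ?f C @ [z]) @ z # R) @ Qb)"
        unfolding u2 using lp_replace[OF _ _ R, of "[]" Qb] by simp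
      then show ?thesis using W_sq[of "Pa @ ?f C" "R @ Qb" z] Pa Qlen by simp
    qed
  next
    case True
    obtain Q' where Q': "length Q' = 4 * m" "set Q' \<subseteq> T m" "u = lp (Ps @ z # Q')"
      using regroup[of Qs "4 * m" "Ps @ [z]" "[]"] PQ lam by auto
    show ?thesis
    proof (cases "lam = Suc s")
      case c: True
      obtain R where R: "lp (Ps @ z # [] @ take m Q') = lp (Ps @ z # [] @ z # R)"
      proof (rule pull_left[OF ws(1) True])
        show "s \<le> length Ps" "m - lam \<le> length (take m Q')" "if lam = Suc s then [] = [] else lam - 1 - s \<le> length []"
          using ws(3) PQ c Q' lam by auto
      qed
      have "u = lp ([] @ (Ps @ z # [] @ take m Q') @ drop m Q')" using Q' by simp
      also have "\<dots> = lp ([] @ (Ps @ z # [] @ z # R) @ drop m Q')" using R by (intro lp_replace) auto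
      finally show ?thesis using W_sq[of Ps "R @ drop m Q'" z] PQ Q' by simp
    next
      case c: False
      define r Q1 Qa Qb where "r = take m Q'" "Q1 = take m (drop m Q')"
        "Qa = take m (drop (2 * m) Q')" "Qb = drop (3 * m) Q'"
      note defs = r_Q1_Qa_Qb_def
      have Qsp: "Q' = r @ Q1 @ Qa @ Qb"
      proof -
        have "Q' = r @ Q1 @ drop m (drop m Q')" unfolding defs by (metis append_take_drop_id)
        also have "drop m (drop m Q') = Qa @ drop m (drop (2 * m) Q')" unfolding defs
          by (simp add: mult_2) (metis append_take_drop_id drop_drop)
        also have "drop m (drop (2 * m) Q') = Qb" unfolding defs by (simp add: algebra_simps)
        finally show ?thesis .
      qed
      have len: "length r = m" "length Q1 = m" "length Qa = m" "length Qb = m" using Q' by (auto simp: defs)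
      obtain R where R: "lp (Ps @ z # r @ Q1) = lp (Ps @ z # r @ z # R)"
      proof (rule pull_left[OF ws(1) True])
        show "s \<le> length Ps" "m - lam \<le> length Q1" "if lam = Suc s then r = [] else lam - 1 - s \<le> length r"
          using ws(3) PQ c len lam by auto
      qed
      obtain zs where zs: "z = lp zs" "length zs = m" using z by (auto simp: T_def)
      \<comment> \<open>The product now contains \<open>z r z\<close>. Copying
        \<open>v = z r\<close> across the second \<open>z\<close>, which is split into
        \<open>zs\<close>, gives \<open>z r z z r\<close> and with it the square.\<close>
      define v where "v = lp (z # r)"
      obtain R' where R': "lp (Ps @ v # zs @ (R @ Qa)) = lp (Ps @ v # zs @ v # R')"
      proof (rule pull_left[OF ws(1) True])
        show "s \<le> length Ps" "m - lam \<le> length (R @ Qa)" "if lam = Suc s then zs = [] else lam - 1 - s \<le> length zs"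
          using ws(3) PQ c len zs lam by auto
      qed
      have "u = lp ([] @ (Ps @ z # r @ Q1) @ (Qa @ Qb))" using Q'(3) Qsp by simp
      also have "\<dots> = lp ([] @ (Ps @ z # r @ z # R) @ (Qa @ Qb))" by (rule lp_replace) (auto simp: R)
      also have "\<dots> = lp (Ps @ (z # r) @ (z # R @ Qa @ Qb))" by simp
      also have "\<dots> = lp (Ps @ [v] @ (z # R @ Qa @ Qb))" unfolding v_def by (rule lp_mid) simp
      also have "\<dots> = lp ((Ps @ [v]) @ [lp zs] @ (R @ Qa @ Qb))" using zs by simp
      also have "\<dots> = lp ((Ps @ [v]) @ zs @ (R @ Qa @ Qb))" using zs lam by (intro lp_mid[symmetric]) auto
      also have "\<dots> = lp ([] @ (Ps @ v # zs @ (R @ Qa)) @ Qb)" by simp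
      also have "\<dots> = lp ([] @ (Ps @ v # zs @ v # R') @ Qb)" by (rule lp_replace) (auto simp: R')
      also have "\<dots> = lp (Ps @ [v] @ zs @ v # R' @ Qb)" by simp
      also have "\<dots> = lp (Ps @ (z # r) @ zs @ v # R' @ Qb)" unfolding v_def by (rule lp_mid[symmetric]) simp
      also have "\<dots> = lp ((Ps @ z # r) @ zs @ (v # R' @ Qb))" by simp
      also have "\<dots> = lp ((Ps @ z # r) @ [lp zs] @ (v # R' @ Qb))" using zs lam by (intro lp_mid) auto
      also have "\<dots> = lp ((Ps @ z # r @ [z]) @ [v] @ (R' @ Qb))" using zs by simp
      also have "\<dots> = lp ((Ps @ z # r @ [z]) @ (z # r) @ (R' @ Qb))" unfolding v_def by (rule lp_mid[symmetric]) simp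
      finally have "u = lp ((Ps @ z # r) @ z # z # (r @ R' @ Qb))" by simp
      then show ?thesis using W_sq[of "Ps @ z # r" "r @ R' @ Qb" z] PQ len by simp
    qed
  qed
qed

lemma idem_factor_word: assumes "u \<in> T m" obtains A f B where "u = A \<odot> f \<odot> B" "f \<odot> f = f"
proof -
  obtain bs where bs: "length bs = Suc (m + m)" "set bs \<subseteq> T m" "lp bs = u" using split_into_blocks[OF assms] by (metis le_add1 plus_1_eq_Suc)
  define z where "z = bs ! m"
  have z: "z \<in> T m" using bs by (simp add: z_def subset_iff)
  have "bs = take m bs @ z # drop (Suc m) bs" using bs unfolding z_def by (simp add: id_take_nth_drop)
  then have "u \<in> W z" unfolding W_def using bs
    by (intro CollectI exI[of _ "take m bs"] exI[of _ "drop (Suc m) bs"]) auto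
  then have "u \<in> W (pw z (2 ^ k - 1)) \<and> pw z (2 ^ k - 1) \<in> T m" for k
  proof (induction k)
    case (Suc k)
    then have 1: "u \<in> W (pw z (2 ^ k - 1) \<odot> pw z (2 ^ k - 1))" using square by simp
    have 2: "pw z (2 ^ k - 1) \<odot> pw z (2 ^ k - 1) \<in> T m"
      using T_add[of "pw z (2 ^ k - 1)" m "pw z (2 ^ k - 1)" m] Suc T_down[of _ "m + m" m] lam by auto
    have "Suc ((2 ^ k - 1) + (2 ^ k - 1)) = 2 ^ Suc k - (1::nat)"
      using one_le_power[of "2::nat" k] by (simp only: power_Suc) arith
    then show ?case using 1 2 by (simp only: pw_add)
  qed (use z in simp)
  then obtain n where n: "n \<ge> N" "u \<in> W (pw z n)" using pw_ge[of N] by metis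
  then obtain Ps Qs where PQ: "u = lp (Ps @ pw z n # Qs)" "length Ps \<ge> m" "length Qs \<ge> m" by (auto simp: W_def)
  then have "Ps \<noteq> []" "Qs \<noteq> []" using lam by auto
  then have "u = lp Ps \<odot> (pw z n \<odot> om z) \<odot> lp Qs" using PQ pw_om[OF n(1)] by (simp add: lp_append lp_Cons assoc)
  then have "u = (lp Ps \<odot> pw z n) \<odot> om z \<odot> lp Qs" by (simp add: assoc)
  then show thesis using that om_idem by blast
qed

end

lemma idem_factor: assumes "u \<in> T m" obtains A f B where "u = A \<odot> f \<odot> B" "f \<odot> f = f"
proof (cases "\<exists>w. UInv w \<in> set L")
  case True
  then obtain w L1 L2 where L: "L = L1 @ UInv w # L2" by (metis split_list)
  obtain bs where bs: "length bs = Suc (Suc m)" "lp bs = u" using split_into_blocks[OF assms] by (metis le_add1 plus_1_eq_Suc)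
  \<comment> \<open>The outer factors keep both sides of the idempotent nonempty, there being no
    empty product.\<close>
  obtain b0 ys b1 where b: "bs = b0 # ys @ [b1]" "length ys = m"
  proof -
    obtain b0 r where r: "bs = b0 # r" "length r = Suc m" using bs(1) by (metis length_Suc_conv)
    then have "r = butlast r @ [last r]" "length (butlast r) = m" by (cases r rule: rev_cases; simp)+
    then show thesis using that r by metis
  qed
  let ?f = "map (ue ((!) ys))"
  define a where "a = ue ((!) ys) w"
  have "u = lp ([b0] @ ys @ [b1])" using b bs by simp
  also have "\<dots> = lp ([b0] @ (?f L1 @ iv a # ?f L2) @ [b1])"
    using H[OF b(2)] L b lam by (intro lp_replace) (auto simp: a_def)
  also have "\<dots> = lp ((b0 # ?f L1) @ iv a # (?f L2 @ [b1]))" by simp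
  also have "\<dots> = lp (b0 # ?f L1) \<odot> (iv a \<odot> lp (?f L2 @ [b1]))"
    by (subst lp_append) (auto simp: lp_Cons)
  also have "\<dots> = lp (b0 # ?f L1) \<odot> om a \<odot> (iv a \<odot> lp (?f L2 @ [b1]))"
    using om_iv[of a] by (metis assoc)
  finally show thesis using that om_idem by blast
next
  case False
  then have "\<forall>a\<in>set L. \<exists>i. a = UVar i" using atoms by blast
  then obtain w where "L = map UVar w" by (metis ex_map_conv)
  then show thesis using idem_factor_word[of w, OF _ _ assms] long False that by auto
qed

lemma rS_idem: "f \<odot> f = f \<Longrightarrow> x \<in> rS f \<Longrightarrow> f \<odot> x = x"
  by (auto simp: rS_def assoc[symmetric])

text \<open>An element \<open>u = A f B\<close> with \<open>f\<close> idempotent is evaluated on \<open>A f, f, \<dots>, f, h\<close>: unless \<open>u\<close> has a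
  right unit it is a right multiple of arbitrarily high powers of \<open>A f\<close>.\<close>

lemma open_step: assumes "length ys = m"
  shows "\<exists>g. lp ys = g \<odot> lp ys \<or> lp ys = lp ys \<odot> g"
proof -
  define u where "u = lp ys"
  have uT: "u \<in> T m" using assms by (auto simp: u_def T_def)
  obtain A f B where uAB: "u = A \<odot> f \<odot> B" and f: "f \<odot> f = f" by (rule idem_factor[OF uT])
  obtain t0 t' where t0: "t = t0 # t'" using t by (cases t) auto
  show ?thesis
  proof (cases "lam = 0")
    case True
    then have L: "L = t0 # t'" using L_def t0 by simp
    consider s where "t0 = UVar s" | w where "t0 = UInv w" using atoms[of t0] L by auto
    then show ?thesis
    proof cases
      case 1
      then have s: "s \<noteq> 0" "s < m" using t t0 True vars[of t0] L by auto
      \<comment> \<open>With \<open>A\<close> for the first letter and \<open>f\<close> for all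
        others the left side is \<open>A f\<close>, whereas the right side starts with
        \<open>f\<close>. So \<open>f\<close> fixes \<open>A f\<close>, and hence
        \<open>u\<close>.\<close>
      define ys' where "ys' = A # replicate (m - 1) f"
      have l: "length ys' = m" using s by (simp add: ys'_def)
      have "lp ys' = A \<odot> f" unfolding ys'_def using s lp_idem[OF f, of "m - 2"]
        by (subst lp_Cons) (auto simp: Suc_diff_Suc numeral_2_eq_2)
      moreover have "ys' ! s = f" using s by (auto simp: ys'_def nth_Cons split: nat.splits)
      moreover have "lp ys' = lp (ys' ! s # map (ue ((!) ys')) t')" using H[OF l] 1 L by simp
      ultimately have "A \<odot> f \<in> rS f" by (metis rS_lp)
      then have "f \<odot> (A \<odot> f) = A \<odot> f" using rS_idem[OF f] by blast
      then have "u = f \<odot> u" unfolding uAB by (simp add: assoc[symmetric])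
      then show ?thesis unfolding u_def by blast
    next
      case 2
      have "u \<in> rS (iv (ue ((!) ys) w))" using H[OF assms] L 2 rS_lp unfolding u_def by simp
      then have "om (ue ((!) ys) w) \<odot> u = u" using om_iv by (auto simp: rS_def assoc[symmetric])
      then show ?thesis unfolding u_def by metis
    qed
  next
    case False
    have key: "(\<exists>c. u = u \<odot> c) \<or> u \<in> rS (g \<odot> g)"
      if gh: "u = g \<odot> h" "g \<odot> f = g" "f \<odot> h = h" for g h
    proof -
      \<comment> \<open>The word takes the value \<open>g h = u\<close>, and the common prefix,
        which ends before the last letter, takes the value \<open>g\<close>.\<close>
      define \<rho> where "\<rho> = (\<lambda>i. if i = 0 then g else if i = m - 1 then h else f)"
      have m2: "m \<ge> 2" using False lam by simp
      have g_abs: "lp (g # replicate n f) = g" for n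
        using gh(2) lp_idem[OF f] by (cases n) (auto simp: lp_Cons)
      have "map \<rho> [0..<m] = [g] @ (replicate (m - 2) f @ [h])"
        using m2 by (auto intro!: nth_equalityI simp: \<rho>_def nth_append nth_Cons split: nat.splits)
      then have 1: "lp (map \<rho> [0..<m]) = u" using lp_idem_left[OF f gh(3)] gh(1) by (simp add: lp_Cons)
      have "map \<rho> [0..<lam] = g # replicate (lam - 1) f"
        using False lam by (auto intro!: nth_equalityI simp: \<rho>_def nth_Cons split: nat.splits)
      then have 2: "lp (map (ue \<rho>) L) = g \<odot> ue \<rho> (ucat t)"
        using t False g_abs by (simp add: L_def comp_def uev_ucat lp_append[of "g # _", simplified])
      have u: "u = g \<odot> ue \<rho> (ucat t)" using H'[of \<rho>] 1 2 by simp
      \<comment> \<open>Here \<open>zero\<close> enters: as the letter carrying \<open>g\<close>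
        occurs in the tail, the value cannot be \<open>f\<close>, nor start with \<open>h\<close>
        without a later \<open>g\<close>.\<close>
      have v0: "0 \<in> uvars (ucat t)" using zero False t by (auto simp: uvars_ucat)
      consider "ue \<rho> (ucat t) \<in> rS g \<union> rS (f \<odot> g)"
        | p y where "p \<in> rS h" "y \<in> rS g" "ue \<rho> (ucat t) = p \<odot> y"
        using eval_two_letters[OF f gh(2,3), of 0 "m - 1" "ucat t" \<rho>] v0 m2 by (auto simp: \<rho>_def)
      then show ?thesis
      proof cases
        case 1
        have "g \<odot> x \<in> rS (g \<odot> g)" if "x \<in> rS g \<union> rS (f \<odot> g)" for x
          using that rS_lmul[of x g g] rS_lmul[of x "f \<odot> g" g] gh(2) by (auto simp: assoc[symmetric])
        then show ?thesis using 1 u by simp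
      next
        case 2
        then have "g \<odot> p \<in> rS u" using rS_lmul[of p h g] gh by simp
        then have "\<exists>c. g \<odot> p \<odot> y = u \<odot> c" unfolding rS_def by (elim insertE rangeE) (auto simp: assoc[of u])
        then show ?thesis using u 2 by (simp add: assoc[symmetric])
      qed
    qed
    define g where "g = A \<odot> f"
    have gf: "g \<odot> f = g" by (simp add: g_def f assoc)
    have pgf: "pw g n \<odot> f = pw g n" for n using gf by (cases n) (auto simp: assoc)
    show ?thesis
    proof (cases "\<exists>c. u = u \<odot> c")
      case True then show ?thesis unfolding u_def by blast
    next
      case nc: False
      have "u \<in> rS (pw g (2 ^ k - 1))" for k
      proof (induction k)
        case 0
        show ?case using uAB by (simp add: g_def)
      next
        case (Suc k)
        let ?p = "pw g (2 ^ k - 1)"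
        obtain h where "u = ?p \<odot> h" "f \<odot> h = h"
        proof -
          from Suc consider "u = ?p" | R where "u = ?p \<odot> R" by (auto simp: rS_def)
          then show ?thesis
          proof cases
            case 1 then show ?thesis using that[of f] pgf f by metis
          next
            case 2
            then show ?thesis using that[of "f \<odot> R"] pgf f by (metis assoc)
          qed
        qed
        then have 1: "u \<in> rS (?p \<odot> ?p)" using key[of ?p h] pgf nc by blast
        have "Suc ((2 ^ k - 1) + (2 ^ k - 1)) = 2 ^ Suc k - (1::nat)"
          using one_le_power[of "2::nat" k] by (simp only: power_Suc) arith
        then show ?case using 1 by (simp only: pw_add)
      qed
      then have "om g \<odot> u = u" using pw_ge[of N] om_rS by metis
      then show ?thesis unfolding u_def by metis
    qed
  qed
qed

end

section \<open>Equational theories\<close>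

abbreviation usub :: "(nat \<Rightarrow> uterm) \<Rightarrow> uterm \<Rightarrow> uterm" where "usub \<equiv> uev UMul UInv"
abbreviation uw :: "nat list \<Rightarrow> uterm" where "uw is \<equiv> ucat (map UVar is)"
abbreviation upow :: "uterm \<Rightarrow> nat \<Rightarrow> uterm" where "upow \<equiv> pwr UMul"

primrec hasinv :: "uterm \<Rightarrow> bool" where
  "hasinv (UVar i) \<longleftrightarrow> False"
| "hasinv (UMul s t) \<longleftrightarrow> hasinv s \<or> hasinv t"
| "hasinv (UInv s) \<longleftrightarrow> True"

primrec wd :: "uterm \<Rightarrow> nat list" where
  "wd (UVar i) = [i]"
| "wd (UMul s t) = wd s @ wd t"
| "wd (UInv s) = wd s"

lemma wd_ne [simp]: "wd t \<noteq> []" by (induction t) auto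
lemma set_wd: "set (wd t) = uvars t" by (induction t) auto
lemma flat_wd: "\<not> hasinv t \<Longrightarrow> flat t = map UVar (wd t)" by (induction t) auto
lemma hasinv_flat: "hasinv t \<longleftrightarrow> (\<exists>w. UInv w \<in> set (flat t))" by (induction t) auto

lemma usub_ucat: "xs \<noteq> [] \<Longrightarrow> usub \<sigma> (ucat xs) = ucat (map (usub \<sigma>) xs)"
  by (induction UMul xs rule: lprod.induct) auto

lemma usub_id [simp]: "usub UVar t = t" by (induction t) auto
lemma usub_usub: "usub \<sigma> (usub \<tau> t) = usub (\<lambda>i. usub \<sigma> (\<tau> i)) t" by (induction t) auto
lemma uvars_usub: "uvars (usub \<sigma> t) = (\<Union>i\<in>uvars t. uvars (\<sigma> i))" by (induction t) auto
lemma hasinv_usub: "hasinv t \<Longrightarrow> hasinv (usub \<sigma> t)" by (induction t) auto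
lemma hasinv_usub_var: "i \<in> uvars t \<Longrightarrow> hasinv (\<sigma> i) \<Longrightarrow> hasinv (usub \<sigma> t)" by (induction t) auto
lemma usub_upow: "usub \<sigma> (upow t n) = upow (usub \<sigma> t) n" by (induction n) auto
lemma usub_cong: "(\<And>i. i \<in> uvars t \<Longrightarrow> \<sigma> i = \<tau> i) \<Longrightarrow> usub \<sigma> t = usub \<tau> t" by (rule uev_cong)

locale semigroup_theory =
  fixes \<theta> :: "(uterm \<times> uterm) set"
  assumes rfl [simp]: "(t, t) \<in> \<theta>"
    and sym: "(s, t) \<in> \<theta> \<Longrightarrow> (t, s) \<in> \<theta>"
    and trans: "(s, t) \<in> \<theta> \<Longrightarrow> (t, r) \<in> \<theta> \<Longrightarrow> (s, r) \<in> \<theta>"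
    and cmul: "(s, t) \<in> \<theta> \<Longrightarrow> (s', t') \<in> \<theta> \<Longrightarrow> (UMul s s', UMul t t') \<in> \<theta>"
    and asc: "(UMul (UMul s t) r, UMul s (UMul t r)) \<in> \<theta>"
begin

text \<open>Choosing representatives makes the congruence an equality: \<open>qm\<close> is a genuine associative operation on
  all terms (every product is a representative), so the results on semigroups apply to theories
  without forming a quotient type.\<close>

definition q :: "uterm \<Rightarrow> uterm" where "q s = (SOME t. (s, t) \<in> \<theta>)"

lemma q_rel: "(s, q s) \<in> \<theta>" unfolding q_def by (rule someI[of _ s]) simp

lemma q_eq: "q s = q t \<longleftrightarrow> (s, t) \<in> \<theta>"
proof
  assume "q s = q t" then show "(s, t) \<in> \<theta>" by (metis q_rel sym trans)
next
  assume "(s, t) \<in> \<theta>"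
  then have "(s, r) \<in> \<theta> \<longleftrightarrow> (t, r) \<in> \<theta>" for r by (meson sym trans)
  then show "q s = q t" by (simp add: q_def)
qed

definition qm :: "uterm \<Rightarrow> uterm \<Rightarrow> uterm" where "qm s t = q (UMul s t)"

lemma q_q [simp]: "q (q s) = q s" using q_eq q_rel sym by blast

lemma q_simps [simp]: "qm (q s) t = qm s t" "qm s (q t) = qm s t" "q (qm s t) = qm s t"
  unfolding qm_def q_eq using q_rel sym cmul by (auto simp: q_eq)

lemma q_mul: "q (UMul s t) = qm s t" by (simp add: qm_def)

lemma qm_UMul: "qm (UMul s t) r = qm (qm s t) r" "qm r (UMul s t) = qm r (qm s t)"
  by (metis q_mul q_simps(1), metis q_mul q_simps(2))

sublocale semigrp qm
proof
  fix x y z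
  have "qm (qm x y) z = q (UMul (UMul x y) z)" by (metis q_mul q_simps(1))
  also have "\<dots> = q (UMul x (UMul y z))" unfolding q_eq by (rule asc)
  also have "\<dots> = qm x (qm y z)" by (metis q_mul q_simps(2))
  finally show "qm (qm x y) z = qm x (qm y z)" .
qed

lemma q_ucat: "xs \<noteq> [] \<Longrightarrow> q (ucat xs) = q (lp xs)"
proof (induction UMul xs rule: lprod.induct)
  case (3 x y xs)
  have "q (ucat (x # y # xs)) = qm x (q (ucat (y # xs)))" by (simp add: q_mul)
  also have "\<dots> = qm x (lp (y # xs))" using 3 by simp
  finally show ?case by simp
qed auto

text \<open>A product of one term is that term, which need not be a representative. This is why
  one-letter words are treated separately further on.\<close>

lemma q_ucat2: "length xs \<ge> 2 \<Longrightarrow> q (ucat xs) = lp xs"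
  using q_ucat[of xs] by (cases xs rule: remdups_adj.cases) auto

lemma q_upow: "q (upow s n) = q (pw s n)"
proof (induction n)
  case (Suc n)
  have "q (upow s (Suc n)) = qm (q (upow s n)) s" by (simp add: q_mul)
  then show ?case using Suc by simp
qed simp

lemma q_upow_Suc: "q (upow s (Suc n)) = pw s (Suc n)"
  using q_upow[of s "Suc n"] by simp

lemma cat_append: "xs \<noteq> [] \<Longrightarrow> ys \<noteq> [] \<Longrightarrow> (ucat (xs @ ys), UMul (ucat xs) (ucat ys)) \<in> \<theta>"
proof -
  assume a: "xs \<noteq> []" "ys \<noteq> []"
  have "q (ucat (xs @ ys)) = qm (q (lp xs)) (q (lp ys))" using a q_ucat[of "xs @ ys"] by (simp add: lp_append)
  also have "\<dots> = q (UMul (ucat xs) (ucat ys))"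
    using a q_ucat by (metis q_mul q_simps(1,2))
  finally show ?thesis unfolding q_eq .
qed

lemma cat_mid: "ys \<noteq> [] \<Longrightarrow> (ucat (xs @ ys @ zs), ucat (xs @ [ucat ys] @ zs)) \<in> \<theta>"
proof (induction xs)
  case Nil
  then show ?case using cat_append[of ys zs] by (cases "zs = []") (auto simp: ucat_Cons)
next
  case (Cons x xs)
  then show ?case using cmul[of x x] by (simp add: ucat_Cons)
qed

lemma cat_cong: "list_all2 (\<lambda>s t. (s, t) \<in> \<theta>) xs ys \<Longrightarrow> xs \<noteq> [] \<Longrightarrow> (ucat xs, ucat ys) \<in> \<theta>"
proof (induction rule: list_all2_induct)
  case (Cons x xs y ys)
  then show ?case by (cases "xs = []"; cases "ys = []") (auto simp: ucat_Cons cmul)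
qed simp

lemma cat_cong1: "(s, t) \<in> \<theta> \<Longrightarrow> (ucat (xs @ [s] @ ys), ucat (xs @ [t] @ ys)) \<in> \<theta>"
  by (rule cat_cong) (auto intro!: list_all2_appendI list_all2_refl)

lemma flat_cat: "(t, ucat (flat t)) \<in> \<theta>"
proof (induction t)
  case (UMul s t)
  have "(UMul s t, UMul (ucat (flat s)) (ucat (flat t))) \<in> \<theta>" using UMul cmul by blast
  then show ?case using cat_append[of "flat s" "flat t"] by (metis flat.simps(2) flat_ne sym trans)
qed auto

lemma wd_cat: "\<not> hasinv t \<Longrightarrow> (t, uw (wd t)) \<in> \<theta>"
  using flat_cat[of t] by (simp add: flat_wd)

text \<open>The relation induced on a factor with \<open>c\<close> neighbours on the left and
  \<open>d\<close> on the right. It will turn out to be an epigroup theory again, so that a factor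
  of a word can be treated like a whole word.\<close>

definition ctx :: "nat \<Rightarrow> nat \<Rightarrow> (uterm \<times> uterm) set" where
  "ctx c d = {(s, t). \<forall>xs ys. length xs = c \<longrightarrow> length ys = d \<longrightarrow>
     (ucat (xs @ [s] @ ys), ucat (xs @ [t] @ ys)) \<in> \<theta>}"

lemma ctxI: "(\<And>xs ys. length xs = c \<Longrightarrow> length ys = d \<Longrightarrow> (ucat (xs @ [s] @ ys), ucat (xs @ [t] @ ys)) \<in> \<theta>)
    \<Longrightarrow> (s, t) \<in> ctx c d" by (simp add: ctx_def)
lemma ctxD: "(s, t) \<in> ctx c d \<Longrightarrow> length xs = c \<Longrightarrow> length ys = d \<Longrightarrow>
    (ucat (xs @ [s] @ ys), ucat (xs @ [t] @ ys)) \<in> \<theta>" by (simp add: ctx_def)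

lemma ctx_sub: "\<theta> \<subseteq> ctx c d" using cat_cong1 by (auto intro!: ctxI)

text \<open>Surplus context elements can be merged into one.\<close>

lemma ctx_long: assumes "(s, t) \<in> ctx c d" "length xs \<ge> c" "length ys \<ge> d"
  shows "(ucat (xs @ [s] @ ys), ucat (xs @ [t] @ ys)) \<in> \<theta>"
proof -
  define x1 x2 y1 y2 where "x1 = take (length xs - c) xs" "x2 = drop (length xs - c) xs" "y1 = take d ys" "y2 = drop d ys"
  have sp: "xs = x1 @ x2" "ys = y1 @ y2" "length x2 = c" "length y1 = d"
    using assms by (auto simp: x1_x2_y1_y2_def)
  have "(ucat (x1 @ (x2 @ [r] @ y1) @ y2), ucat (x1 @ [ucat (x2 @ [r] @ y1)] @ y2)) \<in> \<theta>" for r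
    by (rule cat_mid) simp
  moreover have "(ucat (x1 @ [ucat (x2 @ [s] @ y1)] @ y2), ucat (x1 @ [ucat (x2 @ [t] @ y1)] @ y2)) \<in> \<theta>"
    by (rule cat_cong1) (rule ctxD[OF assms(1) sp(3,4)])
  ultimately have "(ucat (x1 @ (x2 @ [s] @ y1) @ y2), ucat (x1 @ (x2 @ [t] @ y1) @ y2)) \<in> \<theta>"
    by (meson sym trans)
  then show ?thesis using sp by simp
qed

end

locale equational_theory = semigroup_theory +
  assumes cinv: "(s, t) \<in> \<theta> \<Longrightarrow> (UInv s, UInv t) \<in> \<theta>"
    and sub: "(s, t) \<in> \<theta> \<Longrightarrow> (usub \<sigma> s, usub \<sigma> t) \<in> \<theta>"
begin

definition qi :: "uterm \<Rightarrow> uterm" where "qi s = q (UInv s)"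

lemma qi_simps [simp]: "qi (q s) = qi s" "q (qi s) = qi s"
  unfolding qi_def q_eq using q_rel sym cinv by (auto simp: q_eq)

lemma q_inv: "q (UInv t) = qi t" by (simp add: qi_def)

lemma q_usub: "q (usub \<rho> t) = q (uev qm qi \<rho> t)"
proof (induction t)
  case (UMul s t)
  have "q (usub \<rho> (UMul s t)) = qm (q (usub \<rho> s)) (q (usub \<rho> t))" by (simp add: q_mul)
  then show ?case using UMul by simp
next
  case (UInv t)
  have "q (usub \<rho> (UInv t)) = qi (q (usub \<rho> t))" by (simp add: q_inv)
  then show ?case using UInv by simp
qed simp

end

locale epigroup_theory = equational_theory +
  fixes n0 :: nat
  assumes e1: "(UMul s (UInv s), UMul (UInv s) s) \<in> \<theta>"
    and e2: "(UMul (UMul (UInv s) s) (UInv s), UInv s) \<in> \<theta>"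
    and e3: "(UMul (upow s n0) (UMul s (UInv s)), upow s n0) \<in> \<theta>"
begin

text \<open>The bound is raised by one because for \<open>n0 = 0\<close> the law would equate a
  product, which is a representative, with an arbitrary term.\<close>

sublocale epi_semigrp qm qi "Suc n0"
proof
  fix x
  show "qm x (qi x) = qm (qi x) x" using e1[of x] unfolding q_eq[symmetric] qi_def by (simp add: q_mul)
  show "qm (qm (qi x) x) (qi x) = qi x"
    using e2[of x] unfolding q_eq[symmetric] by (simp add: q_mul q_inv[symmetric]) (metis q_inv q_mul q_simps(1,2))
  have "q (UMul (upow x (Suc n0)) (UMul x (UInv x))) = q (UMul x (UMul (upow x n0) (UMul x (UInv x))))"
    using q_upow[of x n0] q_upow[of x "Suc n0"] pw_comm[of x n0]
    by (metis assoc pwr.simps(2) q_mul q_simps(1,2))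
  also have "\<dots> = q (UMul x (upow x n0))" using e3 cmul unfolding q_eq by simp
  also have "\<dots> = pw x (Suc n0)" using q_upow[of x n0] pw_comm[of x n0] by (metis pwr.simps(2) q_mul q_simps(1,2))
  finally show "qm (pw x (Suc n0)) (qm x (qi x)) = pw x (Suc n0)"
    using q_upow_Suc[of x n0] by (metis q_inv q_mul q_simps(1,2))
qed

end

text \<open>Pseudoinverses are unique modulo any congruence for the multiplication, so compatibility
  with \<open>UInv\<close> can be derived from the laws.\<close>

lemma pinv_cong:
  assumes "semigroup_theory E"
    and b: "(UMul a b, UMul b a) \<in> E" "(UMul (UMul b a) b, b) \<in> E" "(UMul (upow a n) (UMul a b), upow a n) \<in> E"
    and c: "(UMul a c, UMul c a) \<in> E" "(UMul (UMul c a) c, c) \<in> E" "(UMul (upow a n) (UMul a c), upow a n) \<in> E"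
  shows "(b, c) \<in> E"
proof -
  interpret semigroup_theory E by fact
  have pw: "pw (q a) k = q (upow a k)" for k
    by (induction k) (auto simp: q_mul)
  have "q b = q c"
    using assms(2-) unfolding q_eq[symmetric]
    by (intro pinv_unique[of "q a" "q b" n "q c" n]) (auto simp: q_mul qm_UMul pw)
  then show ?thesis by (simp add: q_eq)
qed

text \<open>For products, one factor serves as additional context while the other is replaced.
  Compatibility with \<open>UInv\<close> is not visible in contexts and comes from uniqueness of
  pseudoinverses.\<close>

lemma (in epigroup_theory) ctx_epigroup_theory: "epigroup_theory (ctx c d) n0"
proof -
  have long: "(ucat (xs @ [s] @ ys), ucat (xs @ [t] @ ys)) \<in> \<theta>"
    if "(s, t) \<in> ctx c d" "length xs \<ge> c" "length ys \<ge> d" for s t xs ys using ctx_long that by blast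
  have sg: "semigroup_theory (ctx c d)"
  proof
    show "(t, t) \<in> ctx c d" for t by (simp add: ctx_def)
    show "(t, s) \<in> ctx c d" if "(s, t) \<in> ctx c d" for s t using that by (auto simp: ctx_def sym)
    show "(s, r) \<in> ctx c d" if "(s, t) \<in> ctx c d" "(t, r) \<in> ctx c d" for s t r
      using that trans by (fastforce simp: ctx_def)
    show "(UMul (UMul s t) r, UMul s (UMul t r)) \<in> ctx c d" for s t r using ctx_sub asc by blast
    fix s t s' t' assume a: "(s, t) \<in> ctx c d" "(s', t') \<in> ctx c d"
    show "(UMul s s', UMul t t') \<in> ctx c d"
    proof (rule ctxI)
      fix xs ys :: "uterm list" assume l: "length xs = c" "length ys = d"
      have 1: "(ucat (xs @ [r, r'] @ ys), ucat (xs @ [UMul r r'] @ ys)) \<in> \<theta>" for r r'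
        using cat_mid[of "[r, r']" xs ys] by simp
      have "(ucat (xs @ [s] @ (s' # ys)), ucat (xs @ [t] @ (s' # ys))) \<in> \<theta>"
        by (rule ctx_long[OF a(1)]) (auto simp: l)
      moreover have "(ucat ((xs @ [t]) @ [s'] @ ys), ucat ((xs @ [t]) @ [t'] @ ys)) \<in> \<theta>"
        by (rule ctx_long[OF a(2)]) (auto simp: l)
      ultimately have "(ucat (xs @ [s, s'] @ ys), ucat (xs @ [t, t'] @ ys)) \<in> \<theta>"
        using trans by simp
      then show "(ucat (xs @ [UMul s s'] @ ys), ucat (xs @ [UMul t t'] @ ys)) \<in> \<theta>"
        using 1 sym trans by blast
    qed
  qed
  interpret C: semigroup_theory "ctx c d" by fact
  have base: "(s, t) \<in> ctx c d" if "(s, t) \<in> \<theta>" for s t using that ctx_sub by blast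
  show ?thesis
  proof
    fix s t assume a: "(s, t) \<in> ctx c d"
    show "(UInv s, UInv t) \<in> ctx c d"
    proof (rule pinv_cong[OF sg, of s _ n0])
      show "(UMul s (UInv s), UMul (UInv s) s) \<in> ctx c d" "(UMul (UMul (UInv s) s) (UInv s), UInv s) \<in> ctx c d"
        "(UMul (upow s n0) (UMul s (UInv s)), upow s n0) \<in> ctx c d"
        using base e1 e2 e3 by auto
      have r: "(UInv t, UInv t) \<in> ctx c d" by simp
      show "(UMul s (UInv t), UMul (UInv t) s) \<in> ctx c d"
        by (meson C.cmul C.sym C.trans a r base e1)
      show "(UMul (UMul (UInv t) s) (UInv t), UInv t) \<in> ctx c d"
        by (meson C.cmul C.trans a r base e2)
      have "(upow s k, upow t k) \<in> ctx c d" for k by (induction k) (auto simp: a C.cmul)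
      then show "(UMul (upow s n0) (UMul s (UInv t)), upow s n0) \<in> ctx c d"
        by (meson C.cmul C.sym C.trans a r base e3)
    qed
  next
    fix s t \<sigma> assume a: "(s, t) \<in> ctx c d"
    show "(usub \<sigma> s, usub \<sigma> t) \<in> ctx c d"
    proof (rule ctxI)
      fix xs ys :: "uterm list" assume l: "length xs = c" "length ys = d"
      obtain M where M: "\<And>i. i \<in> uvars s \<union> uvars t \<Longrightarrow> i < M"
        using finite_nat_set_iff_bounded[of "uvars s \<union> uvars t"] by auto
      \<comment> \<open>Fresh letters first stand for the context, so that a single substitution
        acts as \<sigma> on the two terms and inserts \<open>xs\<close> and \<open>ys\<close> around
        them.\<close>
      define \<tau> where "\<tau> = (\<lambda>i. if i < M then \<sigma> i else if i < M + c then xs ! (i - M) else ys ! (i - M - c))"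
      let ?x = "map UVar [M..<M + c]" and ?y = "map UVar [M + c..<M + c + d]"
      have "(ucat (?x @ [s] @ ?y), ucat (?x @ [t] @ ?y)) \<in> \<theta>" by (rule ctxD[OF a]) auto
      then have "(usub \<tau> (ucat (?x @ [s] @ ?y)), usub \<tau> (ucat (?x @ [t] @ ?y))) \<in> \<theta>" by (rule sub)
      moreover have "map (usub \<tau>) ?x = xs" "map (usub \<tau>) ?y = ys"
        using l by (auto intro!: nth_equalityI simp: \<tau>_def)
      moreover have "usub \<tau> s = usub \<sigma> s" "usub \<tau> t = usub \<sigma> t"
        using M by (auto intro!: usub_cong simp: \<tau>_def)
      ultimately show "(ucat (xs @ [usub \<sigma> s] @ ys), ucat (xs @ [usub \<sigma> t] @ ys)) \<in> \<theta>"
        by (simp add: usub_ucat)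
    qed
  qed (use base e1 e2 e3 in auto)
qed

text \<open>The term \<open>s\<^sup>\<omega>\<^sup>+\<^sup>1\<close>, where \<open>s\<^sup>\<omega>\<close> is \<open>s\<close> times its pseudoinverse.\<close>

definition omega_mul :: "uterm \<Rightarrow> uterm" where "omega_mul s = UMul s (UMul s (UInv s))"

lemma usub_omega_mul [simp]: "usub \<sigma> (omega_mul s) = omega_mul (usub \<sigma> s)" by (simp add: omega_mul_def)
lemma hasinv_omega_mul [simp]: "hasinv (omega_mul s)" by (simp add: omega_mul_def)

text \<open>The conclusion of the Golubov-Sapir type theorem: in a linear word of length
  \<open>m\<close>, the factor between the first \<open>c\<close> and the last \<open>d\<close>
  letters may be raised to the power \<open>\<omega> + 1\<close>. Using \<open>ctx\<close>, its
  letters can be numbered from \<open>0\<close>.\<close>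

definition omega_form :: "(uterm \<times> uterm) set \<Rightarrow> nat \<Rightarrow> bool" where
  "omega_form \<theta> m \<longleftrightarrow> (\<exists>c k d. c + k + d = m \<and> 1 \<le> k \<and> (uw [0..<k], omega_mul (uw [0..<k])) \<in> semigroup_theory.ctx \<theta> c d)"

context epigroup_theory begin

lemma q_omega_mul: "q (omega_mul s) = qm (om s) s"
  using om_pw_comm[of s 0] by (simp add: omega_mul_def q_mul qm_UMul q_inv[symmetric] qi_def)

lemma omega_mul_cong: "(s, t) \<in> \<theta> \<Longrightarrow> (omega_mul s, omega_mul t) \<in> \<theta>"
  unfolding omega_mul_def by (intro cmul cinv)

text \<open>An inverse is a right multiple of all powers of its argument and so absorbs
  \<open>om x\<close> on the left, even when the argument is a plain power of \<open>x\<close>; a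
  product inherits this from either factor.\<close>

lemma one_var_value:
  "(\<not> hasinv t \<and> ue (\<lambda>_. x) t = pw x (length (flat t) - 1)) \<or> qm (om x) (ue (\<lambda>_. x) t) = ue (\<lambda>_. x) t"
proof -
  have iter: "\<exists>y. qi a = qm (pw a n) y" for a n
  proof (induction n)
    case 0 show ?case using iv_expand[of a] by auto
  next
    case (Suc n)
    then obtain y where y: "qi a = qm (pw a n) y" by blast
    have "qi a = qm a (qm (qm (pw a n) y) (qi a))" using iv_expand[of a] y by simp
    also have "\<dots> = qm (pw a (Suc n)) (qm y (qi a))" by (simp add: assoc pw_comm)
    finally show ?case by blast
  qed
  show ?thesis
  proof (induction t)
    case (UMul s t)
    have "qm (om x) (qm (pw x k) r) = qm (pw x k) r" if "qm (om x) r = r" for k r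
    proof -
      have "qm (om x) (qm (pw x k) r) = qm (qm (pw x k) (om x)) r" using om_pw_comm[of x k] by (simp add: assoc[symmetric])
      then show ?thesis using that by (simp add: assoc)
    qed
    moreover have "qm (pw x (length (flat s) - 1)) (pw x (length (flat t) - 1)) = pw x (length (flat s @ flat t) - 1)"
    proof -
      obtain a b where "length (flat s) = Suc a" "length (flat t) = Suc b" by (metis flat_ne length_0_conv not0_implies_Suc)
      then show ?thesis by (simp add: pw_add)
    qed
    moreover have "qm (om x) (qm a b) = qm a b" if "qm (om x) a = a" for a b using that by (metis assoc)
    ultimately show ?case using UMul by auto
  next
    case (UInv t)
    let ?a = "ue (\<lambda>_. x) t"
    from UInv have "qm (om x) (qi ?a) = qi ?a"
    proof (elim disjE conjE)
      assume "?a = pw x (length (flat t) - 1)"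
      moreover obtain l where "length (flat t) = Suc l" by (metis flat_ne length_0_conv not0_implies_Suc)
      ultimately have a: "?a = pw x l" by simp
      obtain y where "qi ?a = qm (pw (pw x l) (Suc n0)) y" using iter[of ?a "Suc n0"] a by auto
      then have "qi ?a = qm (pw x (l + Suc n0 * Suc l)) y" by (simp only: pw_mult)
      moreover have "Suc n0 \<le> l + Suc n0 * Suc l" by simp
      ultimately show ?thesis using om_pw by (metis assoc)
    next
      assume "qm (om x) ?a = ?a"
      then show ?thesis using iv_expand[of ?a] by (metis assoc)
    qed
    then show ?case by simp
  qed simp
qed

text \<open>If \<open>v\<close> is a proper power of the letter, iterating the identity turns
  \<open>x\<close> into powers beyond the index, where \<open>om x\<close> is a unit.\<close>

lemma one_var:
  assumes v: "(UVar 0, v) \<in> \<theta>" "uvars v = {0}" "flat v \<noteq> [UVar 0]"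
  shows "(UVar 0, omega_mul (UVar 0)) \<in> \<theta>"
proof -
  define x where "x = UVar 0"
  have "ue UVar v = ue (\<lambda>_. x) v" using v(2) by (intro uev_cong) (auto simp: x_def)
  moreover have "q x = q (ue UVar v)" using v(1) q_usub[of UVar v] unfolding x_def by (simp only: q_eq[symmetric] usub_id)
  ultimately have qx: "q x = q (ue (\<lambda>_. x) v)" by simp
  have "qm (om x) x = q x"
  proof (cases "qm (om x) (ue (\<lambda>_. x) v) = ue (\<lambda>_. x) v")
    case True
    have "qm (om x) x = qm (om x) (q x)" by simp
    also have "\<dots> = q (ue (\<lambda>_. x) v)" unfolding qx using True by (metis q_simps(2,3))
    finally show ?thesis using qx by simp
  next
    case False
    then have v': "\<not> hasinv v" "ue (\<lambda>_. x) v = pw x (length (flat v) - 1)" using False one_var_value[of v x] by auto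
    define k where "k = length (flat v) - 1"
    have "k \<ge> 1"
    proof (rule ccontr)
      assume "\<not> k \<ge> 1"
      then have "length (wd v) = 1" using v' flat_wd[of v] wd_ne[of v] by (cases "wd v") (auto simp: k_def Suc_le_eq)
      then obtain i where "wd v = [i]" by (cases "wd v") auto
      then have "flat v = [UVar 0]" using v' flat_wd v(2) set_wd[of v] by auto
      then show False using v(3) by simp
    qed
    have qk: "q (pw x k) = q x" using qx v' by (simp add: k_def)
    have "q (pw x (n * k)) = q x" for n
    proof (induction n)
      case (Suc n)
      have "pw x (Suc n * k) = qm (pw x (n * k)) (pw x (k - 1))" using \<open>k \<ge> 1\<close> by (simp add: pw_add add.commute)
      also have "\<dots> = qm x (pw x (k - 1))" using Suc by (metis q_simps(1))
      also have "\<dots> = pw x k" using \<open>k \<ge> 1\<close> pw_comm[of x "k - 1"] by (cases k) auto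
      finally show ?case using qk by simp
    qed simp
    then have 1: "q (pw x (Suc n0 * k)) = q x" .
    have 2: "Suc n0 \<le> Suc n0 * k" using \<open>k \<ge> 1\<close> mult_le_mono2[of 1 k "Suc n0"] by simp
    have "qm (om x) x = qm (om x) (pw x (Suc n0 * k))" using 1 by (metis q_simps(2))
    also have "\<dots> = pw x (Suc n0 * k)" by (rule om_pw[OF 2])
    finally show ?thesis using 1 by (metis q_simps(3))
  qed
  then show ?thesis unfolding q_eq[symmetric] q_omega_mul x_def by simp
qed

lemma ctx_ctx: "(s, t) \<in> semigroup_theory.ctx (ctx a b) c d \<Longrightarrow> (s, t) \<in> ctx (a + c) (d + b)"
proof (rule ctxI)
  interpret C: epigroup_theory "ctx a b" n0 by (rule ctx_epigroup_theory)
  fix xs ys :: "uterm list"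
  assume st: "(s, t) \<in> semigroup_theory.ctx (ctx a b) c d" and l: "length xs = a + c" "length ys = d + b"
  let ?x1 = "take a xs" and ?x2 = "drop a xs" and ?y1 = "take d ys" and ?y2 = "drop d ys"
  have "(ucat (?x2 @ [s] @ ?y1), ucat (?x2 @ [t] @ ?y1)) \<in> ctx a b"
    by (rule C.ctxD[OF st]) (auto simp: l)
  then have "(ucat (?x1 @ [ucat (?x2 @ [s] @ ?y1)] @ ?y2), ucat (?x1 @ [ucat (?x2 @ [t] @ ?y1)] @ ?y2)) \<in> \<theta>"
    by (rule ctxD) (auto simp: l)
  moreover have "(ucat (?x1 @ (?x2 @ [r] @ ?y1) @ ?y2), ucat (?x1 @ [ucat (?x2 @ [r] @ ?y1)] @ ?y2)) \<in> \<theta>" for r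
    by (rule cat_mid) simp
  ultimately have "(ucat (?x1 @ (?x2 @ [s] @ ?y1) @ ?y2), ucat (?x1 @ (?x2 @ [t] @ ?y1) @ ?y2)) \<in> \<theta>"
    by (meson sym trans)
  moreover have "?x1 @ (?x2 @ [r] @ ?y1) @ ?y2 = xs @ [r] @ ys" for r
    by (metis append.assoc append_take_drop_id)
  ultimately show "(ucat (xs @ [s] @ ys), ucat (xs @ [t] @ ys)) \<in> \<theta>" by metis
qed

lemma omega_form_ctx: assumes "omega_form (ctx a b) m" shows "omega_form \<theta> (a + m + b)"
proof -
  obtain c k d where "c + k + d = m" "1 \<le> k" "(uw [0..<k], omega_mul (uw [0..<k])) \<in> semigroup_theory.ctx (ctx a b) c d"
    using assms unfolding omega_form_def by blast
  then show ?thesis unfolding omega_form_def using ctx_ctx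
    by (intro exI[of _ "a + c"] exI[of _ k] exI[of _ "d + b"]) auto
qed

lemma omega_form_whole: "(uw [0..<m], omega_mul (uw [0..<m])) \<in> \<theta> \<Longrightarrow> 1 \<le> m \<Longrightarrow> omega_form \<theta> m"
  unfolding omega_form_def using ctx_sub by (intro exI[of _ 0] exI[of _ m]) auto

lemma sub_uw: "m \<ge> 1 \<Longrightarrow> usub \<sigma> (uw [0..<m]) = ucat (map \<sigma> [0..<m])"
  by (subst usub_ucat) (auto simp: comp_def)

lemma q_lp_ge2: "length xs \<ge> 2 \<Longrightarrow> q (lp xs) = lp xs"
  by (metis q_ucat2 q_q)

text \<open>The letters behind the largest one occurring in \<open>g\<close> become right context.
  In the shortened word the last letter does occur in the left factor, as
  \<open>left_open_power\<close> demands.\<close>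

lemma left_open:
  assumes g: "(uw [0..<m], UMul g (uw [0..<m])) \<in> \<theta>" "uvars g \<subseteq> {..<m}" and m: "m \<ge> 1"
  shows "omega_form \<theta> m"
proof -
  define j where "j = Max (uvars g)"
  have j: "j \<in> uvars g" "uvars g \<subseteq> {..j}" "j < m" using g(2) Max_in[of "uvars g"] unfolding j_def by auto
  interpret C: epigroup_theory "ctx 0 (m - Suc j)" n0 by (rule ctx_epigroup_theory)
  have rel: "(uw [0..<Suc j], UMul g (uw [0..<Suc j])) \<in> ctx 0 (m - Suc j)"
  proof (rule ctxI)
    fix xs ys :: "uterm list" assume l: "length xs = 0" "length ys = m - Suc j"
    define \<sigma> where "\<sigma> = (\<lambda>i. if i \<le> j then UVar i else ys ! (i - Suc j))"
    have 1: "map \<sigma> [0..<m] = map UVar [0..<Suc j] @ ys"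
      using l j by (intro nth_equalityI) (auto simp: \<sigma>_def nth_append simp del: upt_Suc)
    have "usub \<sigma> g = usub UVar g" using j by (intro usub_cong) (auto simp: \<sigma>_def)
    then have "(ucat (map \<sigma> [0..<m]), UMul g (ucat (map \<sigma> [0..<m]))) \<in> \<theta>"
      using sub[OF g(1), of \<sigma>] sub_uw[OF m] by simp
    moreover have "(ucat (map \<sigma> [0..<m]), ucat ([] @ [uw [0..<Suc j]] @ ys)) \<in> \<theta>"
      using cat_mid[of "map UVar [0..<Suc j]" "[]" ys] 1 by simp
    moreover have "(UMul g (ucat (map \<sigma> [0..<m])), ucat ([] @ [UMul g (uw [0..<Suc j])] @ ys)) \<in> \<theta>"
    proof -
      have "(ucat ([] @ (g # map UVar [0..<Suc j]) @ ys), ucat ([] @ [ucat (g # map UVar [0..<Suc j])] @ ys)) \<in> \<theta>"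
        by (rule cat_mid) simp
      moreover have "ucat (g # map \<sigma> [0..<m]) = UMul g (ucat (map \<sigma> [0..<m]))" using m by (intro ucat_Cons) auto
      moreover have "ucat (g # map UVar [0..<Suc j]) = UMul g (uw [0..<Suc j])" by (intro ucat_Cons) auto
      ultimately show ?thesis using 1 by simp
    qed
    ultimately show "(ucat (xs @ [uw [0..<Suc j]] @ ys), ucat (xs @ [UMul g (uw [0..<Suc j])] @ ys)) \<in> \<theta>"
      using l by (metis append_Nil length_0_conv sym trans)
  qed
  have "(uw [0..<Suc j], omega_mul (uw [0..<Suc j])) \<in> ctx 0 (m - Suc j)"
  proof (cases "j = 0")
    case True
    have "flat (UMul g (UVar 0)) \<noteq> [UVar 0]" by simp
    then show ?thesis using C.one_var[of "UMul g (UVar 0)"] rel True j by auto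
  next
    case False
    have eq: "C.lp (map \<rho> [0..<Suc j]) = C.qm (C.ue \<rho> g) (C.lp (map \<rho> [0..<Suc j]))" for \<rho>
    proof -
      have "C.q (usub \<rho> (uw [0..<Suc j])) = C.q (UMul (usub \<rho> g) (usub \<rho> (uw [0..<Suc j])))"
        using C.sub[OF rel, of \<rho>] C.q_eq by simp
      moreover have "C.q (usub \<rho> (uw [0..<Suc j])) = C.lp (map \<rho> [0..<Suc j])"
        using False by (subst sub_uw) (auto intro!: C.q_ucat2 simp del: upt_Suc)
      ultimately show ?thesis by (metis C.q_mul C.q_simps(1,2) C.q_usub)
    qed
    have "C.qm (C.om (C.lp (map UVar [0..<Suc j]))) (C.lp (map UVar [0..<Suc j])) = C.lp (map UVar [0..<Suc j])"
      by (rule C.left_open_power[OF eq j(2,1)])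
    moreover have "C.q (uw [0..<Suc j]) = C.lp (map UVar [0..<Suc j])"
      using False by (intro C.q_ucat2) (auto simp del: upt_Suc)
    ultimately have "C.q (uw [0..<Suc j]) = C.q (omega_mul (uw [0..<Suc j]))"
      unfolding C.q_omega_mul by (metis C.q_simps(1,2) C.qi_simps(1))
    then show ?thesis by (simp add: C.q_eq)
  qed
  then show ?thesis unfolding omega_form_def using j
    by (intro exI[of _ 0] exI[of _ "Suc j"] exI[of _ "m - Suc j"]) auto
qed

end

section \<open>Identities with a linear side\<close>

primrec urev :: "uterm \<Rightarrow> uterm" where
  "urev (UVar i) = UVar i"
| "urev (UMul s t) = UMul (urev t) (urev s)"
| "urev (UInv s) = UInv (urev s)"

lemma urev_urev [simp]: "urev (urev t) = t" by (induction t) auto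
lemma urev_usub: "urev (usub \<sigma> t) = usub (\<lambda>i. urev (\<sigma> i)) (urev t)" by (induction t) auto
lemma uvars_urev [simp]: "uvars (urev t) = uvars t" by (induction t) auto

context epigroup_theory begin

definition opposite :: "(uterm \<times> uterm) set" where "opposite = {(s, t). (urev s, urev t) \<in> \<theta>}"

lemma urev_upow: "(urev (upow s n), upow (urev s) n) \<in> \<theta>"
proof -
  have "q (urev (upow s n)) = q (upow (urev s) n)"
  proof (induction n)
    case (Suc n)
    have "q (urev (upow s (Suc n))) = qm (urev s) (q (urev (upow s n)))" by (simp add: q_mul)
    also have "\<dots> = qm (pw (urev s) n) (urev s)" using Suc q_upow pw_comm by simp
    finally show ?case using q_upow_Suc by simp
  qed simp
  then show ?thesis by (simp add: q_eq)
qed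

lemma urev_ucat: "xs \<noteq> [] \<Longrightarrow> (urev (ucat xs), ucat (rev (map urev xs))) \<in> \<theta>"
proof (induction xs)
  case (Cons x xs)
  show ?case
  proof (cases "xs = []")
    case False
    then have "(urev (ucat (x # xs)), UMul (ucat (rev (map urev xs))) (urev x)) \<in> \<theta>"
      using Cons cmul by (simp add: ucat_Cons)
    moreover have "(ucat (rev (map urev xs) @ [urev x]), UMul (ucat (rev (map urev xs))) (ucat [urev x])) \<in> \<theta>"
      using False by (intro cat_append) auto
    ultimately show ?thesis using sym trans by (metis lprod.simps(2) list.simps(9) rev.simps(2))
  qed simp
qed simp

lemma opposite_epigroup_theory: "epigroup_theory opposite n0"
proof
  show "(usub \<sigma> s, usub \<sigma> t) \<in> opposite" if "(s, t) \<in> opposite" for s t \<sigma>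
    using that sub by (simp add: opposite_def urev_usub)
  show "(UMul (UMul (UInv s) s) (UInv s), UInv s) \<in> opposite" for s
    using trans[OF sym[OF asc] e2[of "urev s"]] by (simp add: opposite_def)
  show "(UMul (upow s n0) (UMul s (UInv s)), upow s n0) \<in> opposite" for s
  proof -
    let ?s = "urev s"
    have "q (UMul (UMul (UInv ?s) ?s) (urev (upow s n0))) = qm (qm (qi ?s) ?s) (q (upow ?s n0))"
      using urev_upow[of s n0] unfolding q_eq[symmetric] by (metis q_inv q_mul q_simps(1,2))
    also have "\<dots> = qm (om ?s) (pw ?s n0)" using q_upow ic by simp
    also have "\<dots> = qm (pw ?s n0) (om ?s)" by (rule om_pw_comm)
    also have "\<dots> = q (UMul (upow ?s n0) (UMul ?s (UInv ?s)))"
      using q_upow by (metis q_inv q_mul q_simps(1,2))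
    also have "\<dots> = q (upow ?s n0)" using e3 q_eq by blast
    also have "\<dots> = q (urev (upow s n0))" using urev_upow[of s n0] sym by (simp add: q_eq)
    finally show ?thesis by (simp add: opposite_def q_eq)
  qed
  show "(UMul s (UInv s), UMul (UInv s) s) \<in> opposite" for s
    using e1[of "urev s"] sym by (simp add: opposite_def)
  show "(t, t) \<in> opposite" for t by (simp add: opposite_def)
  show "(t, s) \<in> opposite" if "(s, t) \<in> opposite" for s t using that sym by (simp add: opposite_def)
  show "(s, r) \<in> opposite" if "(s, t) \<in> opposite" "(t, r) \<in> opposite" for s t r
    using that trans unfolding opposite_def by blast
  show "(UMul s s', UMul t t') \<in> opposite" if "(s, t) \<in> opposite" "(s', t') \<in> opposite" for s t s' t'
    using that cmul by (simp add: opposite_def)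
  show "(UMul (UMul s t) r, UMul s (UMul t r)) \<in> opposite" for s t r using sym[OF asc] by (simp add: opposite_def)
  show "(UInv s, UInv t) \<in> opposite" if "(s, t) \<in> opposite" for s t using that cinv by (simp add: opposite_def)
qed

text \<open>Reversal exchanges the two context lengths, and a renaming puts the reversed factor back
  into increasing order.\<close>

lemma omega_form_opposite: assumes "omega_form opposite m" shows "omega_form \<theta> m"
proof -
  interpret R: epigroup_theory opposite n0 by (rule opposite_epigroup_theory)
  obtain c k d where ckd: "c + k + d = m" "1 \<le> k" and P: "(uw [0..<k], omega_mul (uw [0..<k])) \<in> semigroup_theory.ctx opposite c d"
    using assms unfolding omega_form_def by blast
  interpret C: epigroup_theory "ctx d c" n0 by (rule ctx_epigroup_theory)
  let ?P = "urev (uw [0..<k])"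
  have "(?P, urev (omega_mul (uw [0..<k]))) \<in> ctx d c"
  proof (rule ctxI)
    fix xs ys :: "uterm list" assume l: "length xs = d" "length ys = c"
    have "(ucat (rev (map urev ys) @ [uw [0..<k]] @ rev (map urev xs)),
      ucat (rev (map urev ys) @ [omega_mul (uw [0..<k])] @ rev (map urev xs))) \<in> opposite"
      by (rule R.ctxD[OF P]) (auto simp: l)
    moreover have "(urev (ucat (rev (map urev ys) @ [t] @ rev (map urev xs))), ucat (xs @ [urev t] @ ys)) \<in> \<theta>" for t
      using urev_ucat[of "rev (map urev ys) @ [t] @ rev (map urev xs)"] by (simp add: comp_def rev_map)
    ultimately show "(ucat (xs @ [?P] @ ys), ucat (xs @ [urev (omega_mul (uw [0..<k]))] @ ys)) \<in> \<theta>"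
      unfolding opposite_def using sym trans by blast
  qed
  moreover have "C.q (urev (omega_mul (uw [0..<k]))) = C.q (omega_mul ?P)"
  proof -
    have "C.qm (UInv ?P) ?P = C.qm ?P (UInv ?P)" using C.e1[of ?P] unfolding C.q_eq[symmetric] by (simp add: C.q_mul)
    then show ?thesis unfolding C.q_omega_mul by (simp add: omega_mul_def C.q_mul C.qm_UMul C.qi_def)
  qed
  ultimately have 1: "(?P, omega_mul ?P) \<in> ctx d c" using C.q_eq by (metis C.trans)
  define \<sigma> where "\<sigma> = (\<lambda>i. UVar (k - 1 - i))"
  have 2: "(usub \<sigma> ?P, uw [0..<k]) \<in> ctx d c"
  proof -
    have "(?P, ucat (rev (map urev (map UVar [0..<k])))) \<in> \<theta>" using ckd by (intro urev_ucat) auto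
    then have "(usub \<sigma> ?P, usub \<sigma> (ucat (rev (map urev (map UVar [0..<k]))))) \<in> \<theta>" by (rule sub)
    moreover have "usub \<sigma> (ucat (rev (map urev (map UVar [0..<k])))) = uw [0..<k]"
    proof -
      have "map (usub \<sigma>) (rev (map urev (map UVar [0..<k]))) = map UVar [0..<k]"
        by (rule nth_equalityI) (auto simp: \<sigma>_def rev_nth)
      then show ?thesis using ckd by (subst usub_ucat) auto
    qed
    ultimately show ?thesis using ctx_sub by auto
  qed
  have "(usub \<sigma> ?P, omega_mul (usub \<sigma> ?P)) \<in> ctx d c" using C.sub[OF 1, of \<sigma>] by simp
  then have "(uw [0..<k], omega_mul (uw [0..<k])) \<in> ctx d c"
    by (rule C.trans[OF C.sym[OF 2] C.trans[OF _ C.omega_mul_cong[OF 2]]])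
  then show ?thesis unfolding omega_form_def using ckd by (intro exI[of _ d] exI[of _ k] exI[of _ c]) auto
qed

lemma right_open:
  assumes g: "(uw [0..<m], UMul (uw [0..<m]) g) \<in> \<theta>" "uvars g \<subseteq> {..<m}" and m: "m \<ge> 1"
  shows "omega_form \<theta> m"
proof -
  interpret R: epigroup_theory opposite n0 by (rule opposite_epigroup_theory)
  let ?U = "uw [0..<m]"
  define \<sigma> where "\<sigma> = (\<lambda>i. UVar (m - 1 - i))"
  have "(urev ?U, UMul (urev g) (urev ?U)) \<in> opposite" using g by (simp add: opposite_def)
  then have 1: "(usub \<sigma> (urev ?U), UMul (usub \<sigma> (urev g)) (usub \<sigma> (urev ?U))) \<in> opposite"
    using R.sub[of "urev ?U" "UMul (urev g) (urev ?U)" \<sigma>] by simp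
  have 0: "(?U, usub \<sigma> (urev ?U)) \<in> opposite"
  proof -
    have "usub \<sigma> ?U = ucat (map UVar (rev [0..<m]))"
    proof -
      have "map \<sigma> [0..<m] = map UVar (rev [0..<m])"
        by (rule nth_equalityI) (auto simp: \<sigma>_def rev_nth)
      then show ?thesis using m by (simp add: sub_uw)
    qed
    moreover have "urev (usub \<sigma> (urev ?U)) = usub \<sigma> ?U" by (simp add: urev_usub \<sigma>_def)
    moreover have "(urev ?U, ucat (rev (map urev (map UVar [0..<m])))) \<in> \<theta>" using m by (intro urev_ucat) auto
    ultimately show ?thesis by (simp add: opposite_def comp_def rev_map)
  qed
  have "(?U, UMul (usub \<sigma> (urev g)) ?U) \<in> opposite"
    by (intro R.trans[OF R.trans[OF 0 1] R.cmul[OF R.rfl R.sym[OF 0]]])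
  moreover have "uvars (usub \<sigma> (urev g)) \<subseteq> {..<m}" using m by (auto simp: uvars_usub \<sigma>_def)
  ultimately have "omega_form opposite m" by (rule R.left_open[OF _ _ m])
  then show ?thesis by (rule omega_form_opposite)
qed

lemma open_any:
  assumes g: "(uw [0..<m], UMul g (uw [0..<m])) \<in> \<theta> \<or> (uw [0..<m], UMul (uw [0..<m]) g) \<in> \<theta>" and m: "m \<ge> 1"
  shows "omega_form \<theta> m"
proof -
  define \<sigma> where "\<sigma> = (\<lambda>i. if i < m then UVar i else UVar 0)"
  have "map \<sigma> [0..<m] = map UVar [0..<m]" by (auto simp: \<sigma>_def)
  then have "usub \<sigma> (uw [0..<m]) = uw [0..<m]" by (simp only: sub_uw[OF m])
  then have "(uw [0..<m], UMul (usub \<sigma> g) (uw [0..<m])) \<in> \<theta> \<or> (uw [0..<m], UMul (uw [0..<m]) (usub \<sigma> g)) \<in> \<theta>"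
    using g sub[of "uw [0..<m]" _ \<sigma>] by fastforce
  moreover have "uvars (usub \<sigma> g) \<subseteq> {..<m}" using m by (auto simp: uvars_usub \<sigma>_def split: if_splits)
  ultimately show ?thesis using left_open right_open m by blast
qed

lemma common_prefix:
  "\<exists>lam\<le>m. lam \<le> length L \<and> take lam L = map UVar [0..<lam] \<and> (lam = m \<or> lam = length L \<or> L ! lam \<noteq> UVar lam)"
proof (induction m)
  case (Suc m)
  then obtain lam where l: "lam \<le> m" "lam \<le> length L" "take lam L = map UVar [0..<lam]"
    "lam = m \<or> lam = length L \<or> L ! lam \<noteq> UVar lam" by blast
  show ?case
  proof (cases "lam = m \<and> lam < length L \<and> L ! lam = UVar lam")
    case True
    then have "m < length L" "L ! m = UVar m" "take m L = map UVar [0..<m]" using l by auto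
    then have "take (Suc m) L = map UVar [0..<Suc m]" by (simp add: take_Suc_conv_app_nth)
    then show ?thesis using True by (intro exI[of _ "Suc m"]) auto
  next
    case False
    then show ?thesis using l by (intro exI[of _ lam]) auto
  qed
qed simp

lemma linear_identity_core:
  assumes rel: "(uw [0..<m], ucat L) \<in> \<theta>" and L: "L = map UVar [0..<lam] @ t"
    and t: "t \<noteq> []" "hd t \<noteq> UVar lam" and lam: "lam < m"
    and vars: "\<And>a. a \<in> set L \<Longrightarrow> uvars a \<subseteq> {..<m}"
    and long: "(\<exists>w. UInv w \<in> set L) \<or> length L > m"
    and atoms: "\<And>a. a \<in> set L \<Longrightarrow> (\<exists>i. a = UVar i) \<or> (\<exists>w. a = UInv w)"
    and zero: "lam = 0 \<or> (\<exists>a\<in>set t. 0 \<in> uvars a)"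
  shows "omega_form \<theta> m"
\<comment> \<open>For \<open>m = 1\<close> the left side is a letter and not a product, so the
  equality demanded by \<open>epi_semigrp_ident\<close> would hold only up to
  representatives.\<close>
proof (cases "m = 1")
  case True
  then have l0: "L = t" "lam = 0" using L lam by auto
  have fl: "flat (ucat as) = as" if "as \<noteq> []" "\<And>a. a \<in> set as \<Longrightarrow> flat a = [a]" for as
    using that by (induction UMul as rule: lprod.induct) auto
  have "flat a = [a]" if "a \<in> set t" for a using atoms[of a] that l0 by auto
  then have "flat (ucat L) = t" using fl[of t] t l0 by auto
  then have "flat (ucat L) \<noteq> [UVar 0]" using t l0 by auto
  moreover have "uvars (ucat L) = {0}"
  proof -
    have "uvars (ucat L) \<subseteq> {0}" using vars True t l0 by (auto simp: uvars_ucat)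
    then show ?thesis using uvars_ne[of "ucat L"] by blast
  qed
  ultimately have "(UVar 0, omega_mul (UVar 0)) \<in> \<theta>" using one_var[of "ucat L"] rel True by simp
  then show ?thesis using omega_form_whole[of 1] True by simp
next
  case False
  then have m2: "m \<ge> 2" using lam by simp
  have Lne: "L \<noteq> []" using L t by auto
  interpret I: epi_semigrp_ident qm qi "Suc n0" m L t lam
  proof
    fix ys :: "uterm list" assume l: "length ys = m"
    have 0: "map ((!) ys) [0..<m] = ys" using l by (auto intro: nth_equalityI)
    have "(usub ((!) ys) (uw [0..<m]), usub ((!) ys) (ucat L)) \<in> \<theta>" using rel by (rule sub)
    then have 1: "q (ucat ys) = q (ue ((!) ys) (ucat L))" using m2 0 by (simp add: sub_uw q_eq[symmetric] q_usub)
    have "q (lp (map (ue ((!) ys)) L)) = lp (map (ue ((!) ys)) L)"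
    proof (cases "length L \<ge> 2")
      case True then show ?thesis by (intro q_lp_ge2) simp
    next
      case False
      then obtain a where "L = [a]" using Lne by (cases L rule: remdups_adj.cases) auto
      moreover from this obtain w where "a = UInv w" using long m2 by auto
      ultimately show ?thesis by simp
    qed
    then show "lp ys = lp (map (ue ((!) ys)) L)"
      using 1 q_ucat2[of ys] m2 l Lne by (simp add: uev_ucat)
  qed (use L t lam vars long atoms zero in auto)
  obtain g where g: "lp (map UVar [0..<m]) = qm g (lp (map UVar [0..<m])) \<or> lp (map UVar [0..<m]) = qm (lp (map UVar [0..<m])) g"
    using I.open_step[of "map UVar [0..<m]"] by auto
  have "q (uw [0..<m]) = lp (map UVar [0..<m])" using m2 by (intro q_ucat2) simp
  then have "q (uw [0..<m]) = q (UMul g (uw [0..<m])) \<or> q (uw [0..<m]) = q (UMul (uw [0..<m]) g)"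
    using g by (metis q_mul q_simps(1,2))
  then show ?thesis using open_any[of m g] m2 by (simp add: q_eq)
qed

text \<open>The theorem of Golubov-Sapir type. Three reductions lead to the core: a letter missing
  on the right can be replaced by anything, foreign letters are turned into inverses, and initial
  letters that recur nowhere become left context.\<close>

theorem linear_identity:
  assumes rel: "(uw [0..<m], v) \<in> \<theta>" and m: "m \<ge> 1"
    and nonperm: "hasinv v \<or> mset (wd v) \<noteq> mset [0..<m]"
  shows "omega_form \<theta> m"
proof (cases "{..<m} \<subseteq> uvars v")
  case False
  then obtain x where x: "x < m" "x \<notin> uvars v" by auto
  have "(UVar 0, omega_mul (UVar 0)) \<in> ctx x (m - Suc x)"
  proof (rule ctxI)
    fix xs ys :: "uterm list" assume l: "length xs = x" "length ys = m - Suc x"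
    define \<sigma> where "\<sigma> r = (\<lambda>i. if i < x then xs ! i else if i = x then r else ys ! (i - Suc x))" for r
    have "map (\<sigma> r) [0..<m] = xs @ [r] @ ys" for r
      using l x by (auto intro!: nth_equalityI simp: \<sigma>_def nth_append nth_Cons split: nat.splits) (metis Suc_diff_Suc Suc_lessI diff_Suc_1 not_less_eq linorder_neqE_nat)
    then have 1: "(ucat (xs @ [r] @ ys), usub (\<sigma> r) v) \<in> \<theta>" for r using sub[OF rel, of "\<sigma> r"] sub_uw[OF m] by simp
    have "usub (\<sigma> (UVar 0)) v = usub (\<sigma> (omega_mul (UVar 0))) v" using x by (intro usub_cong) (auto simp: \<sigma>_def)
    then show "(ucat (xs @ [UVar 0] @ ys), ucat (xs @ [omega_mul (UVar 0)] @ ys)) \<in> \<theta>" using 1 by (metis sym trans)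
  qed
  then show ?thesis unfolding omega_form_def using x by (intro exI[of _ x] exI[of _ 1] exI[of _ "m - Suc x"]) auto
next
  case True
  \<comment> \<open>Substituting an inverse for foreign letters ensures that the right side still is
    no rearrangement of the word.\<close>
  define \<sigma> where "\<sigma> = (\<lambda>i. if i < m then UVar i else UInv (UVar 0))"
  define w where "w = usub \<sigma> v"
  have "map \<sigma> [0..<m] = map UVar [0..<m]" by (auto simp: \<sigma>_def)
  then have "usub \<sigma> (uw [0..<m]) = uw [0..<m]" by (simp only: sub_uw[OF m])
  then have rel': "(uw [0..<m], w) \<in> \<theta>" using sub[OF rel, of \<sigma>] by (simp only: w_def)
  have vw: "uvars w = {..<m}" using True m by (fastforce simp: w_def uvars_usub \<sigma>_def split: if_splits)
  have np: "hasinv w \<or> mset (wd w) \<noteq> mset [0..<m]"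
  proof (cases "uvars v \<subseteq> {..<m}")
    case True
    then have "usub \<sigma> v = usub UVar v" by (intro usub_cong) (auto simp: \<sigma>_def)
    then show ?thesis using nonperm by (simp add: w_def)
  next
    case False
    then obtain i where i: "i \<in> uvars v" "\<not> i < m" by auto
    then have "hasinv (\<sigma> i)" by (simp add: \<sigma>_def)
    with i show ?thesis using hasinv_usub_var unfolding w_def by blast
  qed
  define L where "L = flat w"
  have relL: "(uw [0..<m], ucat L) \<in> \<theta>" using rel' flat_cat trans unfolding L_def by blast
  have Lvars: "uvars a \<subseteq> {..<m}" if "a \<in> set L" for a using that uvars_flat[of w] vw by (auto simp: L_def)
  have atoms: "(\<exists>i. a = UVar i) \<or> (\<exists>w. a = UInv w)" if "a \<in> set L" for a using that flat_atom by (auto simp: L_def)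
  have long: "(\<exists>w. UInv w \<in> set L) \<or> length L > m"
  proof (rule ccontr)
    assume a: "\<not> ?thesis"
    then have nh: "\<not> hasinv w" by (simp add: hasinv_flat L_def)
    then have "length (wd w) \<le> m" using a flat_wd[OF nh] by (simp add: L_def)
    moreover have s: "set (wd w) = set [0..<m]" using vw by (simp add: set_wd lessThan_atLeast0)
    ultimately have "distinct (wd w)" by (metis card_distinct card_length distinct_card distinct_upt le_antisym length_upt diff_zero)
    then show False using np nh s set_eq_iff_mset_eq_distinct distinct_upt by blast
  qed
  obtain lam where lam: "lam \<le> m" "lam \<le> length L" "take lam L = map UVar [0..<lam]"
    "lam = m \<or> lam = length L \<or> L ! lam \<noteq> UVar lam" using common_prefix by blast
  define t where "t = drop lam L"
  have Lt: "L = map UVar [0..<lam] @ t" using lam unfolding t_def by (metis append_take_drop_id)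
  have tne: "t \<noteq> []"
  proof
    assume "t = []"
    then have "L = map UVar [0..<lam]" using Lt by simp
    then show False using long lam by auto
  qed
  show ?thesis
  proof (cases "lam = m")
    case True
    have "(uw [0..<m], UMul (uw [0..<m]) (ucat t)) \<in> \<theta>"
    proof (rule trans[OF relL])
      show "(ucat L, UMul (uw [0..<m]) (ucat t)) \<in> \<theta>"
        using cat_append[of "map UVar [0..<m]" t] Lt True tne m by simp
    qed
    then show ?thesis using open_any m by blast
  next
    case False
    then have lm: "lam < m" using lam by simp
    have hdt: "hd t \<noteq> UVar lam" using lam False tne by (auto simp: t_def hd_drop_conv_nth)
    \<comment> \<open>Letters below \<open>l\<close> stand in the common prefix and nowhere else on
      the right, so they can pass into the left context. After renumbering, letter \<open>0\<close>
      occurs in the tail unless the prefix has become empty.\<close>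
    define l where "l = Min (insert lam (\<Union>a\<in>set t. uvars a))"
    have fin: "finite (insert lam (\<Union>a\<in>set t. uvars a))" by simp
    have l_le: "l \<le> lam" unfolding l_def using fin by simp
    have l_t: "l \<le> i" if "a \<in> set t" "i \<in> uvars a" for a i unfolding l_def using fin that by (intro Min_le) auto
    have l_in: "l = lam \<or> (\<exists>a\<in>set t. l \<in> uvars a)" using Min_in[OF fin] unfolding l_def[symmetric] by auto
    interpret C: epigroup_theory "ctx l 0" n0 by (rule ctx_epigroup_theory)
    define \<tau> where "\<tau> = (\<lambda>i. UVar (i - l))"
    define t' where "t' = map (usub \<tau>) t"
    define L' where "L' = map UVar [0..<lam - l] @ t'"
    have relC: "(uw [0..<m - l], ucat L') \<in> ctx l 0"
    proof (rule ctxI)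
      fix xs ys :: "uterm list" assume len: "length xs = l" "length ys = 0"
      define \<rho> where "\<rho> = (\<lambda>i. if i < l then xs ! i else UVar (i - l))"
      have up: "map \<rho> [0..<n] = xs @ map UVar [0..<n - l]" if "l \<le> n" for n
        using len that by (intro nth_equalityI) (auto simp: \<rho>_def nth_append)
      have "map (usub \<rho>) t = t'" unfolding t'_def
      proof (intro map_cong refl usub_cong)
        fix a i assume "a \<in> set t" "i \<in> uvars a"
        then have "\<not> i < l" using l_t[of a i] by simp
        then show "\<rho> i = \<tau> i" by (simp add: \<rho>_def \<tau>_def)
      qed
      then have "map (usub \<rho>) L = xs @ L'" using up[OF l_le] by (simp add: Lt L'_def comp_def)
      then have "(ucat (xs @ map UVar [0..<m - l]), ucat (xs @ L')) \<in> \<theta>"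
      proof -
        have "usub \<rho> (uw [0..<m]) = ucat (xs @ map UVar [0..<m - l])"
          unfolding sub_uw[OF m] using up[of m] l_le lm by simp
        moreover have "usub \<rho> (ucat L) = ucat (xs @ L')"
          using \<open>map (usub \<rho>) L = xs @ L'\<close> tne Lt by (subst usub_ucat) auto
        ultimately show ?thesis using sub[OF relL, of \<rho>] by simp
      qed
      moreover have "(ucat (xs @ map UVar [0..<m - l]), ucat (xs @ [uw [0..<m - l]])) \<in> \<theta>"
        using cat_mid[of "map UVar [0..<m - l]" xs "[]"] l_le lm by simp
      moreover have "(ucat (xs @ L'), ucat (xs @ [ucat L'])) \<in> \<theta>"
        using cat_mid[of L' xs "[]"] tne by (simp add: L'_def t'_def)
      ultimately show "(ucat (xs @ [uw [0..<m - l]] @ ys), ucat (xs @ [ucat L'] @ ys)) \<in> \<theta>"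
        using len sym trans by (metis append_Nil2 length_0_conv)
    qed
    have "omega_form (ctx l 0) (m - l)"
    proof (rule C.linear_identity_core[OF relC L'_def])
      show "t' \<noteq> []" using tne by (simp add: t'_def)
      obtain t0 t1 where t0: "t = t0 # t1" using tne by (cases t) auto
      have "hd t' = usub \<tau> t0" by (simp add: t'_def t0)
      moreover have "(\<exists>i. t0 = UVar i) \<or> (\<exists>w. t0 = UInv w)" using atoms Lt t0 by auto
      moreover have "i \<ge> l" if "t0 = UVar i" for i using l_t[of t0 i] t0 that by simp
      ultimately show "hd t' \<noteq> UVar (lam - l)" using hdt t0 l_le by (auto simp: \<tau>_def)
      show "lam - l < m - l" using lm l_le by simp
      show "uvars a \<subseteq> {..<m - l}" if "a \<in> set L'" for a
      proof -
        have "uvars (usub \<tau> b) \<subseteq> {..<m - l}" if "b \<in> set t" for b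
          using Lvars[of b] l_t[OF that] that lm l_le by (fastforce simp: uvars_usub \<tau>_def Lt)
        then show ?thesis using that lm by (auto simp: L'_def t'_def)
      qed
      show "(\<exists>w. UInv w \<in> set L') \<or> m - l < length L'"
        using long
      proof
        assume "\<exists>w. UInv w \<in> set L"
        then obtain w where "UInv w \<in> set t" using Lt by auto
        then have "usub \<tau> (UInv w) \<in> set t'" unfolding t'_def by (metis image_eqI set_map)
        then show ?thesis by (auto simp: L'_def)
      next
        assume "m < length L"
        then have "m - l < length L - l" using l_le lm by (intro diff_less_mono) auto
        also have "length L - l = length L'" using l_le by (simp add: Lt L'_def t'_def)
        finally show ?thesis by blast
      qed
      show "(\<exists>i. a = UVar i) \<or> (\<exists>w. a = UInv w)" if "a \<in> set L'" for a
        using that atoms Lt by (fastforce simp: L'_def t'_def \<tau>_def)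
      show "lam - l = 0 \<or> (\<exists>a\<in>set t'. 0 \<in> uvars a)"
        using l_in by (auto simp: t'_def uvars_usub \<tau>_def)
    qed
    then show ?thesis using omega_form_ctx[of l 0 "m - l"] l_le lm by simp
  qed
qed

end

abbreviation uom :: "uterm \<Rightarrow> uterm" where "uom s \<equiv> UMul s (UInv s)"

context epigroup_theory begin

lemma omega_form_apply:
  assumes "(uw [0..<k], omega_mul (uw [0..<k])) \<in> ctx c d" "1 \<le> k" "k \<le> length p"
  shows "(ucat p, omega_mul (ucat p)) \<in> ctx c d"
proof -
  interpret C: epigroup_theory "ctx c d" n0 by (rule ctx_epigroup_theory)
  define p' where "p' = take (k - 1) p @ [ucat (drop (k - 1) p)]"
  have l: "length p' = k" using assms by (simp add: p'_def)
  have "map ((!) p') [0..<k] = p'" using l by (auto intro: nth_equalityI)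
  then have "(ucat p', omega_mul (ucat p')) \<in> ctx c d"
    using C.sub[OF assms(1), of "(!) p'"] sub_uw[OF assms(2), of "(!) p'"] by simp
  moreover have "(ucat p, ucat p') \<in> \<theta>"
    using cat_mid[of "drop (k - 1) p" "take (k - 1) p" "[]"] assms by (simp add: p'_def)
  then have "(ucat p, ucat p') \<in> ctx c d" using ctx_sub by blast
  ultimately show ?thesis by (meson C.omega_mul_cong C.sym C.trans)
qed

lemma omega_mul_right: "p \<noteq> [] \<Longrightarrow> (ucat (xs @ [omega_mul (ucat p)] @ ys), ucat (xs @ p @ [uom (ucat p)] @ ys)) \<in> \<theta>"
proof -
  assume p: "p \<noteq> []"
  have "(ucat (p @ [uom (ucat p)]), omega_mul (ucat p)) \<in> \<theta>"
    using cat_append[of p "[uom (ucat p)]"] p by (simp add: omega_mul_def)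
  then have "(ucat (xs @ [ucat (p @ [uom (ucat p)])] @ ys), ucat (xs @ [omega_mul (ucat p)] @ ys)) \<in> \<theta>"
    by (rule cat_cong1)
  moreover have "(ucat (xs @ (p @ [uom (ucat p)]) @ ys), ucat (xs @ [ucat (p @ [uom (ucat p)])] @ ys)) \<in> \<theta>"
    by (rule cat_mid) simp
  ultimately show ?thesis using sym trans by (metis append.assoc)
qed

lemma omega_mul_left: "p \<noteq> [] \<Longrightarrow> (ucat (xs @ [omega_mul (ucat p)] @ ys), ucat (xs @ [uom (ucat p)] @ p @ ys)) \<in> \<theta>"
proof -
  assume p: "p \<noteq> []"
  have "q (UMul (uom (ucat p)) (ucat p)) = q (omega_mul (ucat p))"
    by (simp add: q_omega_mul q_mul qm_UMul qi_def)
  moreover have "(ucat ([uom (ucat p)] @ p), UMul (uom (ucat p)) (ucat p)) \<in> \<theta>"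
    using cat_append[of "[uom (ucat p)]" p] p by simp
  ultimately have "(ucat ([uom (ucat p)] @ p), omega_mul (ucat p)) \<in> \<theta>" using q_eq trans by blast
  then have "(ucat (xs @ [ucat ([uom (ucat p)] @ p)] @ ys), ucat (xs @ [omega_mul (ucat p)] @ ys)) \<in> \<theta>"
    by (rule cat_cong1)
  moreover have "(ucat (xs @ ([uom (ucat p)] @ p) @ ys), ucat (xs @ [ucat ([uom (ucat p)] @ p)] @ ys)) \<in> \<theta>"
    by (rule cat_mid) simp
  ultimately show ?thesis using sym trans by (metis append.assoc)
qed

lemma omega_form_insert:
  assumes "(uw [0..<k], omega_mul (uw [0..<k])) \<in> ctx c d" "1 \<le> k" "k \<le> length p" "c \<le> length xs" "d \<le> length ys"
  shows "(ucat (xs @ p @ ys), ucat (xs @ [omega_mul (ucat p)] @ ys)) \<in> \<theta>"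
    and "(ucat (xs @ p @ ys), ucat (xs @ p @ [uom (ucat p)] @ ys)) \<in> \<theta>"
    and "(ucat (xs @ p @ ys), ucat (xs @ [uom (ucat p)] @ p @ ys)) \<in> \<theta>"
proof -
  have p: "p \<noteq> []" using assms by auto
  have "(ucat (xs @ [ucat p] @ ys), ucat (xs @ [omega_mul (ucat p)] @ ys)) \<in> \<theta>"
    by (rule ctx_long[OF omega_form_apply[OF assms(1-3)]]) (use assms in auto)
  then show 1: "(ucat (xs @ p @ ys), ucat (xs @ [omega_mul (ucat p)] @ ys)) \<in> \<theta>"
    using cat_mid[OF p] trans by blast
  show "(ucat (xs @ p @ ys), ucat (xs @ p @ [uom (ucat p)] @ ys)) \<in> \<theta>" by (rule trans[OF 1 omega_mul_right[OF p]])
  show "(ucat (xs @ p @ ys), ucat (xs @ [uom (ucat p)] @ p @ ys)) \<in> \<theta>" by (rule trans[OF 1 omega_mul_left[OF p]])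
qed

end

lemma hasinv_ucat: "xs \<noteq> [] \<Longrightarrow> hasinv (ucat xs) \<longleftrightarrow> (\<exists>x\<in>set xs. hasinv x)"
  by (induction UMul xs rule: lprod.induct) auto

text \<open>\<open>A\<close> takes the word to \<open>v\<close>, \<open>B\<close> takes it to
  \<open>w\<close>, and each theory leads from the term of the other to a common \<open>z\<close>.
  All three contain inverses, so \<open>agree\<close> transfers these last steps and
  \<open>z\<close> is reached in both theories. What remains is to make each insertion leave the
  other one possible.\<close>

lemma common_inverse_term_le:
  assumes "epigroup_theory A na" "epigroup_theory B nb"
    and agree: "\<And>s t. hasinv s \<Longrightarrow> hasinv t \<Longrightarrow> (s, t) \<in> A \<longleftrightarrow> (s, t) \<in> B"
    and a: "(uw [0..<k], omega_mul (uw [0..<k])) \<in> semigroup_theory.ctx A c d" "1 \<le> k" "c + k + d = m"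
    and b: "(uw [0..<k'], omega_mul (uw [0..<k'])) \<in> semigroup_theory.ctx B c' d'" "1 \<le> k'" "c' + k' + d' = m"
    and cc: "c \<le> c'"
  shows "\<exists>t. hasinv t \<and> (uw [0..<m], t) \<in> A \<and> (uw [0..<m], t) \<in> B"
proof -
  interpret A: epigroup_theory A na by fact
  interpret B: epigroup_theory B nb by fact
  define X where "X = map UVar [0..<m]"
  have lX: "length X = m" by (simp add: X_def)
  have fin: ?thesis if v: "(ucat X, v) \<in> A" "(ucat X, w) \<in> B" "(v, z) \<in> B" "(w, z) \<in> A"
    "hasinv v" "hasinv w" "hasinv z" for v w z
  proof -
    have "(v, z) \<in> A" "(w, z) \<in> B" using v agree by blast+
    then show ?thesis using v A.trans B.trans unfolding X_def by blast
  qed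
  note hi = hasinv_ucat
  consider "c + k \<le> c'" | "c' + k' \<le> c + k" "c' < c + k" | "c' < c + k" "c + k < c' + k'" by linarith
  then show ?thesis
  proof cases
    case 1
    define x1 p e r x2 where "x1 = take c X" "p = take k (drop c X)" "e = take (c' - c - k) (drop (c + k) X)"
      "r = take k' (drop c' X)" "x2 = drop (c' + k') X"
    note df = x1_p_e_r_x2_def
    have len: "length x1 = c" "length p = k" "length e = c' - c - k" "length r = k'" "length x2 = d'"
      using lX a b 1 by (auto simp: df)
    have "X = x1 @ drop c X" by (simp add: df)
    also have "drop c X = p @ drop (c + k) X" by (simp add: df) (metis add.commute append_take_drop_id drop_drop)
    also have "drop (c + k) X = e @ drop c' X" using 1 by (simp add: df) (metis append_take_drop_id drop_drop le_add_diff_inverse2 diff_diff_left)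
    also have "drop c' X = r @ x2" by (simp add: df) (metis add.commute append_take_drop_id drop_drop)
    finally have X: "X = x1 @ p @ e @ r @ x2" .
    show ?thesis
    proof (rule fin)
      show "(ucat X, ucat (x1 @ p @ [uom (ucat p)] @ (e @ r @ x2))) \<in> A"
        unfolding X by (rule A.omega_form_insert(2)[OF a(1,2)]) (use len a b 1 in auto)
      show "(ucat X, ucat ((x1 @ p @ e) @ r @ [uom (ucat r)] @ x2)) \<in> B"
        using B.omega_form_insert(2)[OF b(1,2), of r "x1 @ p @ e" x2] len 1 by (simp add: X)
      show "(ucat (x1 @ p @ [uom (ucat p)] @ (e @ r @ x2)), ucat (x1 @ p @ [uom (ucat p)] @ e @ r @ [uom (ucat r)] @ x2)) \<in> B"
        using B.omega_form_insert(2)[OF b(1,2), of r "x1 @ p @ [uom (ucat p)] @ e" x2] len 1 by simp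
      show "(ucat ((x1 @ p @ e) @ r @ [uom (ucat r)] @ x2), ucat (x1 @ p @ [uom (ucat p)] @ e @ r @ [uom (ucat r)] @ x2)) \<in> A"
        using A.omega_form_insert(2)[OF a(1,2), of p x1 "e @ r @ [uom (ucat r)] @ x2"] len a b 1 by simp
    qed (auto simp: hi)
  next
    case 2
    define x1 r s t x2 where "x1 = take c X" "r = take (c' - c) (drop c X)" "s = take k' (drop c' X)"
      "t = take (c + k - c' - k') (drop (c' + k') X)" "x2 = drop (c + k) X"
    note df = x1_r_s_t_x2_def
    have len: "length x1 = c" "length r = c' - c" "length s = k'" "length t = c + k - c' - k'" "length x2 = d"
      using lX a b 2 by (auto simp: df)
    have "X = x1 @ drop c X" by (simp add: df)
    also have "drop c X = r @ drop c' X" using cc by (simp add: df) (metis append_take_drop_id drop_drop le_add_diff_inverse2)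
    also have "drop c' X = s @ drop (c' + k') X" by (simp add: df) (metis add.commute append_take_drop_id drop_drop)
    also have "drop (c' + k') X = t @ x2" using 2 by (simp add: df) (metis append_take_drop_id drop_drop le_add_diff_inverse2 diff_diff_left)
    finally have X: "X = x1 @ (r @ s @ t) @ x2" by simp
    \<comment> \<open>The block of \<open>B\<close> lies inside that of \<open>A\<close>. Since
      \<open>A\<close> raises its whole block, \<open>B\<close> has to act underneath that power,
      which is compatibility of \<open>omega_mul\<close> with the theory
      \<open>B.ctx c d\<close>.\<close>
    define p p' where "p = r @ s @ t" "p' = r @ s @ [uom (ucat s)] @ t"
    have lp: "length p = k" using len cc 2 by (simp add: p_p'_def)
    have ne: "p \<noteq> []" "p' \<noteq> []" using lp a(2) by (auto simp: p_p'_def)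
    have pp: "(ucat p, ucat p') \<in> B.ctx c d"
    proof (rule B.ctxI)
      fix xs ys :: "uterm list" assume l: "length xs = c" "length ys = d"
      have "(ucat ((xs @ r) @ s @ (t @ ys)), ucat ((xs @ r) @ s @ [uom (ucat s)] @ (t @ ys))) \<in> B"
        by (rule B.omega_form_insert(2)[OF b(1,2)]) (use len l a b cc 2 in auto)
      then show "(ucat (xs @ [ucat p] @ ys), ucat (xs @ [ucat p'] @ ys)) \<in> B"
        using B.cat_mid[OF ne(1), of xs ys] B.cat_mid[OF ne(2), of xs ys] unfolding p_p'_def
        by (metis B.sym B.trans append.assoc)
    qed
    interpret C: epigroup_theory "B.ctx c d" nb by (rule B.ctx_epigroup_theory)
    show ?thesis
    proof (rule fin)
      show "(ucat X, ucat (x1 @ [omega_mul (ucat p)] @ x2)) \<in> A"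
        unfolding X p_p'_def[symmetric] by (rule A.omega_form_insert(1)[OF a(1,2)]) (use len lp in auto)
      show "(ucat X, ucat (x1 @ p' @ x2)) \<in> B"
        using B.omega_form_insert(2)[OF b(1,2), of s "x1 @ r" "t @ x2"] len cc 2 a b by (simp add: X p_p'_def)
      show "(ucat (x1 @ [omega_mul (ucat p)] @ x2), ucat (x1 @ [omega_mul (ucat p')] @ x2)) \<in> B"
        by (rule B.ctxD[OF C.omega_mul_cong[OF pp]]) (use len in auto)
      show "(ucat (x1 @ p' @ x2), ucat (x1 @ [omega_mul (ucat p')] @ x2)) \<in> A"
        by (rule A.omega_form_insert(1)[OF a(1,2)]) (use len lp in \<open>auto simp: p_p'_def\<close>)
    qed (auto simp: hi p_p'_def)
  next
    case 3
    define x1 r ov s x2 where "x1 = take c X" "r = take (c' - c) (drop c X)" "ov = take (c + k - c') (drop c' X)"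
      "s = take (c' + k' - c - k) (drop (c + k) X)" "x2 = drop (c' + k') X"
    note df = x1_r_ov_s_x2_def
    have len: "length x1 = c" "length r = c' - c" "length ov = c + k - c'" "length s = c' + k' - c - k" "length x2 = d'"
      using lX a b 3 cc by (auto simp: df)
    have "X = x1 @ drop c X" by (simp add: df)
    also have "drop c X = r @ drop c' X" using cc by (simp add: df) (metis append_take_drop_id drop_drop le_add_diff_inverse2)
    also have "drop c' X = ov @ drop (c + k) X" using 3 by (simp add: df) (metis append_take_drop_id drop_drop le_add_diff_inverse2 less_imp_le_nat)
    also have "drop (c + k) X = s @ x2" using 3 by (simp add: df) (metis append_take_drop_id drop_drop le_add_diff_inverse2 diff_diff_left less_imp_le_nat)
    finally have X: "X = x1 @ r @ ov @ s @ x2" .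
    \<comment> \<open>For overlapping blocks \<open>A\<close> inserts to the left of its block and
      \<open>B\<close> to the right of its own, so that both blocks stay intact.\<close>
    let ?P = "uom (ucat (r @ ov))" and ?Q = "uom (ucat (ov @ s))"
    show ?thesis
    proof (rule fin)
      show "(ucat X, ucat (x1 @ [?P] @ (r @ ov) @ (s @ x2))) \<in> A"
        using A.omega_form_insert(3)[OF a(1,2), of "r @ ov" x1 "s @ x2"] len a b 3 cc by (simp add: X)
      show "(ucat X, ucat ((x1 @ r) @ (ov @ s) @ [?Q] @ x2)) \<in> B"
        using B.omega_form_insert(2)[OF b(1,2), of "ov @ s" "x1 @ r" x2] len a b 3 cc by (simp add: X)
      show "(ucat (x1 @ [?P] @ (r @ ov) @ (s @ x2)), ucat (x1 @ [?P] @ r @ ov @ s @ [?Q] @ x2)) \<in> B"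
        using B.omega_form_insert(2)[OF b(1,2), of "ov @ s" "x1 @ [?P] @ r" x2] len a b 3 cc by simp
      show "(ucat ((x1 @ r) @ (ov @ s) @ [?Q] @ x2), ucat (x1 @ [?P] @ r @ ov @ s @ [?Q] @ x2)) \<in> A"
        using A.omega_form_insert(3)[OF a(1,2), of "r @ ov" x1 "s @ [?Q] @ x2"] len a b 3 cc by simp
    qed (auto simp: hi)
  qed
qed

theorem common_inverse_term:
  assumes A: "epigroup_theory A na" and B: "epigroup_theory B nb"
    and agree: "\<And>s t. hasinv s \<Longrightarrow> hasinv t \<Longrightarrow> (s, t) \<in> A \<longleftrightarrow> (s, t) \<in> B"
    and m: "m \<ge> 1"
    and v: "(uw [0..<m], v) \<in> A" "hasinv v \<or> mset (wd v) \<noteq> mset [0..<m]"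
    and w: "(uw [0..<m], w) \<in> B" "hasinv w \<or> mset (wd w) \<noteq> mset [0..<m]"
  shows "\<exists>t. hasinv t \<and> (uw [0..<m], t) \<in> A \<and> (uw [0..<m], t) \<in> B"
proof -
  obtain c k d where a: "(uw [0..<k], omega_mul (uw [0..<k])) \<in> semigroup_theory.ctx A c d" "1 \<le> k" "c + k + d = m"
    using epigroup_theory.linear_identity[OF A v(1) m v(2)] unfolding omega_form_def by blast
  obtain c' k' d' where b: "(uw [0..<k'], omega_mul (uw [0..<k'])) \<in> semigroup_theory.ctx B c' d'" "1 \<le> k'" "c' + k' + d' = m"
    using epigroup_theory.linear_identity[OF B w(1) m w(2)] unfolding omega_form_def by blast
  show ?thesis
  proof (cases "c \<le> c'")
    case True
    then show ?thesis using common_inverse_term_le[OF A B agree a b] by blast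
  next
    case False
    have "\<exists>t. hasinv t \<and> (uw [0..<m], t) \<in> B \<and> (uw [0..<m], t) \<in> A"
      by (rule common_inverse_term_le[OF B A _ b a]) (use agree False in auto)
    then show ?thesis by blast
  qed
qed

lemma (in equational_theory) usub_rel: "(\<And>i. (\<sigma> i, \<tau> i) \<in> \<theta>) \<Longrightarrow> (usub \<sigma> t, usub \<tau> t) \<in> \<theta>"
  by (induction t) (auto intro: cmul cinv)

lemma uvars_upow [simp]: "uvars (upow s n) = uvars s" by (induction n) auto

section \<open>Commutative theories satisfying the square condition\<close>

locale commutative_theory = equational_theory +
  assumes com: "(UMul s t, UMul t s) \<in> \<theta>"
begin

lemma qcom: "qm s t = qm t s" using com q_eq q_mul by metis
lemma qlcom: "qm s (qm t r) = qm t (qm s r)" by (metis assoc qcom)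
lemmas qac = assoc qcom qlcom

lemma perm: "xs \<noteq> [] \<Longrightarrow> mset xs = mset ys \<Longrightarrow> (uw xs, uw ys) \<in> \<theta>"
proof (induction xs arbitrary: ys)
  case (Cons x xs)
  then have "x \<in> set ys" by (metis list.set_intros(1) mset_eq_setD)
  then obtain A B where ys: "ys = A @ x # B" by (metis split_list)
  then have m: "mset xs = mset (A @ B)" using Cons.prems by simp
  show ?case
  proof (cases "xs = []")
    case True
    then show ?thesis using m ys by simp
  next
    case False
    then have ne: "A @ B \<noteq> []" using m by auto
    have "q (uw ys) = qm (UVar x) (uw (A @ B))"
    proof (cases "A = [] \<or> B = []")
      case True
      then show ?thesis
      proof
        assume "A = []"
        then show ?thesis using ne by (simp add: ys ucat_Cons q_mul)
      next
        assume B: "B = []"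
        then have "q (uw ys) = q (UMul (uw A) (UVar x))"
          unfolding q_eq using cat_append[of "map UVar A" "[UVar x]"] ne by (simp add: ys)
        then show ?thesis using B qcom by (simp add: q_mul)
      qed
    next
      case False
      then have "q (uw ys) = q (UMul (uw A) (UMul (UVar x) (uw B)))"
        unfolding q_eq using cat_append[of "map UVar A" "map UVar (x # B)"] by (simp add: ys ucat_Cons)
      moreover have "q (uw (A @ B)) = q (UMul (uw A) (uw B))"
        unfolding q_eq using cat_append[of "map UVar A" "map UVar B"] False by simp
      ultimately show ?thesis by (metis q_mul q_simps(2) qlcom)
    qed
    moreover have "q (uw xs) = q (uw (A @ B))" using Cons.IH[OF False m] q_eq by simp
    then have "q (uw (x # xs)) = qm (UVar x) (uw (A @ B))" using False
      by (simp add: ucat_Cons q_mul) (metis q_simps(2))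
    ultimately show ?thesis by (metis q_eq)
  qed
qed simp

end

locale square_cond = commutative_theory +
  fixes kk :: nat
  assumes sqq: "(UMul (UMul s s) t, UMul (UMul s s) (UMul t t)) \<in> \<theta>"
    and ipow: "(UInv s, upow s kk) \<in> \<theta>"
begin

lemma qsq: "qm s (qm s t) = qm s (qm s (qm t t))"
  using sqq[of s t] unfolding q_eq[symmetric] by (simp add: q_mul qm_UMul assoc)
lemma qi_pw: "qi s = q (pw s kk)"
  using ipow[of s] unfolding q_eq[symmetric] q_inv by (simp add: q_upow)

text \<open>The terms idempotent modulo the theory; \<open>q s\<close> takes the place of
  \<open>s\<close>, which need not be a representative.\<close>

definition Z :: "uterm set" where "Z = {s. q s = qm s s}"

lemma qaab: "qm (qm a (qm a b)) (qm a (qm a b)) = qm a (qm a b)"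
proof -
  have "qm a (qm a b) = qm a (qm a (qm b b))" by (rule qsq)
  also have "\<dots> = qm b (qm b (qm a a))" by (simp only: qac)
  also have "\<dots> = qm b (qm b (qm (qm a a) (qm a a)))" by (rule qsq)
  also have "\<dots> = qm (qm a (qm a b)) (qm a (qm a b))" by (simp add: qac)
  finally show ?thesis by simp
qed

lemma Z_q: "q s \<in> Z \<longleftrightarrow> s \<in> Z" by (simp add: Z_def)

lemma Z_cong: "(s, t) \<in> \<theta> \<Longrightarrow> s \<in> Z \<longleftrightarrow> t \<in> Z"
  unfolding q_eq[symmetric] using Z_q by metis

lemma Z_aab: "UMul (UMul a a) b \<in> Z"
  using qaab[of a b] by (simp add: Z_def q_mul qm_UMul assoc)

lemma Z_mul: assumes "s \<in> Z" shows "UMul s t \<in> Z" "UMul t s \<in> Z"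
proof -
  have "q s = qm s s" using assms by (simp add: Z_def)
  then have "qm s t = qm (qm s s) t" by (metis q_simps(1))
  then have "qm s t = qm s (qm s t)" by (simp only: assoc)
  also have "\<dots> = qm s (qm s (qm t t))" by (rule qsq)
  also have "\<dots> = qm (qm s t) (qm s t)" by (simp add: qac)
  finally have 1: "qm s t = qm (qm s t) (qm s t)" .
  then show "UMul s t \<in> Z" by (simp add: Z_def q_mul qm_UMul)
  show "UMul t s \<in> Z" using 1 by (simp add: Z_def q_mul qm_UMul qcom[of t s])
qed

lemma pw_idem: "s \<in> Z \<Longrightarrow> q (pw s n) = q s"
proof (induction n)
  case (Suc n)
  then have "pw s (Suc n) = qm s s" by (metis pwr.simps(2) q_simps(1))
  then show ?case using Suc by (simp add: Z_def)
qed simp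

lemma Z_inv: "s \<in> Z \<Longrightarrow> UInv s \<in> Z"
  using pw_idem[of s kk] qi_pw[of s] q_inv[of s] Z_q by metis

lemma Z_pw: "n \<ge> 2 \<Longrightarrow> upow s n \<in> Z"
proof -
  assume "n \<ge> 2"
  then obtain m where "n = Suc (Suc m)" by (metis add_2_eq_Suc le_Suc_ex)
  then have "q (upow s n) = q (UMul (UMul s s) (upow s m))"
    by (simp add: q_mul qm_UMul qac)
  then show ?thesis using Z_aab Z_q by metis
qed

lemma Z_hasinv: "kk \<ge> 2 \<Longrightarrow> hasinv s \<Longrightarrow> s \<in> Z"
proof (induction s)
  case (UInv s)
  then show ?case using Z_pw Z_cong[OF ipow] by simp
qed (auto intro: Z_mul)

lemma Z_usub_var: "y \<in> uvars t \<Longrightarrow> \<sigma> y \<in> Z \<Longrightarrow> usub \<sigma> t \<in> Z"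
  by (induction t) (auto intro: Z_mul Z_inv)

lemma Z_usub: "s \<in> Z \<Longrightarrow> usub \<sigma> s \<in> Z"
proof -
  assume "s \<in> Z"
  then have "(s, UMul s s) \<in> \<theta>" unfolding q_eq[symmetric] by (simp add: Z_def q_mul)
  from sub[OF this, of \<sigma>] show ?thesis unfolding q_eq[symmetric] by (simp add: Z_def q_mul)
qed

lemma pw_absorb: "qm (pw a n) x = pw a n \<Longrightarrow> n \<ge> 1 \<Longrightarrow> m \<ge> n \<Longrightarrow> qm (pw a m) x = pw a m"
proof (induction m)
  case (Suc m)
  show ?case
  proof (cases "n = Suc m")
    case False
    then have "qm (pw a m) x = pw a m" using Suc by simp
    then show ?thesis by (metis pwr.simps(2) assoc qcom)
  qed (use Suc in simp)
qed simp

text \<open>\<open>pw s 2\<close> is the cube. For a letter the claim is \<open>x^3 = x^4\<close>,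
  the condition with both variables equal; commutativity carries it through products, and an inverse
  is a power.\<close>

lemma cube_absorb: "x \<in> uvars s \<Longrightarrow> qm (pw s 2) (UVar x) = pw s 2"
proof (induction s)
  case (UVar i)
  have "qm (pw (UVar x) 2) (UVar x) = qm (UVar x) (qm (UVar x) (qm (UVar x) (UVar x)))"
    by (simp add: numeral_2_eq_2 assoc)
  also have "\<dots> = qm (UVar x) (qm (UVar x) (UVar x))" by (rule qsq[symmetric])
  finally show ?case using UVar by (simp add: numeral_2_eq_2 assoc)
next
  case (UMul s t)
  have e: "pw (UMul s t) 2 = qm (pw s 2) (pw t 2)" by (simp add: numeral_2_eq_2 qm_UMul qac)
  from UMul consider "qm (pw s 2) (UVar x) = pw s 2" | "qm (pw t 2) (UVar x) = pw t 2" by auto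
  then show ?case
  proof cases
    case 1
    have "qm (qm (pw s 2) (pw t 2)) (UVar x) = qm (qm (pw s 2) (UVar x)) (pw t 2)" by (simp only: qac)
    then show ?thesis unfolding e 1 .
  next
    case 2
    then show ?thesis unfolding e by (simp only: assoc)
  qed
next
  case (UInv s)
  have pq: "pw (q r) 2 = pw r 2" for r by (simp add: numeral_2_eq_2)
  have "pw (UInv s) 2 = pw (pw s kk) 2"
    using pq[of "UInv s"] pq[of "pw s kk"] qi_pw[of s] q_inv[of s] by metis
  also have "\<dots> = pw s (kk + 2 * Suc kk)" by (simp only: pw_mult)
  finally have e: "pw (UInv s) 2 = pw s (kk + 2 * Suc kk)" .
  show ?case unfolding e by (rule pw_absorb[of s 2]) (use UInv in auto)
qed

lemma Z_absorb: "s \<in> Z \<Longrightarrow> uvars t \<subseteq> uvars s \<Longrightarrow> qm s t = q s"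
proof (induction t)
  case (UVar x)
  have "q (pw s 2) = q s" using UVar pw_idem by blast
  then have "qm s (UVar x) = qm (pw s 2) (UVar x)" by (metis q_simps(1))
  then show ?case using cube_absorb[of x s] UVar \<open>q (pw s 2) = q s\<close> by (simp add: numeral_2_eq_2)
next
  case (UMul t r)
  then have IH: "qm s t = q s" "qm s r = q s" by auto
  have "qm s (UMul t r) = qm (qm s t) r" by (simp add: qm_UMul assoc)
  also have "\<dots> = qm (q s) r" by (simp only: IH)
  also have "\<dots> = q s" using IH by simp
  finally show ?case .
next
  case (UInv t)
  then have 1: "qm s t = q s" by simp
  have 2: "qm s (pw t n) = q s" for n
  proof (induction n)
    case (Suc n)
    have "qm s (pw t (Suc n)) = qm (qm s (pw t n)) t" by (simp add: assoc)
    also have "\<dots> = q s" using Suc 1 by simp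
    finally show ?case .
  qed (use 1 in simp)
  have "qm s (UInv t) = qm s (qi t)" using q_inv[of t] by (metis q_simps(2))
  also have "\<dots> = q s" using 2 qi_pw[of t] by simp
  finally show ?case .
qed

text \<open>Each of the two terms absorbs the other, so both equal their product.\<close>

lemma Z_same_vars: "s \<in> Z \<Longrightarrow> t \<in> Z \<Longrightarrow> uvars s = uvars t \<Longrightarrow> (s, t) \<in> \<theta>"
  using Z_absorb[of s t] Z_absorb[of t s] qcom q_eq by auto

lemma usub_absorb: "y \<in> uvars t \<Longrightarrow> \<sigma> y \<in> Z \<Longrightarrow> qm (usub \<sigma> t) (\<sigma> y) = q (usub \<sigma> t)"
proof (induction t)
  case (UVar i) then show ?case by (simp add: Z_def)
next
  case (UMul s t)
  let ?a = "usub \<sigma> s" and ?b = "usub \<sigma> t"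
  have 1: "qm (qm ?a ?b) (\<sigma> y) = qm (qm ?a (\<sigma> y)) ?b" by (simp only: qac)
  have 2: "qm (qm ?a ?b) (\<sigma> y) = qm ?a (qm ?b (\<sigma> y))" by (simp only: assoc)
  have "qm (qm ?a ?b) (\<sigma> y) = qm ?a ?b"
  proof (cases "y \<in> uvars s")
    case True then show ?thesis using UMul 1 by simp
  next
    case False then show ?thesis using UMul 2 by simp
  qed
  then show ?case by (simp add: q_mul qm_UMul)
next
  case (UInv t)
  let ?a = "usub \<sigma> t"
  have 1: "qm ?a (\<sigma> y) = q ?a" using UInv by simp
  have 2: "qm (pw ?a n) (\<sigma> y) = q (pw ?a n)" for n
  proof (induction n)
    case (Suc n)
    have "qm (pw ?a (Suc n)) (\<sigma> y) = qm (pw ?a n) (qm ?a (\<sigma> y))" by (simp add: assoc)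
    then show ?case using 1 by simp
  qed (use 1 in simp)
  have "qm (UInv ?a) (\<sigma> y) = qm (qi ?a) (\<sigma> y)" using q_inv[of ?a] by (metis q_simps(1))
  also have "\<dots> = q (UInv ?a)" using 2[of kk] by (simp add: qi_pw q_inv)
  finally show ?case by simp
qed

lemma usub_const: "s \<in> Z \<Longrightarrow> (\<And>i. i \<in> uvars t \<Longrightarrow> \<sigma> i = s) \<Longrightarrow> q (usub \<sigma> t) = q s"
proof (induction t)
  case (UMul t r)
  then have "q (usub \<sigma> t) = q s" "q (usub \<sigma> r) = q s" by auto
  then have "qm (q (usub \<sigma> t)) (q (usub \<sigma> r)) = qm (q s) (q s)" by (simp only:)
  then have "q (usub \<sigma> (UMul t r)) = qm (q s) (q s)" by (simp add: q_mul)
  then show ?case using UMul.prems by (simp add: Z_def)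
next
  case (UInv t)
  then have "q (usub \<sigma> t) = q s" by auto
  then have "qi (usub \<sigma> t) = qi s" by (metis qi_simps(1))
  then show ?case using pw_idem[OF UInv.prems(1)] qi_pw by (simp add: q_inv)
qed auto

text \<open>Put \<open>t\<close> for a letter \<open>y\<close> on one side only and \<open>s\<close>
  for all others: the side without \<open>y\<close> becomes \<open>s\<close>, the other side absorbs
  \<open>t\<close>, whence \<open>s t = s\<close>. Exchanging the roles gives
  \<open>t s = t\<close>.\<close>

lemma Z_all:
  assumes p: "(p, p') \<in> \<theta>" "uvars p \<noteq> uvars p'" and st: "s \<in> Z" "t \<in> Z"
  shows "(s, t) \<in> \<theta>"
proof -
  obtain y p1 p2 where y: "(p1, p2) \<in> \<theta>" "y \<notin> uvars p1" "y \<in> uvars p2" using p sym by blast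
  have *: "qm s t = q s" if "s \<in> Z" "t \<in> Z" for s t
  proof -
    define \<sigma> where "\<sigma> = (\<lambda>i. if i = y then t else s)"
    have "q (usub \<sigma> p1) = q s" using that y by (intro usub_const) (auto simp: \<sigma>_def)
    moreover have "q (usub \<sigma> p1) = q (usub \<sigma> p2)" using sub[OF y(1)] q_eq by simp
    ultimately have "q (usub \<sigma> p2) = q s" by simp
    moreover have "qm (usub \<sigma> p2) t = q (usub \<sigma> p2)" using usub_absorb[OF y(3), of \<sigma>] that by (simp add: \<sigma>_def)
    ultimately show ?thesis by (metis q_simps(1))
  qed
  show ?thesis using *[of s t] *[of t s] st qcom q_eq by auto
qed

end

lemma rtrancl_uvars:
  assumes "(s, t) \<in> (A \<union> B)\<^sup>*" "\<And>s t. (s, t) \<in> A \<Longrightarrow> uvars s = uvars t" "\<And>s t. (s, t) \<in> B \<Longrightarrow> uvars s = uvars t"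
  shows "uvars s = uvars t"
  using assms(1) by (induction) (use assms(2,3) in auto)

text \<open>Letters of \<open>t\<close> missing in \<open>s\<close> are eliminated one by one: if \<open>A\<close> identifies terms with different
  letters then so does \<open>B\<close>, by equality of the joins.\<close>

lemma agree_on_Z:
  assumes "square_cond \<nu> k" "equational_theory A" "equational_theory B"
    and int: "\<nu> \<inter> A = \<nu> \<inter> B" and join: "(\<nu> \<union> A)\<^sup>* = (\<nu> \<union> B)\<^sup>*"
    and st: "s \<in> square_cond.Z \<nu>" "t \<in> square_cond.Z \<nu>" "(s, t) \<in> A"
  shows "(s, t) \<in> B"
proof -
  interpret V: square_cond \<nu> k by fact
  interpret A: equational_theory A by fact
  interpret B: equational_theory B by fact
  have sZ: "s \<in> V.Z" "t \<in> V.Z" using st by auto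
  show ?thesis
  proof (cases "\<exists>p p'. (p, p') \<in> \<nu> \<and> uvars p \<noteq> uvars p'")
    case True
    then have "(s, t) \<in> \<nu>" using V.Z_all sZ by blast
    then show ?thesis using int st by blast
  next
    case False
    then have Vv: "uvars p = uvars p'" if "(p, p') \<in> \<nu>" for p p' using that by blast
    have same: "(u, v) \<in> B" if "u \<in> V.Z" "v \<in> V.Z" "uvars u = uvars v" "(u, v) \<in> A" for u v
      using V.Z_same_vars[OF that(1-3)] that(4) int by blast
    show ?thesis
    proof (cases "uvars s = uvars t")
      case True then show ?thesis using same sZ st by blast
    next
      case neq: False
      have "\<exists>p1 p2. (p1, p2) \<in> B \<and> uvars p1 \<noteq> uvars p2"
      proof (rule ccontr)
        assume "\<not> ?thesis"
        moreover have "(s, t) \<in> (\<nu> \<union> B)\<^sup>*" using st(3) join by blast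
        ultimately show False using rtrancl_uvars[of s t \<nu> B] Vv neq by blast
      qed
      then obtain z p1 p2 where z: "(p1, p2) \<in> B" "z \<notin> uvars p1" "z \<in> uvars p2" using B.sym by blast
      have elim: "(t, usub (UVar(y := UVar x)) t) \<in> B"
        if h: "(s, t) \<in> A" "s \<in> V.Z" "t \<in> V.Z" "y \<in> uvars t" "y \<notin> uvars s" for s t x y
      proof -
        define T where "T w = usub (UVar(y := w)) t" for w
        have TZ: "T w \<in> V.Z" for w unfolding T_def by (rule V.Z_usub[OF h(3)])
        have sT: "(s, T w) \<in> A" for w
        proof -
          have "usub (UVar(y := w)) s = usub UVar s" using h(5) by (intro usub_cong) auto
          then show ?thesis using A.sub[OF h(1), of "UVar(y := w)"] by (simp add: T_def)
        qed
        have Tv: "uvars (T w) = (uvars t - {y}) \<union> uvars w" for w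
          using h(4) by (auto simp: T_def uvars_usub split: if_splits)
        have Tsame: "(T w, T w') \<in> B" if "uvars w = uvars w'" for w w'
          using same[OF TZ TZ] that Tv A.trans[OF A.sym[OF sT] sT] by simp
        have TB: "(T w, T w') \<in> B" if "(w, w') \<in> B" for w w'
          unfolding T_def by (rule B.usub_rel) (use that in auto)
        \<comment> \<open>The sides of the identity of \<open>B\<close>, with \<open>a\<close> for
          all letters except that \<open>z\<close>, present on one side only, receives
          \<open>a b\<close>. Thus \<open>B\<close> relates \<open>K a\<close> to
          \<open>P a b\<close> whatever \<open>b\<close> is, and since \<open>P y x\<close> and
          \<open>P x y\<close> have the same letters, \<open>y\<close> can be exchanged for
          \<open>x\<close>.\<close>
        define K P where "K a = usub (\<lambda>_. a) p1" and "P a b = usub (\<lambda>i. if i = z then UMul a b else a) p2" for a b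
        have KP: "(K a, P a b) \<in> B" for a b
        proof -
          have "usub (\<lambda>i. if i = z then UMul a b else a) p1 = K a"
            unfolding K_def using z by (intro usub_cong) auto
          then show ?thesis using B.sub[OF z(1)] P_def by metis
        qed
        have Kv: "uvars (K a) = uvars a" for a using uvars_ne[of p1] by (auto simp: K_def uvars_usub)
        have Pv: "uvars (P a b) = uvars a \<union> uvars b" for a b using z by (auto simp: P_def uvars_usub split: if_splits)
        let ?x = "UVar x" and ?y = "UVar y"
        have "T ?y = usub UVar t" unfolding T_def by (intro usub_cong) auto
        then have t: "T ?y = t" by simp
        have "(T ?y, T (K ?y)) \<in> B" by (rule Tsame) (simp add: Kv)
        moreover have "(T (K ?y), T (P ?y ?x)) \<in> B" by (rule TB[OF KP])
        moreover have "(T (P ?y ?x), T (P ?x ?y)) \<in> B" by (rule Tsame) (auto simp: Pv)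
        moreover have "(T (P ?x ?y), T (K ?x)) \<in> B" by (rule B.sym[OF TB[OF KP]])
        moreover have "(T (K ?x), T ?x) \<in> B" by (rule Tsame) (simp add: Kv)
        ultimately have "(T ?y, T ?x) \<in> B" by (rule B.trans[OF B.trans[OF B.trans[OF B.trans]]])
        then show ?thesis using t by (simp add: T_def)
      qed
      have reduce: "\<exists>t'. (t, t') \<in> B \<and> (s, t') \<in> A \<and> t' \<in> V.Z \<and> uvars t' \<subseteq> uvars s \<and> uvars t \<inter> uvars s \<subseteq> uvars t'"
        if "(s, t) \<in> A" "s \<in> V.Z" "t \<in> V.Z" for s t
        using that
      proof (induction "card (uvars t - uvars s)" arbitrary: t rule: less_induct)
        case less
        show ?case
        proof (cases "uvars t \<subseteq> uvars s")
          case True then show ?thesis using less.prems by (intro exI[of _ t]) auto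
        next
          case False
          then obtain y where y: "y \<in> uvars t" "y \<notin> uvars s" by blast
          obtain x where x: "x \<in> uvars s" using uvars_ne[of s] by blast
          let ?\<sigma> = "UVar(y := UVar x)"
          let ?t = "usub ?\<sigma> t"
          have 1: "(t, ?t) \<in> B" using elim less.prems y by blast
          have "usub ?\<sigma> s = usub UVar s" using y by (intro usub_cong) auto
          then have 2: "(s, ?t) \<in> A" using A.sub[OF less.prems(1), of ?\<sigma>] by simp
          have 3: "?t \<in> V.Z" using V.Z_usub less.prems by blast
          have v: "uvars ?t = (uvars t - {y}) \<union> {x}" using y by (auto simp: uvars_usub split: if_splits)
          have "uvars ?t - uvars s \<subset> uvars t - uvars s" using v x y by auto
          then have "card (uvars ?t - uvars s) < card (uvars t - uvars s)" by (intro psubset_card_mono) auto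
          from less.hyps[OF this 2 less.prems(2) 3] obtain t' where
            "(?t, t') \<in> B" "(s, t') \<in> A" "t' \<in> V.Z" "uvars t' \<subseteq> uvars s" "uvars ?t \<inter> uvars s \<subseteq> uvars t'" by blast
          then show ?thesis using B.trans[OF 1] v y by (intro exI[of _ t']) auto
        qed
      qed
      obtain t' where t': "(t, t') \<in> B" "(s, t') \<in> A" "t' \<in> V.Z" "uvars t' \<subseteq> uvars s"
        using reduce[OF st(3) sZ] by blast
      \<comment> \<open>As the letters of \<open>t'\<close> already lie in \<open>s\<close>,
        reducing in the other direction gives \<open>s'\<close> exactly the letters of
        \<open>t'\<close>.\<close>
      obtain s' where s': "(s, s') \<in> B" "(t', s') \<in> A" "s' \<in> V.Z" "uvars s' \<subseteq> uvars t'" "uvars s \<inter> uvars t' \<subseteq> uvars s'"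
        using reduce[OF A.sym[OF t'(2)] t'(3) sZ(1)] by blast
      have "(s', t') \<in> B" using same[OF s'(3) t'(3)] s' t' A.sym by blast
      then show ?thesis using B.trans[OF s'(1) B.trans[OF _ B.sym[OF t'(1)]]] by blast
    qed
  qed
qed

section \<open>Sufficiency\<close>

definition cancellable_in :: "(uterm \<times> uterm) set set \<Rightarrow> (uterm \<times> uterm) set \<Rightarrow> bool" where
  "cancellable_in F \<nu> \<longleftrightarrow> (\<forall>A\<in>F. \<forall>B\<in>F. \<nu> \<inter> A = \<nu> \<inter> B \<and> (\<nu> \<union> A)\<^sup>* = (\<nu> \<union> B)\<^sup>* \<longrightarrow> A = B)"

text \<open>The modular law is self-dual, so it keeps its form although joins of varieties are
  intersections of theories.\<close>

definition modular_in :: "(uterm \<times> uterm) set set \<Rightarrow> (uterm \<times> uterm) set \<Rightarrow> bool" where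
  "modular_in F \<nu> \<longleftrightarrow> (\<forall>A\<in>F. \<forall>B\<in>F. A \<subseteq> B \<longrightarrow> (\<nu> \<union> A)\<^sup>* \<inter> B = ((\<nu> \<inter> B) \<union> A)\<^sup>*)"

definition epi_theories :: "(uterm \<times> uterm) set set" where "epi_theories = {\<theta>. \<exists>n. epigroup_theory \<theta> n}"
definition sgrp_theories :: "(uterm \<times> uterm) set set" where "sgrp_theories = {\<theta>. equational_theory \<theta> \<and> (\<forall>s. (UInv s, s) \<in> \<theta>)}"

text \<open>\<open>UInv s\<close> is read as the power of \<open>s\<close> with exponent \<open>k + 1\<close>; \<open>k = 0\<close> gives the semigroup
  varieties.\<close>

primrec tr :: "nat \<Rightarrow> uterm \<Rightarrow> uterm" where
  "tr k (UVar i) = UVar i"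
| "tr k (UMul s t) = UMul (tr k s) (tr k t)"
| "tr k (UInv s) = upow (tr k s) k"

lemma hasinv_upow [simp]: "hasinv (upow s n) \<longleftrightarrow> hasinv s" by (induction n) auto
lemma hasinv_tr [simp]: "\<not> hasinv (tr k s)" by (induction s) auto
lemma tr_id [simp]: "\<not> hasinv s \<Longrightarrow> tr k s = s" by (induction s) auto
lemma tr_upow: "tr k (upow s n) = upow (tr k s) n" by (induction n) auto
lemma tr_usub: "tr k (usub \<sigma> t) = usub (\<lambda>i. tr k (\<sigma> i)) (tr k t)"
  by (induction t) (auto simp: usub_upow)
lemma wd_tr0 [simp]: "wd (tr 0 t) = wd t" by (induction t) auto

lemma (in equational_theory) rel_tr: "(\<And>s. (UInv s, upow s k) \<in> \<theta>) \<Longrightarrow> (t, tr k t) \<in> \<theta>"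
proof (induction t)
  case (UInv t)
  have "(upow t n, upow (tr k t) n) \<in> \<theta>" for n
    by (induction n) (use UInv in \<open>auto intro: cmul\<close>)
  then show ?case using UInv.prems trans by (metis tr.simps(3))
qed (auto intro: cmul)

context square_cond begin

text \<open>By commutativity the two occurrences of a repeated letter can be moved to the front; if
  anything remains, a square is properly multiplied and the term is idempotent.\<close>

lemma nonZ_shape:
  assumes "s \<notin> Z" "(s, uw (wd s)) \<in> \<theta>"
  shows "distinct (wd s) \<or> (\<exists>x. wd s = [x, x])"
proof (rule ccontr)
  assume a: "\<not> ?thesis"
  then obtain C B D d where w: "wd s = C @ [d] @ B @ [d] @ D" by (metis not_distinct_decomp)
  with a have ne: "C @ B @ D \<noteq> []" by auto
  have "(uw (wd s), uw ([d, d] @ (C @ B @ D))) \<in> \<theta>" by (rule perm) (auto simp: w)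
  moreover have "(uw ([d, d] @ (C @ B @ D)), UMul (UMul (UVar d) (UVar d)) (uw (C @ B @ D))) \<in> \<theta>"
    using cat_append[of "map UVar [d, d]" "map UVar (C @ B @ D)"] ne by simp
  ultimately have "(s, UMul (UMul (UVar d) (UVar d)) (uw (C @ B @ D))) \<in> \<theta>" using assms(2) trans by blast
  then show False using Z_aab Z_cong assms(1) by blast
qed

text \<open>A letter of \<open>t\<close> foreign to \<open>s\<close> can be replaced by its cube
  without changing \<open>s\<close>, and the idempotent cube makes all of \<open>t\<close>
  idempotent.\<close>

lemma nonZ_vars: assumes "(s, t) \<in> \<theta>" "s \<notin> Z" shows "uvars t \<subseteq> uvars s"
proof (rule ccontr)
  assume "\<not> ?thesis"
  then obtain y where y: "y \<in> uvars t" "y \<notin> uvars s" by blast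
  let ?\<sigma> = "UVar(y := upow (UVar y) 2)"
  have "usub ?\<sigma> s = usub UVar s" using y by (intro usub_cong) auto
  then have "(s, usub ?\<sigma> t) \<in> \<theta>" using sub[OF assms(1), of ?\<sigma>] by simp
  moreover have "usub ?\<sigma> t \<in> Z" using y by (intro Z_usub_var[of y]) (auto intro: Z_pw)
  ultimately show False using Z_cong assms(2) by blast
qed

lemma same_shape:
  assumes st: "(s, t) \<in> \<theta>" "s \<notin> Z" and w: "(s, uw (wd s)) \<in> \<theta>" "(t, uw (wd t)) \<in> \<theta>"
  shows "(distinct (wd s) \<and> distinct (wd t) \<and> set (wd s) = set (wd t)) \<or> (\<exists>x. wd s = [x, x] \<and> wd t = [x, x])"
proof -
  have tZ: "t \<notin> Z" using Z_cong st by blast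
  have v: "uvars s = uvars t" using nonZ_vars[OF st] nonZ_vars[OF sym[OF st(1)] tZ] by blast
  have mix: False if h: "(s, t) \<in> \<theta>" "t \<notin> Z" "(s, uw (wd s)) \<in> \<theta>" "(t, uw (wd t)) \<in> \<theta>"
    "wd s = [x, x]" "distinct (wd t)" "set (wd t) = {x}" for s t x
  proof -
    have "wd t = [x]"
    proof -
      have "length (wd t) = 1" using distinct_card[OF h(6)] h(7) by simp
      then show ?thesis using h(7) by (cases "wd t") auto
    qed
    then have e: "(t, UVar x) \<in> \<theta>" "(s, UMul (UVar x) (UVar x)) \<in> \<theta>" using h by simp_all
    have "(UVar x, UMul (UVar x) (UVar x)) \<in> \<theta>" by (rule trans[OF sym[OF e(1)] trans[OF sym[OF h(1)] e(2)]])
    then have "UVar x \<in> Z" unfolding q_eq[symmetric] by (simp add: Z_def q_mul)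
    then show False using h(2) Z_cong[OF e(1)] by blast
  qed
  consider "distinct (wd s)" "distinct (wd t)" | x where "wd s = [x, x]" "distinct (wd t)"
    | x where "distinct (wd s)" "wd t = [x, x]" | x y where "wd s = [x, x]" "wd t = [y, y]"
    using nonZ_shape[OF st(2) w(1)] nonZ_shape[OF tZ w(2)] by blast
  then show ?thesis
  proof cases
    case 1 then show ?thesis using v by (simp add: set_wd)
  next
    case 2
    then have "set (wd t) = {x}" using v set_wd[of s] set_wd[of t] by auto
    then show ?thesis using mix[OF st(1) tZ w 2] by blast
  next
    case 3
    then have "set (wd s) = {x}" using v set_wd[of s] set_wd[of t] by auto
    then show ?thesis using mix[OF sym[OF st(1)] st(2) w(2,1) 3(2,1)] by blast
  next
    case 4
    then have "{x} = {y}" using v set_wd[of s] set_wd[of t] by auto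
    then show ?thesis using 4 by auto
  qed
qed

end

text \<open>Letters outside \<open>w\<close> are shifted past \<open>m\<close>, so that
  \<open>\<sigma>\<close> has a left inverse on all terms. Hence renaming preserves not only
  identities but also their failure.\<close>

lemma standardize:
  assumes "distinct w" "w \<noteq> []" and m: "m = length w"
  obtains \<sigma> \<tau> where "usub \<sigma> (uw w) = uw [0..<m]" "usub \<tau> (uw [0..<m]) = uw w" "\<And>t. usub \<tau> (usub \<sigma> t) = t"
proof -
  define f where "f = the_inv_into {..<m} ((!) w)"
  have inj: "inj_on ((!) w) {..<m}" using assms by (auto simp: inj_on_nth)
  have f: "f (w ! j) = j" if "j < m" for j unfolding f_def using inj that by (intro the_inv_into_f_f) auto
  define \<sigma> where "\<sigma> i = (if i \<in> set w then UVar (f i) else UVar (m + i))" for i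
  define \<tau> where "\<tau> j = (if j < m then UVar (w ! j) else UVar (j - m))" for j
  have "map \<sigma> w = map UVar [0..<m]" using f m by (auto intro!: nth_equalityI simp: \<sigma>_def)
  then have 1: "usub \<sigma> (uw w) = uw [0..<m]" using assms by (subst usub_ucat) (auto simp: comp_def)
  have "map \<tau> [0..<m] = map UVar w" using m by (auto intro!: nth_equalityI simp: \<tau>_def)
  then have 2: "usub \<tau> (uw [0..<m]) = uw w" using assms by (subst usub_ucat) (auto simp: comp_def)
  have "usub \<tau> (\<sigma> i) = UVar i" for i
  proof (cases "i \<in> set w")
    case True
    then obtain j where "j < m" "i = w ! j" using m by (metis in_set_conv_nth)
    then show ?thesis using True f by (simp add: \<sigma>_def \<tau>_def)
  qed (simp add: \<sigma>_def \<tau>_def)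
  then have "usub \<tau> (usub \<sigma> t) = t" for t by (simp add: usub_usub)
  with 1 2 show thesis using that by blast
qed

lemma rtrancl_exit:
  assumes "(s, t) \<in> (V \<union> B)\<^sup>*" "(s, t) \<notin> V" and V: "\<And>u. (u, u) \<in> V" "\<And>u v w. (u, v) \<in> V \<Longrightarrow> (v, w) \<in> V \<Longrightarrow> (u, w) \<in> V"
  shows "\<exists>s0 t0. (s, s0) \<in> V \<and> (s0, t0) \<in> B \<and> (s0, t0) \<notin> V"
proof (rule ccontr)
  assume n: "\<not> ?thesis"
  have "(s, t) \<in> V" using assms(1)
    by (induction) (use n V in blast)+
  then show False using assms(2) by blast
qed

text \<open>The part common to both lattices. Non-idempotent terms are linear words or squares, and
  for these \<open>lin\<close> and \<open>sq\<close> supply an idempotent term related to them in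
  \<open>A\<close> and in \<open>B\<close>; this reduces the claim to
  \<open>agree_on_Z\<close>.\<close>

lemma cancel_core:
  assumes "square_cond \<nu> k" "equational_theory A" "equational_theory B"
    and int: "\<nu> \<inter> A = \<nu> \<inter> B" and join: "(\<nu> \<union> A)\<^sup>* = (\<nu> \<union> B)\<^sup>*"
    and good: "\<And>s \<theta>. s \<notin> square_cond.Z \<nu> \<Longrightarrow> \<theta> \<in> {\<nu>, A, B} \<Longrightarrow> (s, uw (wd s)) \<in> \<theta>"
    and lin: "\<And>m v w. m \<ge> 1 \<Longrightarrow> (uw [0..<m], v) \<in> A - \<nu> \<Longrightarrow> (uw [0..<m], w) \<in> B - \<nu> \<Longrightarrow>
       \<exists>t\<in>square_cond.Z \<nu>. (uw [0..<m], t) \<in> A \<inter> B"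
    and sq: "\<And>x v w. (uw [x, x], v) \<in> A - \<nu> \<Longrightarrow> (uw [x, x], w) \<in> B - \<nu> \<Longrightarrow>
       \<exists>t\<in>square_cond.Z \<nu>. (uw [x, x], t) \<in> A \<inter> B"
  shows "A \<subseteq> B"
proof -
  interpret V: square_cond \<nu> k by fact
  interpret A: equational_theory A by fact
  interpret B: equational_theory B by fact
  have Z2: "\<exists>t'\<in>V.Z. (s, t') \<in> A \<and> (s, t') \<in> B" if s: "s \<notin> V.Z" "(s, t) \<in> A" "(s, t) \<notin> \<nu>" for s t
  proof -
    \<comment> \<open>A chain of steps from \<open>\<nu>\<close> and \<open>B\<close> leads from
      \<open>s\<close> out of its class under \<open>\<nu>\<close>, so a step of \<open>B\<close>
      leaves that class. It starts at a term of the same shape as \<open>s\<close>.\<close>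
    have "(s, t) \<in> (\<nu> \<union> B)\<^sup>*" using s(2) join by blast
    then obtain s0 t0 where st0: "(s, s0) \<in> \<nu>" "(s0, t0) \<in> B" "(s0, t0) \<notin> \<nu>"
      using rtrancl_exit[of s t \<nu> B] s(3) V.rfl V.trans by metis
    have s0: "s0 \<notin> V.Z" using V.Z_cong st0(1) s(1) by blast
    let ?w = "wd s" and ?v = "wd s0"
    have g: "(s, uw ?w) \<in> \<nu>" "(s, uw ?w) \<in> A" "(s, uw ?w) \<in> B" "(s0, uw ?v) \<in> \<nu>" "(s0, uw ?v) \<in> B"
      using good s(1) s0 by auto
    have a: "(uw ?w, t) \<in> A - \<nu>" using g s A.sym A.trans V.trans by blast
    have b: "(uw ?v, t0) \<in> B - \<nu>" using g st0 B.sym B.trans V.trans by blast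
    have "\<exists>t'\<in>V.Z. (uw ?w, t') \<in> A \<inter> B"
      using V.same_shape[OF st0(1) s(1) g(1,4)]
    proof (elim disjE exE conjE)
      fix x assume "?w = [x, x]" "?v = [x, x]"
      then show ?thesis using sq[of x t t0] a b by simp
    next
      assume d: "distinct ?w" "distinct ?v" "set ?w = set ?v"
      have len: "length ?v = length ?w" using d distinct_card by metis
      define m where "m = length ?w"
      \<comment> \<open>The two words have the same letters, possibly in different orders; separate
        renamings send both to the word to which \<open>lin\<close> applies.\<close>
      obtain \<sigma> \<tau> where 1: "usub \<sigma> (uw ?w) = uw [0..<m]" "usub \<tau> (uw [0..<m]) = uw ?w" "\<And>t. usub \<tau> (usub \<sigma> t) = t"
        using standardize[OF d(1) wd_ne m_def] by metis
      obtain \<sigma>0 \<tau>0 where 2: "usub \<sigma>0 (uw ?v) = uw [0..<m]" "usub \<tau>0 (uw [0..<m]) = uw ?v" "\<And>t. usub \<tau>0 (usub \<sigma>0 t) = t"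
        using standardize[OF d(2) wd_ne] len m_def by metis
      have "(uw [0..<m], usub \<sigma> t) \<in> A" using A.sub[of "uw ?w" t \<sigma>] a 1 by simp
      moreover have "(uw [0..<m], usub \<sigma> t) \<notin> \<nu>" using V.sub[of "uw [0..<m]" "usub \<sigma> t" \<tau>] a 1 by auto
      moreover have "(uw [0..<m], usub \<sigma>0 t0) \<in> B" using B.sub[of "uw ?v" t0 \<sigma>0] b 2 by simp
      moreover have "(uw [0..<m], usub \<sigma>0 t0) \<notin> \<nu>" using V.sub[of "uw [0..<m]" "usub \<sigma>0 t0" \<tau>0] b 2 by auto
      moreover have "m \<ge> 1" by (simp add: m_def Suc_le_eq)
      ultimately obtain t' where t': "t' \<in> V.Z" "(uw [0..<m], t') \<in> A \<inter> B" using lin by blast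
      then have "(uw ?w, usub \<tau> t') \<in> A \<inter> B" using A.sub[of _ t' \<tau>] B.sub[of _ t' \<tau>] 1 by fastforce
      then show ?thesis using V.Z_usub[OF t'(1)] by blast
    qed
    then show ?thesis using g A.trans B.trans by blast
  qed
  have ag: "(s, t) \<in> B" if "s \<in> V.Z" "t \<in> V.Z" "(s, t) \<in> A" for s t
    by (rule agree_on_Z[OF assms(1-5) that])
  have Zt: "(s, t) \<in> B" if s: "s \<in> V.Z" "(s, t) \<in> A" for s t
  proof (cases "t \<in> V.Z")
    case True then show ?thesis using ag s by blast
  next
    case False
    then have "(t, s) \<notin> \<nu>" using V.Z_cong s(1) by blast
    then obtain t' where "t' \<in> V.Z" "(t, t') \<in> A" "(t, t') \<in> B" using Z2[OF False A.sym[OF s(2)]] by blast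
    then show ?thesis using ag[OF s(1)] A.trans[OF s(2)] B.sym B.trans by blast
  qed
  show ?thesis
  proof
    fix p assume "p \<in> A"
    then obtain s t where p: "p = (s, t)" "(s, t) \<in> A" by (cases p) auto
    show "p \<in> B"
    proof (cases "(s, t) \<in> \<nu>")
      case True then show ?thesis using int p by blast
    next
      case nv: False
      show ?thesis
      proof (cases "s \<in> V.Z")
        case True then show ?thesis using Zt p by blast
      next
        case False
        then obtain t' where t': "t' \<in> V.Z" "(s, t') \<in> A" "(s, t') \<in> B" using Z2[OF False p(2) nv] by blast
        then have "(t', t) \<in> B" using Zt[OF t'(1)] A.trans[OF A.sym[OF t'(2)] p(2)] by blast
        then show ?thesis using t' B.trans p by blast
      qed
    qed
  qed
qed

lemma (in epigroup_theory) square_identity: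
  assumes rel: "(uw [i, i], v) \<in> \<theta>" and v: "hasinv v \<or> wd v \<noteq> [i, i]"
  shows "(uw [i, i], UMul (uom (UVar i)) (uw [i, i])) \<in> \<theta>"
proof -
  define x where "x = UVar i"
  \<comment> \<open>Foreign letters become the cube of \<open>x\<close>, so that their presence
    makes an inverse-free right side longer than \<open>x^2\<close>.\<close>
  define \<sigma> where "\<sigma> = (\<lambda>j. if j = i then x else upow x 2)"
  define v' where "v' = usub \<sigma> v"
  have rel': "(UMul x x, v') \<in> \<theta>" using sub[OF rel, of \<sigma>] by (simp add: v'_def \<sigma>_def x_def)
  have vv: "uvars v' \<subseteq> {i}" by (auto simp: v'_def uvars_usub \<sigma>_def x_def split: if_splits)
  have "ue UVar v' = ue (\<lambda>_. x) v'" using vv by (intro uev_cong) (auto simp: x_def)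
  then have qx: "qm x x = q (ue (\<lambda>_. x) v')"
    using rel' q_usub[of UVar v'] by (simp only: q_eq[symmetric] usub_id q_mul)
  have "qm (om x) (qm x x) = qm x x"
  proof (cases "qm (om x) (ue (\<lambda>_. x) v') = ue (\<lambda>_. x) v'")
    case True
    then have "qm (om x) (q (ue (\<lambda>_. x) v')) = q (ue (\<lambda>_. x) v')" by (metis q_simps(2,3))
    then show ?thesis using qx by simp
  next
    case False
    then have n: "\<not> hasinv v'" "ue (\<lambda>_. x) v' = pw x (length (flat v') - 1)" using one_var_value[of v' x] by auto
    have nv: "\<not> hasinv v" using n hasinv_usub unfolding v'_def by blast
    have len: "(\<exists>j\<in>set (wd t). j \<noteq> i) \<longrightarrow> length (wd (usub \<sigma> t)) \<ge> 3" for t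
    proof (induction t)
      case (UVar j) then show ?case by (simp add: \<sigma>_def x_def numeral_2_eq_2)
    qed auto
    have leq: "length (wd (usub \<sigma> t)) = length (wd t)" if "\<forall>j\<in>set (wd t). j = i" for t
      using that by (induction t) (auto simp: \<sigma>_def x_def)
    have "length (wd v') \<noteq> 2"
    proof (cases "\<exists>j\<in>set (wd v). j \<noteq> i")
      case True then show ?thesis using len[of v] by (auto simp: v'_def)
    next
      case False
      then have "length (wd v') = length (wd v)" using leq by (auto simp: v'_def)
      moreover have "wd v \<noteq> [i, i]" using v nv by blast
      ultimately show ?thesis using False by (auto simp: length_Suc_conv numeral_2_eq_2)
    qed
    moreover have "length (flat v') = length (wd v')" using flat_wd[OF n(1)] by simp
    ultimately obtain k where k: "q (pw x k) = qm x x" "k \<noteq> 1" using n qx by (metis One_nat_def Suc_1 Suc_diff_1 flat_ne length_greater_0_conv)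
    \<comment> \<open>\<open>pw x 1\<close> is the square, so \<open>d\<close> is a period of
      \<open>x^2\<close>. For \<open>k = 0\<close> the identity is \<open>x = x^2\<close> and the
      period is 1.\<close>
    obtain d where d: "d \<ge> 1" "pw x (Suc d) = pw x 1"
    proof (cases "k = 0")
      case True
      then have "q x = qm x x" using k by simp
      then have "pw x 2 = pw x 1" by (simp add: numeral_2_eq_2) (metis q_simps(1))
      then show ?thesis using that[of 1] by (simp add: numeral_2_eq_2)
    next
      case False
      then have "k = Suc (k - 1)" "k - 1 \<ge> 1" using k(2) by auto
      moreover from this(1) have "q (pw x k) = pw x k" by (metis pwr.simps(2) q_simps(3))
      ultimately show ?thesis using that[of "k - 1"] k(1) by simp
    qed
    have "pw x (1 + n * d) = pw x 1" for n
    proof (induction n)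
      case (Suc n)
      have "pw x (1 + Suc n * d) = qm (pw x (1 + n * d)) (pw x (d - 1))" 
      proof -
        have "1 + Suc n * d = Suc ((1 + n * d) + (d - 1))" using d(1) by simp
        then show ?thesis by (simp only: pw_add)
      qed
      also have "\<dots> = qm (pw x 1) (pw x (d - 1))" using Suc by simp
      also have "\<dots> = pw x (Suc d)" using d(1) by (simp only: pw_add) simp
      finally show ?case using d(2) by simp
    qed simp
    then have 1: "pw x (1 + Suc n0 * d) = pw x 1" .
    have "Suc n0 * 1 \<le> Suc n0 * d" using d(1) by (intro mult_le_mono2)
    then have "Suc n0 \<le> 1 + Suc n0 * d" by simp
    then show ?thesis using om_pw[of "1 + Suc n0 * d" x] 1 by simp
  qed
  then show ?thesis unfolding q_eq[symmetric] x_def by (simp add: q_mul qm_UMul qi_def)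
qed

text \<open>Since \<open>k \<ge> 2\<close>, an inverse is at least a cube modulo
  \<open>\<nu>\<close> and hence idempotent. Agreement on idempotent terms thus covers all terms
  with inverses, as \<open>common_inverse_term\<close> requires.\<close>

theorem cancellable_epi_semigrp_theories:
  assumes "square_cond \<nu> k" "k \<ge> 2"
  shows "cancellable_in epi_theories \<nu>"
proof -
  interpret V: square_cond \<nu> k by fact
  have "A \<subseteq> B" if AB: "A \<in> epi_theories" "B \<in> epi_theories" and int: "\<nu> \<inter> A = \<nu> \<inter> B" and join: "(\<nu> \<union> A)\<^sup>* = (\<nu> \<union> B)\<^sup>*" for A B
  proof -
    obtain na nb where ab: "epigroup_theory A na" "epigroup_theory B nb" using AB by (auto simp: epi_theories_def)
    interpret A: epigroup_theory A na by fact
    interpret B: epigroup_theory B nb by fact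
    have hz: "hasinv s \<Longrightarrow> s \<in> V.Z" for s using V.Z_hasinv assms(2) by blast
    have agree: "(s, t) \<in> A \<longleftrightarrow> (s, t) \<in> B" if "hasinv s" "hasinv t" for s t
      using agree_on_Z[OF assms(1) A.equational_theory_axioms B.equational_theory_axioms int join hz hz]
        agree_on_Z[OF assms(1) B.equational_theory_axioms A.equational_theory_axioms int[symmetric] join[symmetric] hz hz] that by blast
    have np: "hasinv v \<or> mset (wd v) \<noteq> mset xs" if "(uw xs, v) \<notin> \<nu>" "xs \<noteq> []" for v xs
    proof (rule ccontr)
      assume n: "\<not> ?thesis"
      then have "(uw xs, uw (wd v)) \<in> \<nu>" using that(2) by (intro V.perm) auto
      moreover have "(v, uw (wd v)) \<in> \<nu>" using V.wd_cat n by blast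
      ultimately show False using that V.sym V.trans by blast
    qed
    show ?thesis
    proof (rule cancel_core[OF assms(1) A.equational_theory_axioms B.equational_theory_axioms int join])
      show "(s, uw (wd s)) \<in> \<theta>" if "s \<notin> V.Z" "\<theta> \<in> {\<nu>, A, B}" for s \<theta>
        using that hz V.wd_cat A.wd_cat B.wd_cat by blast
      show "\<exists>t\<in>V.Z. (uw [0..<m], t) \<in> A \<inter> B"
        if h: "m \<ge> 1" "(uw [0..<m], v) \<in> A - \<nu>" "(uw [0..<m], w) \<in> B - \<nu>" for m v w
      proof -
        have ne: "[0..<m] \<noteq> []" using h(1) by simp
        have "\<exists>t. hasinv t \<and> (uw [0..<m], t) \<in> A \<and> (uw [0..<m], t) \<in> B"
          by (rule common_inverse_term[OF ab agree h(1), of v w]) (use h np[OF _ ne] in auto)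
        then show ?thesis using hz by blast
      qed
      show "\<exists>t\<in>V.Z. (uw [x, x], t) \<in> A \<inter> B"
        if h: "(uw [x, x], v) \<in> A - \<nu>" "(uw [x, x], w) \<in> B - \<nu>" for x v w
      proof -
        have "hasinv v \<or> wd v \<noteq> [x, x]" "hasinv w \<or> wd w \<noteq> [x, x]" using np[of "[x, x]" v] np[of "[x, x]" w] h by auto
        then have "(uw [x, x], UMul (uom (UVar x)) (uw [x, x])) \<in> A \<inter> B"
          using A.square_identity[of x v] B.square_identity[of x w] h by blast
        moreover have "UMul (uom (UVar x)) (uw [x, x]) \<in> V.Z" by (rule hz) simp
        ultimately show ?thesis by blast
      qed
    qed
  qed
  then show ?thesis unfolding cancellable_in_def by (metis subset_antisym)
qed

lemma wd_uw: "xs \<noteq> [] \<Longrightarrow> wd (uw xs) = xs"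
proof (induction xs)
  case (Cons x xs) then show ?case by (cases "xs = []") (auto simp: ucat_Cons)
qed simp

section \<open>Semigroup theories reread as epigroup theories\<close>

definition pull :: "nat \<Rightarrow> (uterm \<times> uterm) set \<Rightarrow> (uterm \<times> uterm) set" where
  "pull k A = {(s, t). (tr k s, tr k t) \<in> A}"

context equational_theory begin

lemma pull_equational_theory: "equational_theory (pull k \<theta>)"
proof
  show "(s, r) \<in> pull k \<theta>" if "(s, t) \<in> pull k \<theta>" "(t, r) \<in> pull k \<theta>" for s t r
    using that trans unfolding pull_def by blast
  show "(usub \<sigma> s, usub \<sigma> t) \<in> pull k \<theta>" if "(s, t) \<in> pull k \<theta>" for s t \<sigma>
    using that sub[of "tr k s" "tr k t"] by (simp add: pull_def tr_usub)
  show "(UInv s, UInv t) \<in> pull k \<theta>" if "(s, t) \<in> pull k \<theta>" for s t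
  proof -
    have "(upow (tr k s) n, upow (tr k t) n) \<in> \<theta>" for n
      by (induction n) (use that in \<open>auto simp: pull_def intro: cmul\<close>)
    then show ?thesis by (simp add: pull_def)
  qed
  show "(t, s) \<in> pull k \<theta>" if "(s, t) \<in> pull k \<theta>" for s t using that sym unfolding pull_def by blast
qed (auto simp: pull_def asc intro: cmul)

lemma pw_period:
  assumes "\<And>s. (upow s P, upow s (P + Q)) \<in> \<theta>" "n \<ge> P"
  shows "q (pw s (n + j * Q)) = q (pw s n)"
proof -
  have 0: "q (pw s P) = q (pw s (P + Q))" using assms(1)[of s] unfolding q_eq[symmetric] q_upow .
  have 1: "q (pw s (n + Q)) = q (pw s n)" if "n \<ge> P" for n
    using that
  proof (induction n rule: dec_induct)
    case (step n)
    have "pw s (Suc n + Q) = qm (pw s (n + Q)) s" by simp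
    also have "\<dots> = qm (pw s n) s" using step by (metis q_simps(1))
    finally show ?case by simp
  qed (use 0 in simp)
  show ?thesis
  proof (induction j)
    case (Suc j)
    have "q (pw s (n + Suc j * Q)) = q (pw s ((n + j * Q) + Q))" by (simp add: add.commute add.left_commute)
    then show ?case using 1[of "n + j * Q"] assms(2) Suc by simp
  qed simp
qed

text \<open>A term times its inverse becomes the power with exponent \<open>k + 2\<close>. Being a
  multiple of the period beyond the index, this exponent gives an idempotent that is a unit for all
  sufficiently high powers.\<close>

lemma pull_epigroup_theory:
  assumes per: "\<And>s. (upow s P, upow s (P + Q)) \<in> \<theta>" and Q: "Q dvd k + 2" "k \<ge> P"
  shows "epigroup_theory (pull k \<theta>) P"
proof -
  interpret L: equational_theory "pull k \<theta>" by (rule pull_equational_theory)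
  obtain j where j: "k + 2 = j * Q" using Q by (metis dvd_def mult.commute)
  have qp: "q (upow t n) = q (pw t n)" for t n by (rule q_upow)
  show ?thesis
  proof
    fix s
    let ?t = "tr k s"
    have m: "qm (upow ?t a) r = qm (pw ?t a) r" "qm r (upow ?t a) = qm r (pw ?t a)" for a r
      by (metis q_simps(1) qp, metis q_simps(2) qp)
    show "(UMul s (UInv s), UMul (UInv s) s) \<in> pull k \<theta>"
      by (simp add: pull_def q_eq[symmetric] q_mul m pw_comm)
    have "q (pw ?t (k + 2 + k)) = q (pw ?t k)"
      using pw_period[OF per Q(2), of ?t j] j by (simp add: add.commute add.left_commute)
    moreover have "qm (qm (pw ?t k) ?t) (pw ?t k) = pw ?t (k + 2 + k)"
      using pw_add[of ?t "Suc k" k] by simp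
    ultimately show "(UMul (UMul (UInv s) s) (UInv s), UInv s) \<in> pull k \<theta>"
      by (simp add: pull_def q_eq[symmetric] q_mul qm_UMul m qp)
    have "q (pw ?t (P + (k + 2))) = q (pw ?t P)"
      using pw_period[OF per order_refl, of ?t j] j by simp
    moreover have "qm (pw ?t P) (qm ?t (pw ?t k)) = pw ?t (P + (k + 2))"
      using pw_add[of ?t P "Suc k"] pw_comm[of ?t k] by (simp add: assoc)
    ultimately show "(UMul (upow s P) (UMul s (UInv s)), upow s P) \<in> pull k \<theta>"
      by (simp add: pull_def q_eq[symmetric] q_mul qm_UMul m qp tr_upow)
  qed
qed

text \<open>If the two sides differ in length, all letters are identified. Otherwise some letter has
  different multiplicities, and doubling it produces different lengths.\<close>

lemma period_of:
  assumes id: "\<And>s. (UInv s, s) \<in> \<theta>" and st: "(s, t) \<in> \<theta>" "mset (wd s) \<noteq> mset (wd t)"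
  obtains P Q where "Q \<ge> 1" "\<And>x. (upow x P, upow x (P + Q)) \<in> \<theta>"
proof -
  define X where "X = UVar 0"
  have qid: "qi s = q s" for s using id[of s] unfolding q_eq[symmetric] q_inv .
  have len1: "q (usub (\<lambda>_. X) r) = q (pw X (length (wd r) - 1))" for r
  proof (induction r)
    case (UMul s t)
    obtain a b where ab: "length (wd s) = Suc a" "length (wd t) = Suc b" by (metis wd_ne length_0_conv not0_implies_Suc)
    have "q (usub (\<lambda>_. X) (UMul s t)) = qm (q (usub (\<lambda>_. X) s)) (q (usub (\<lambda>_. X) t))" by (simp add: q_mul)
    then show ?case unfolding UMul using ab by (simp add: pw_add)
  qed (auto simp: q_inv qid)
  have len2: "q (usub (\<lambda>i. if i = y then UMul X X else X) r) = q (pw X (length (wd r) + count (mset (wd r)) y - 1))" for r y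
  proof (induction r)
    case (UVar i) then show ?case by (simp add: q_mul)
  next
    case (UMul s t)
    let ?\<sigma> = "\<lambda>i. if i = y then UMul X X else X"
    obtain a b where ab: "length (wd s) = Suc a" "length (wd t) = Suc b" by (metis wd_ne length_0_conv not0_implies_Suc)
    have "q (usub ?\<sigma> (UMul s t)) = qm (q (usub ?\<sigma> s)) (q (usub ?\<sigma> t))" by (simp add: q_mul)
    then show ?case unfolding UMul using ab by (simp add: pw_add ac_simps)
  qed (auto simp: q_inv qid)
  obtain a b where ab: "a < b" "q (pw X a) = q (pw X b)"
  proof -
    obtain y where y: "count (mset (wd s)) y \<noteq> count (mset (wd t)) y" using st(2) by (meson multiset_eqI)
    let ?a = "length (wd s)" and ?b = "length (wd t)"
    have pos: "?a > 0" "?b > 0" by auto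
    have e1: "q (pw X (?a - 1)) = q (pw X (?b - 1))"
      using sub[OF st(1), of "\<lambda>_. X"] len1 unfolding q_eq[symmetric] by simp
    have e2: "q (pw X (?a + count (mset (wd s)) y - 1)) = q (pw X (?b + count (mset (wd t)) y - 1))"
      using sub[OF st(1), of "\<lambda>i. if i = y then UMul X X else X"] unfolding q_eq[symmetric] len2 .
    show thesis
    proof (cases "?a = ?b")
      case False
      then show thesis using that[of "?a - 1" "?b - 1"] that[of "?b - 1" "?a - 1"] e1 pos by (metis diff_less_mono le_eq_less_or_eq less_one linorder_neqE_nat not_less)
    next
      case True
      then have "?a + count (mset (wd s)) y - 1 \<noteq> ?b + count (mset (wd t)) y - 1" using y pos by linarith
      then show thesis using that e2 by (metis linorder_neqE_nat)
    qed
  qed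
  have "(upow x a, upow x b) \<in> \<theta>" for x
  proof -
    have "(upow X a, upow X b) \<in> \<theta>" using ab(2) unfolding q_eq[symmetric] q_upow .
    then show ?thesis using sub[of _ _ "\<lambda>_. x"] by (simp add: usub_upow X_def) (metis (no_types, lifting) uev.simps(1) usub_upow)
  qed
  then show thesis using that[of "b - a" a] ab(1) by simp
qed

end

theorem cancellable_semigroup_on_theories:
  assumes "square_cond \<nu> k" "\<nu> \<in> sgrp_theories"
  shows "cancellable_in sgrp_theories \<nu>"
proof -
  interpret V: square_cond \<nu> k by fact
  have Vid: "(UInv s, s) \<in> \<nu>" for s using assms by (auto simp: sgrp_theories_def)
  have "A \<subseteq> B" if AB: "A \<in> sgrp_theories" "B \<in> sgrp_theories" and int: "\<nu> \<inter> A = \<nu> \<inter> B" and join: "(\<nu> \<union> A)\<^sup>* = (\<nu> \<union> B)\<^sup>*" for A B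
  proof -
    interpret A: equational_theory A using AB by (simp add: sgrp_theories_def)
    interpret B: equational_theory B using AB by (simp add: sgrp_theories_def)
    have Aid: "(UInv s, s) \<in> A" and Bid: "(UInv s, s) \<in> B" for s using AB by (auto simp: sgrp_theories_def)
    have good: "(s, uw (wd s)) \<in> \<theta>" if "\<theta> \<in> sgrp_theories" for s \<theta>
    proof -
      interpret T: equational_theory \<theta> using that by (simp add: sgrp_theories_def)
      have "(s, tr 0 s) \<in> \<theta>" using that by (intro T.rel_tr) (auto simp: sgrp_theories_def)
      then show ?thesis using T.wd_cat[of "tr 0 s"] T.trans by simp
    qed
    have np: "mset (wd v) \<noteq> mset xs" if "(uw xs, v) \<notin> \<nu>" "xs \<noteq> []" for v xs
    proof
      assume "mset (wd v) = mset xs"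
      then have "(uw xs, uw (wd v)) \<in> \<nu>" using that(2) by (intro V.perm) auto
      then show False using good[OF assms(2), of v] that V.sym V.trans by blast
    qed
    have ag: "(s, t) \<in> A \<longleftrightarrow> (s, t) \<in> B" if "s \<in> V.Z" "t \<in> V.Z" for s t
      using agree_on_Z[OF assms(1) A.equational_theory_axioms B.equational_theory_axioms int join that]
        agree_on_Z[OF assms(1) B.equational_theory_axioms A.equational_theory_axioms int[symmetric] join[symmetric] that] by blast
    \<comment> \<open>Identities outside \<open>\<nu>\<close> make both theories periodic. A common
      index and a common period then allow one exponent \<open>K\<close> for both, so that
      \<open>UInv\<close> has the same meaning in the two pulled theories.\<close>
    have sharp: "\<exists>K P. epigroup_theory (pull K A) P \<and> epigroup_theory (pull K B) P \<and> K \<ge> 2"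
      if h: "(uw xs, v) \<in> A - \<nu>" "(uw xs, w) \<in> B - \<nu>" "xs \<noteq> []" for xs v w
    proof -
      have wx: "mset (wd (uw xs)) = mset xs"
        using h(3) by (simp add: wd_uw)
      have "mset (wd v) \<noteq> mset xs" "mset (wd w) \<noteq> mset xs" by (rule np; use h in blast)+
      then have ne: "mset (wd (uw xs)) \<noteq> mset (wd v)" "mset (wd (uw xs)) \<noteq> mset (wd w)" unfolding wx by simp_all
      obtain P1 Q1 where 1: "Q1 \<ge> 1" "\<And>x. (upow x P1, upow x (P1 + Q1)) \<in> A" 
        by (rule A.period_of[OF Aid _ ne(1)]) (use h in auto)
      obtain P2 Q2 where 2: "Q2 \<ge> 1" "\<And>x. (upow x P2, upow x (P2 + Q2)) \<in> B" 
        by (rule B.period_of[OF Bid _ ne(2)]) (use h in auto)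
      define P Q where "P = P1 + P2" "Q = Q1 * Q2"
      have A': "(upow x P, upow x (P + Q)) \<in> A" for x
        using A.pw_period[of P1 Q1 P x Q2] 1 by (simp add: A.q_eq[symmetric] A.q_upow P_Q_def mult.commute)
      have B': "(upow x P, upow x (P + Q)) \<in> B" for x
        using B.pw_period[of P2 Q2 P x Q1] 2 by (simp add: B.q_eq[symmetric] B.q_upow P_Q_def mult.commute)
      \<comment> \<open>\<open>K + 2\<close> is a multiple of the period, and the summand 4 makes
        \<open>K\<close> at least \<open>P\<close> and at least 2; the latter turns the powers read
        for \<open>UInv\<close> into idempotents modulo \<open>\<nu>\<close>.\<close>
      define K where "K = (P + 4) * Q - 2"
      have "Q \<ge> 1" using 1 2 by (simp add: P_Q_def)
      then have "P + 4 \<le> (P + 4) * Q" using mult_le_mono2[of 1 Q "P + 4"] by simp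
      then have "K + 2 = (P + 4) * Q" "K \<ge> P" "K \<ge> 2" unfolding K_def by linarith+
      then have "epigroup_theory (pull K A) P" "epigroup_theory (pull K B) P" "K \<ge> 2"
        using A.pull_epigroup_theory[OF A'] B.pull_epigroup_theory[OF B'] by (metis dvd_triv_right)+
      then show ?thesis by blast
    qed
    have trZ: "tr K s \<in> V.Z" if "K \<ge> 2" "hasinv s" for K s
      using that(2) by (induction s) (auto intro: V.Z_mul V.Z_pw that(1))
    have agree: "(s, t) \<in> pull K A \<longleftrightarrow> (s, t) \<in> pull K B" if "K \<ge> 2" "hasinv s" "hasinv t" for K s t
      using ag trZ that by (simp add: pull_def)
    have lift: "(uw xs, tr 0 v) \<in> pull K \<theta>" if "\<theta> \<in> sgrp_theories" "(uw xs, v) \<in> \<theta>" "xs \<noteq> []" for xs v K \<theta>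
    proof -
      interpret T: equational_theory \<theta> using that by (simp add: sgrp_theories_def)
      have "(v, tr 0 v) \<in> \<theta>" using that by (intro T.rel_tr) (auto simp: sgrp_theories_def)
      moreover have "\<not> hasinv (uw xs)" using that by (simp add: hasinv_ucat)
      ultimately show ?thesis using that(2) T.trans by (simp add: pull_def)
    qed
    have unlift: "\<exists>t\<in>V.Z. (uw xs, t) \<in> A \<inter> B"
      if "K \<ge> 2" "hasinv t" "(uw xs, t) \<in> pull K A" "(uw xs, t) \<in> pull K B" "xs \<noteq> []" for K t xs
    proof -
      have "\<not> hasinv (uw xs)" using that by (simp add: hasinv_ucat)
      then have "(uw xs, tr K t) \<in> A \<inter> B" using that by (simp add: pull_def)
      then show ?thesis using trZ that by blast
    qed
    show ?thesis
    proof (rule cancel_core[OF assms(1) A.equational_theory_axioms B.equational_theory_axioms int join])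
      show "(s, uw (wd s)) \<in> \<theta>" if "s \<notin> V.Z" "\<theta> \<in> {\<nu>, A, B}" for s \<theta>
        using that good assms(2) AB by blast
      show "\<exists>t\<in>V.Z. (uw [0..<m], t) \<in> A \<inter> B"
        if h: "m \<ge> 1" "(uw [0..<m], v) \<in> A - \<nu>" "(uw [0..<m], w) \<in> B - \<nu>" for m v w
      proof -
        have ne: "[0..<m] \<noteq> []" using h(1) by simp
        obtain K P where K: "epigroup_theory (pull K A) P" "epigroup_theory (pull K B) P" "K \<ge> 2" using sharp[OF h(2,3) ne] by blast
        have "\<exists>t. hasinv t \<and> (uw [0..<m], t) \<in> pull K A \<and> (uw [0..<m], t) \<in> pull K B"
          by (rule common_inverse_term[OF K(1,2) agree[OF K(3)] h(1), of "tr 0 v" "tr 0 w"])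
            (use h lift[OF _ _ ne] AB np[OF _ ne] in auto)
        then show ?thesis using unlift[OF K(3) _ _ _ ne] by blast
      qed
      show "\<exists>t\<in>V.Z. (uw [x, x], t) \<in> A \<inter> B"
        if h: "(uw [x, x], v) \<in> A - \<nu>" "(uw [x, x], w) \<in> B - \<nu>" for x v w
      proof -
        have ne: "[x, x] \<noteq> []" by simp
        obtain K P where K: "epigroup_theory (pull K A) P" "epigroup_theory (pull K B) P" "K \<ge> 2" using sharp[OF h ne] by blast
        have "wd (tr 0 v) \<noteq> [x, x]" "wd (tr 0 w) \<noteq> [x, x]" using np[of "[x, x]" v] np[of "[x, x]" w] h by auto
        then have 1: "(uw [x, x], UMul (uom (UVar x)) (uw [x, x])) \<in> pull K A" and 2:
          "(uw [x, x], UMul (uom (UVar x)) (uw [x, x])) \<in> pull K B"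
          using epigroup_theory.square_identity[OF K(1)] epigroup_theory.square_identity[OF K(2)] lift[OF _ _ ne] AB h by (meson DiffD1)+
        have "hasinv (UMul (uom (UVar x)) (uw [x, x]))" by simp
        from unlift[OF K(3) this 1 2 ne] show ?thesis .
      qed
    qed
  qed
  then show ?thesis unfolding cancellable_in_def by (metis subset_antisym)
qed

section \<open>Necessity\<close>

definition wrel :: "(nat list \<Rightarrow> nat list \<Rightarrow> bool) \<Rightarrow> (uterm \<times> uterm) set" where
  "wrel R = {(s, t). R (wd s) (wd t)}"

lemma wd_usub: "wd (usub \<sigma> t) = concat (map (\<lambda>i. wd (\<sigma> i)) (wd t))" by (induction t) auto

text \<open>\<open>R_long\<close> gives \<open>x^4 = x^5\<close>, so these congruences of words
  yield periodic theories: semigroup theories at once, and epigroup theories when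
  \<open>UInv\<close> is read as a sufficiently high power.\<close>

locale word_cong =
  fixes R :: "nat list \<Rightarrow> nat list \<Rightarrow> bool"
  assumes R_refl: "R w w" and R_sym: "R v w \<Longrightarrow> R w v" and R_trans: "R u v \<Longrightarrow> R v w \<Longrightarrow> R u w"
    and R_left: "R v w \<Longrightarrow> u \<noteq> [] \<Longrightarrow> R (u @ v) (u @ w)"
    and R_right: "R v w \<Longrightarrow> u \<noteq> [] \<Longrightarrow> R (v @ u) (w @ u)"
    and R_sub: "R v w \<Longrightarrow> (\<And>i. f i \<noteq> []) \<Longrightarrow> R (concat (map f v)) (concat (map f w))"
    and R_long: "4 \<le> length v \<Longrightarrow> 4 \<le> length w \<Longrightarrow> take 2 v = take 2 w \<Longrightarrow> R v w"
begin

lemma wrel_equational_theory: "equational_theory (wrel R)"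
proof
  show "(UMul s s', UMul t t') \<in> wrel R" if "(s, t) \<in> wrel R" "(s', t') \<in> wrel R" for s t s' t'
    using that R_trans[OF R_left[of "wd s'" "wd t'" "wd s"] R_right[of "wd s" "wd t" "wd t'"]] by (simp add: wrel_def)
  show "(s, r) \<in> wrel R" if "(s, t) \<in> wrel R" "(t, r) \<in> wrel R" for s t r
    using that R_trans by (auto simp: wrel_def)
  show "(usub \<sigma> s, usub \<sigma> t) \<in> wrel R" if "(s, t) \<in> wrel R" for s t \<sigma>
    using that R_sub[of "wd s" "wd t" "\<lambda>i. wd (\<sigma> i)"] by (simp add: wrel_def wd_usub)
qed (auto simp: wrel_def R_refl R_sym)

lemma pull_wrel_sgrp_theories: "pull 0 (wrel R) \<in> sgrp_theories"
  using equational_theory.pull_equational_theory[OF wrel_equational_theory, of 0] unfolding sgrp_theories_def by (simp add: pull_def wrel_def R_refl)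

lemma wd_upow: "wd (upow s n) = concat (replicate (Suc n) (wd s))"
proof (induction n)
  case (Suc n)
  have "concat (replicate m (wd s)) @ wd s = wd s @ concat (replicate m (wd s))" for m
    by (induction m) auto
  then show ?case using Suc by (simp only: pwr.simps wd.simps) simp
qed simp

lemma pull_wrel_epi_theories: "3 \<le> k \<Longrightarrow> pull k (wrel R) \<in> epi_theories"
proof -
  assume k: "3 \<le> k"
  interpret W: equational_theory "wrel R" by (rule wrel_equational_theory)
  have "(upow s 3, upow s (3 + 1)) \<in> wrel R" for s
  proof -
    have "wd s \<noteq> []" by simp
    then have "1 \<le> length (wd s)" by (simp add: Suc_le_eq)
    then have "R (wd s @ wd s @ wd s @ wd s) (wd s @ wd s @ wd s @ wd s @ wd s)" by (intro R_long) auto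
    then show ?thesis by (simp add: wrel_def wd_upow numeral_eq_Suc)
  qed
  then have "epigroup_theory (pull k (wrel R)) 3" by (rule W.pull_epigroup_theory) (use k in auto)
  then show ?thesis unfolding epi_theories_def by blast
qed

end

section \<open>Two pairs of congruences on words\<close>

lemma length_concat_map: "(\<And>i. f i \<noteq> []) \<Longrightarrow> length w \<le> length (concat (map f w))"
proof (induction w)
  case (Cons x w)
  then have "f x \<noteq> []" "length w \<le> length (concat (map f w))" by auto
  then show ?case by (cases "f x") auto
qed simp

text \<open>The congruences \<open>R1 False \<subseteq> R1 True\<close>, and below \<open>R2 (W2 False) \<subseteq> R2 (W2 True)\<close>, differ in the class of
  \<open>aab\<close>, which is trivial in the smaller one.\<close>

definition R1 :: "bool \<Rightarrow> nat list \<Rightarrow> nat list \<Rightarrow> bool" where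
  "R1 c v w \<longleftrightarrow> v = w \<or> 4 \<le> length v \<and> 4 \<le> length w \<or> (\<exists>a b. v = [a, b, a] \<and> w = [b, a, b])
     \<or> c \<and> (\<exists>a b. v = [a, a, b] \<and> w = [b, b, a])"

lemma R1_cong: "word_cong (R1 c)"
proof
  fix v w and f :: "nat \<Rightarrow> nat list" assume R: "R1 c v w" and f: "\<And>i. f i \<noteq> []"
  have l: "length x \<le> length (concat (map f x))" for x using length_concat_map f by blast
  have pos: "1 \<le> length (f i)" for i using f[of i] by (simp add: Suc_le_eq)
  have single: "(\<exists>i j. f a = [i] \<and> f b = [j]) \<or> 3 \<le> length (f a @ f b)" for a b
    using f[of a] f[of b] by (cases "f a"; cases "f b") (auto simp: Suc_le_eq)
  consider "v = w" | "4 \<le> length v" "4 \<le> length w" | a b where "v = [a, b, a]" "w = [b, a, b]"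
    | a b where c "v = [a, a, b]" "w = [b, b, a]" using R by (auto simp: R1_def)
  then show "R1 c (concat (map f v)) (concat (map f w))"
  proof cases
    case 1 then show ?thesis by (simp add: R1_def)
  next
    case 2 then show ?thesis using l[of v] l[of w] by (simp add: R1_def)
  next
    case 3
    from single[of a b] show ?thesis
    proof
      assume "\<exists>i j. f a = [i] \<and> f b = [j]"
      then show ?thesis using 3 by (auto simp: R1_def)
    next
      assume "3 \<le> length (f a @ f b)"
      then have "4 \<le> length (concat (map f v))" "4 \<le> length (concat (map f w))"
        using 3 pos[of a] pos[of b] by auto
      then show ?thesis by (simp add: R1_def)
    qed
  next
    case 4
    from single[of a b] show ?thesis
    proof
      assume "\<exists>i j. f a = [i] \<and> f b = [j]"
      then show ?thesis using 4 by (auto simp: R1_def)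
    next
      assume "3 \<le> length (f a @ f b)"
      then have "4 \<le> length (concat (map f v))" "4 \<le> length (concat (map f w))"
        using 4 pos[of a] pos[of b] by auto
      then show ?thesis by (simp add: R1_def)
    qed
  qed
next
  show "R1 c w v" if "R1 c v w" for v w using that by (auto simp: R1_def)
  show "R1 c u w" if "R1 c u v" "R1 c v w" for u v w using that unfolding R1_def by fastforce
  show "R1 c (u @ v) (u @ w)" if "R1 c v w" "u \<noteq> []" for u v w using that by (cases u) (auto simp: R1_def)
  show "R1 c (v @ u) (w @ u)" if "R1 c v w" "u \<noteq> []" for u v w using that by (cases u) (auto simp: R1_def)
qed (auto simp: R1_def)

definition R2 :: "nat list set \<Rightarrow> nat list \<Rightarrow> nat list \<Rightarrow> bool" where
  "R2 A v w \<longleftrightarrow> v = w \<or> v \<in> A \<and> w \<in> A \<and> take 2 v = take 2 w"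

lemma take2: "3 \<le> length v \<Longrightarrow> \<exists>a b c r. v = a # b # c # r"
  by (cases v; cases "tl v"; cases "tl (tl v)") auto

text \<open>Letters have nonempty images, so the first two letters of a word determine those of its
  image. A word of \<open>A\<close> multiplied by a nonempty word has length at least 4 and stays in
  \<open>A\<close>.\<close>

lemma R2_cong:
  assumes A: "\<And>w. 4 \<le> length w \<Longrightarrow> w \<in> A" "\<And>w. w \<in> A \<Longrightarrow> 3 \<le> length w"
    "\<And>w f. w \<in> A \<Longrightarrow> (\<And>i. f i \<noteq> []) \<Longrightarrow> concat (map f w) \<in> A"
  shows "word_cong (R2 A)"
proof
  show "R2 A (u @ v) (u @ w)" if "R2 A v w" "u \<noteq> []" for u v w
  proof (cases "v = w")
    case False
    then have vw: "v \<in> A" "w \<in> A" "take 2 v = take 2 w" using that by (auto simp: R2_def)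
    then have "u @ v \<in> A" "u @ w \<in> A" using that(2) A(2)[of v] A(2)[of w] by (cases u; auto intro!: A(1))+
    moreover have "take 2 (u @ v) = take 2 (u @ w)"
      using vw take2[OF A(2)[OF vw(1)]] take2[OF A(2)[OF vw(2)]] by (cases u; cases "tl u") auto
    ultimately show ?thesis by (simp add: R2_def)
  qed (simp add: R2_def)
  show "R2 A (v @ u) (w @ u)" if "R2 A v w" "u \<noteq> []" for u v w
  proof (cases "v = w")
    case False
    then have vw: "v \<in> A" "w \<in> A" "take 2 v = take 2 w" using that by (auto simp: R2_def)
    then have "v @ u \<in> A" "w @ u \<in> A" using that(2) A(2)[of v] A(2)[of w] by (cases u; auto intro!: A(1))+
    then show ?thesis using vw A(2)[of v] A(2)[of w] by (simp add: R2_def)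
  qed (simp add: R2_def)
  fix v w and f :: "nat \<Rightarrow> nat list" assume R: "R2 A v w" and f: "\<And>i. f i \<noteq> []"
  show "R2 A (concat (map f v)) (concat (map f w))"
  proof (cases "v = w")
    case False
    then have vw: "v \<in> A" "w \<in> A" "take 2 v = take 2 w" using R by (auto simp: R2_def)
    then obtain a b r s where "v = a # b # r" "w = a # b # s"
      using take2[OF A(2)[OF vw(1)]] take2[OF A(2)[OF vw(2)]] by auto
    then have "take 2 (concat (map f v)) = take 2 (concat (map f w))"
      using f[of a] f[of b] by (cases "f a"; cases "tl (f a)"; cases "f b") auto
    then show ?thesis using A(3) vw f by (simp add: R2_def)
  qed (simp add: R2_def)
qed (use A in \<open>auto simp: R2_def\<close>)

definition W2 :: "bool \<Rightarrow> nat list set" where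
  "W2 c = {w. 4 \<le> length w \<or> (\<exists>a b. w = [a, b, a]) \<or> c \<and> (\<exists>a b. w = [a, a, b])}"

lemma W2_cong: "word_cong (R2 (W2 c))"
proof (rule R2_cong)
  fix w and f :: "nat \<Rightarrow> nat list" assume w: "w \<in> W2 c" and f: "\<And>i. f i \<noteq> []"
  have l: "length x \<le> length (concat (map f x))" for x using length_concat_map f by blast
  have pos: "1 \<le> length (f i)" for i using f[of i] by (simp add: Suc_le_eq)
  have single: "(\<exists>i j. f a = [i] \<and> f b = [j]) \<or> 4 \<le> length (f a) + length (f b) + length (f a)
    \<and> 4 \<le> length (f a) + length (f a) + length (f b)
    \<or> 4 \<le> length (f a) + length (f b) + length (f a)" for a b
    using pos[of a] pos[of b] by (cases "f a"; cases "f b"; cases "tl (f a)"; cases "tl (f b)") auto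
  from w show "concat (map f w) \<in> W2 c" unfolding W2_def
  proof (elim CollectE disjE exE conjE)
    assume "4 \<le> length w" then show "concat (map f w) \<in> {w. 4 \<le> length w \<or> (\<exists>a b. w = [a, b, a]) \<or> c \<and> (\<exists>a b. w = [a, a, b])}"
      using l[of w] by simp
  next
    fix a b assume "w = [a, b, a]" then show "concat (map f w) \<in> {w. 4 \<le> length w \<or> (\<exists>a b. w = [a, b, a]) \<or> c \<and> (\<exists>a b. w = [a, a, b])}"
      using single[of a b] by auto
  next
    fix a b assume "c" "w = [a, a, b]" then show "concat (map f w) \<in> {w. 4 \<le> length w \<or> (\<exists>a b. w = [a, b, a]) \<or> c \<and> (\<exists>a b. w = [a, a, b])}"
      using single[of a b] by auto
  qed
qed (auto simp: W2_def)

lemma rtrancl_leave: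
  assumes "(s, t) \<in> r\<^sup>*" "s \<in> S" "t \<notin> S"
  shows "\<exists>u v. (u, v) \<in> r \<and> u \<in> S \<and> v \<notin> S"
  using assms by (induction) auto

theorem modular_imp_square_cond:
  assumes "commutative_theory \<nu>" and inv: "\<And>s. (UInv s, upow s k) \<in> \<nu>" and mod: "modular_in F \<nu>"
    and F: "\<And>R. word_cong R \<Longrightarrow> pull k (wrel R) \<in> F"
  shows "square_cond \<nu> k"
proof -
  interpret V: commutative_theory \<nu> by fact
  define h where "h s = wd (tr k s)" for s
  define T where "T = uw [0, 0, 1]"
  have hw: "h (uw xs) = xs" if "xs \<noteq> []" for xs
    using that by (simp add: h_def hasinv_ucat wd_uw)
  have norm: "(s, uw (h s)) \<in> \<nu>" for s
    unfolding h_def by (rule V.trans[OF V.rel_tr[OF inv] V.wd_cat[OF hasinv_tr]])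
  have pullI: "(s, t) \<in> pull k (wrel R) \<longleftrightarrow> R (h s) (h t)" for R s t by (simp add: pull_def wrel_def h_def)
  \<comment> \<open>The pentagon: \<open>\<nu>\<close> and the smaller theory connect
    \<open>xxy\<close> with \<open>z\<close> through two intermediate words, while the larger theory
    does so directly. Modularity turns this into a chain of steps from the smaller theory and from
    \<open>\<nu>\<close> inside the larger one. The smaller theory is trivial at \<open>xxy\<close>,
    so a step leaving that word belongs to \<open>\<nu>\<close>.\<close>
  have key: "\<exists>w. w \<noteq> [0, 0, 1] \<and> R' [0, 0, 1] w \<and> (T, uw w) \<in> \<nu>"
    if RR: "word_cong R" "word_cong R'" "\<And>v w. R v w \<Longrightarrow> R' v w" "\<And>w. R [0, 0, 1] w \<Longrightarrow> w = [0, 0, 1]"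
      and xyz: "mset x = {#0, 0, 1#}" "mset y = mset z" "R x y" "R' [0, 0, 1] z" "z \<noteq> [0, 0, 1]" "z \<noteq> []"
    for R R' x y z
  proof -
    interpret R': word_cong R' by fact
    let ?A = "pull k (wrel R)" and ?B = "pull k (wrel R')"
    have ne: "x \<noteq> []" "y \<noteq> []" using xyz(1,2,6) by auto
    have 1: "(T, uw x) \<in> \<nu> \<union> ?A" unfolding T_def using xyz(1) by (intro UnI1 V.perm) auto
    have 2: "(uw x, uw y) \<in> \<nu> \<union> ?A" using hw ne xyz by (intro UnI2) (simp add: pullI)
    have 3: "(uw y, uw z) \<in> \<nu> \<union> ?A" using xyz ne by (intro UnI1 V.perm) auto
    have "(T, uw z) \<in> (\<nu> \<union> ?A)\<^sup>*"
      by (rule rtrancl_into_rtrancl[OF rtrancl_into_rtrancl[OF r_into_rtrancl[OF 1] 2] 3])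
    moreover have "(T, uw z) \<in> ?B" unfolding pullI using hw[of z] hw[of "[0, 0, 1]"] xyz by (simp add: T_def)
    moreover have "?A \<subseteq> ?B" using RR(3) by (auto simp: pullI)
    ultimately have a: "(T, uw z) \<in> ((\<nu> \<inter> ?B) \<union> ?A)\<^sup>*"
      using mod F[OF RR(1)] F[OF RR(2)] unfolding modular_in_def by blast
    have b: "T \<in> {s. h s = [0, 0, 1]}" using hw[of "[0, 0, 1]"] by (simp add: T_def)
    have c: "uw z \<notin> {s. h s = [0, 0, 1]}" using hw[of z] xyz by simp
    obtain u v where uv: "(u, v) \<in> (\<nu> \<inter> ?B) \<union> ?A" "h u = [0, 0, 1]" "h v \<noteq> [0, 0, 1]"
      using rtrancl_leave[OF a b c] by auto
    have "(u, v) \<notin> ?A" using RR(4) uv by (auto simp: pullI)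
    then have d: "(u, v) \<in> \<nu>" "R' [0, 0, 1] (h v)" using uv by (auto simp: pullI)
    have "(u, T) \<in> \<nu>" using norm[of u] unfolding uv(2) T_def .
    then have "(T, uw (h v)) \<in> \<nu>" by (rule V.trans[OF V.trans[OF V.sym d(1)] norm])
    then show ?thesis using d(2) uv(3) by blast
  qed
  \<comment> \<open>\<open>R1 False\<close> relates \<open>xyx\<close> to \<open>yxy\<close>.
    Rearranged, these are \<open>xxy\<close> and \<open>yyx\<close>, which only
    \<open>R1 True\<close> relates.\<close>
  have "\<exists>w. w \<noteq> [0, 0, 1] \<and> R1 True [0, 0, 1] w \<and> (T, uw w) \<in> \<nu>"
    by (rule key[OF R1_cong[of False] R1_cong[of True], of "[0, 1, 0]" "[1, 0, 1]" "[1, 1, 0]"])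
      (auto simp: R1_def)
  then have "(T, uw [1, 1, 0]) \<in> \<nu>" by (auto simp: R1_def)
  then have swap: "V.qm s (V.qm s t) = V.qm t (V.qm t s)" for s t
    using V.sub[of T _ "\<lambda>i. if i = 0 then s else t"] unfolding V.q_eq[symmetric] T_def
    by (fastforce simp: V.q_mul V.qm_UMul)
  \<comment> \<open>\<open>xyx\<close> is related to \<open>xyxy\<close>, a rearrangement of
    \<open>xxyy\<close>, which has the same first two letters as \<open>xxy\<close>.\<close>
  have "\<exists>w. w \<noteq> [0, 0, 1] \<and> R2 (W2 True) [0, 0, 1] w \<and> (T, uw w) \<in> \<nu>"
    by (rule key[OF W2_cong[of False] W2_cong[of True], of "[0, 1, 0]" "[0, 1, 0, 1]" "[0, 0, 1, 1]"])
      (auto simp: R2_def W2_def)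
  then obtain w where w: "w \<noteq> [0, 0, 1]" "w \<in> W2 True" "take 2 w = [0, 0]" "(T, uw w) \<in> \<nu>"
    by (auto simp: R2_def)
  have "3 \<le> length w" using w(2) by (auto simp: W2_def)
  then obtain r where r: "w = 0 # 0 # r" "r \<noteq> []" using w(3) take2 by fastforce
  define x y where "x = UVar 0" "y = UVar 1"
  \<comment> \<open>By the symmetry \<open>x^2 y = y^2 x\<close> this element absorbs both letters,
    so every proper right multiple of \<open>x^2 y\<close> by a word in \<open>x\<close> and
    \<open>y\<close> collapses to it.\<close>
  define Q where "Q = V.qm x (V.qm x (V.qm y y))"
  have Q3: "V.qm x (V.qm x (V.qm x y)) = Q" "V.qm y (V.qm y (V.qm y x)) = Q"
  proof -
    have "V.qm x (V.qm x (V.qm x y)) = V.qm x (V.qm y (V.qm y x))" using swap by simp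
    then show "V.qm x (V.qm x (V.qm x y)) = Q" unfolding Q_def by (simp add: V.qac)
    have "V.qm y (V.qm y (V.qm y x)) = V.qm y (V.qm x (V.qm x y))" using swap by simp
    then show "V.qm y (V.qm y (V.qm y x)) = Q" unfolding Q_def by (simp add: V.qac)
  qed
  have Qx: "V.qm Q x = Q"
  proof -
    have "V.qm Q x = V.qm (V.qm x x) (V.qm (V.qm x x) y)" unfolding Q3(1)[symmetric] by (simp add: V.qac)
    also have "\<dots> = V.qm y (V.qm y (V.qm x x))" by (rule swap)
    also have "\<dots> = Q" unfolding Q_def by (simp add: V.qac)
    finally show ?thesis .
  qed
  have Qy: "V.qm Q y = Q"
  proof -
    have "V.qm Q y = V.qm (V.qm y y) (V.qm (V.qm y y) x)" unfolding Q3(2)[symmetric] by (simp add: V.qac)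
    also have "\<dots> = V.qm x (V.qm x (V.qm y y))" by (rule swap)
    finally show ?thesis unfolding Q_def .
  qed
  have Qw: "V.qm Q (uw u) = Q" if "set u \<subseteq> {0, 1}" "u \<noteq> []" for u
    using that(2,1)
  proof (induction u rule: list_nonempty_induct)
    case (single a) then show ?case using Qx Qy by (auto simp: x_y_def)
  next
    case (cons a u)
    have "V.qm Q (uw (a # u)) = V.qm (V.qm Q (UVar a)) (uw u)"
      using cons.hyps by (simp add: ucat_Cons V.qm_UMul V.assoc)
    also have "\<dots> = V.qm Q (uw u)" using cons.prems Qx Qy by (auto simp: x_y_def)
    finally show ?case using cons by simp
  qed
  have qT: "V.q T = V.qm x (V.qm x y)" by (simp add: T_def x_y_def V.q_mul V.qm_UMul)
  have TQ: "V.q T = Q"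
  proof -
    \<comment> \<open>Foreign letters become \<open>y^2\<close>, so the tail does not shrink to the
      single letter \<open>y\<close> unless it was \<open>y\<close> from the start.\<close>
    define g where "g = (\<lambda>i::nat. if i = 0 then [0] else if i = 1 then [1] else [1, 1::nat])"
    define r' where "r' = concat (map g r)"
    have gne: "g i \<noteq> []" for i by (simp add: g_def)
    have r'ne: "r' \<noteq> []" using r(2) gne by (cases r) (auto simp: r'_def)
    have r'set: "set r' \<subseteq> {0, 1}" by (auto simp: r'_def g_def split: if_splits)
    have "(usub (\<lambda>i. uw (g i)) (uw [0, 0, 1]), usub (\<lambda>i. uw (g i)) (uw w)) \<in> \<nu>" by (rule V.sub[OF w(4)[unfolded T_def]])
    moreover have "usub (\<lambda>i. uw (g i)) (uw [0, 0, 1]) = T" by (simp add: T_def g_def)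
    moreover have "(usub (\<lambda>i. uw (g i)) (uw w), uw ([0, 0] @ r')) \<in> \<nu>"
    proof -
      have h0: "\<not> hasinv (uw (g i))" for i using gne by (simp add: hasinv_ucat)
      have nh: "\<not> hasinv (usub (\<lambda>i. uw (g i)) t)" if "\<not> hasinv t" for t
        using that by (induction t) (auto simp: h0)
      have "\<not> hasinv (uw w)" using r by (simp add: hasinv_ucat)
      then have "(usub (\<lambda>i. uw (g i)) (uw w), uw (wd (usub (\<lambda>i. uw (g i)) (uw w)))) \<in> \<nu>" using nh V.wd_cat by blast
      moreover have "wd (usub (\<lambda>i. uw (g i)) (uw w)) = [0, 0] @ r'"
      proof -
        have "wd (uw w) = w" using r by (intro wd_uw) auto
        moreover have "g 0 = [0]" by (simp add: g_def)
        ultimately show ?thesis unfolding wd_usub wd_uw[OF gne] by (simp add: r r'_def)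
      qed
      ultimately show ?thesis by simp
    qed
    ultimately have T: "(T, uw ([0, 0] @ r')) \<in> \<nu>" using V.trans by metis
    show ?thesis
    proof (cases "1 \<in> set r'")
      case False
      \<comment> \<open>With \<open>y\<close> absent from one side, replacing \<open>y\<close> by
        \<open>y^2\<close> fixes that side and turns \<open>x^2 y\<close> into
        \<open>x^2 y^2\<close>.\<close>
      define \<tau> where "\<tau> = UVar(1 := UMul y y)"
      have "1 \<notin> uvars (uw ([0, 0] @ r'))" using False uvars_ucat[of "map UVar ([0, 0] @ r')"] by auto
      then have "usub \<tau> (uw ([0, 0] @ r')) = usub UVar (uw ([0, 0] @ r'))" by (intro usub_cong) (auto simp: \<tau>_def)
      then have "(usub \<tau> T, uw ([0, 0] @ r')) \<in> \<nu>" using V.sub[OF T, of \<tau>] by simp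
      then have "V.q T = V.q (usub \<tau> T)" using T V.sym V.trans V.q_eq by blast
      also have "\<dots> = Q" by (simp add: T_def \<tau>_def Q_def x_y_def V.q_mul V.qm_UMul)
      finally show ?thesis .
    next
      case True
      then obtain a b where ab: "r' = a @ 1 # b" by (metis split_list)
      have "a @ b \<noteq> []"
      proof
        assume "a @ b = []"
        then have r1: "r' = [1]" using ab by simp
        then have "length r \<le> 1" using length_concat_map[of g r] gne by (simp add: r'_def)
        then obtain i where "r = [i]" using r(2) by (cases r) auto
        then have "r = [1]" using r1 by (auto simp: r'_def g_def split: if_splits)
        then show False using w(1) r by simp
      qed
      then obtain c e where ce: "a @ b = c # e" by (cases "a @ b") auto
      have "mset ([0, 0] @ r') = mset ([0, 0, 1] @ (c # e))" unfolding ce[symmetric] by (simp add: ab)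
      then have "(uw ([0, 0] @ r'), uw ([0, 0, 1] @ (c # e))) \<in> \<nu>" by (intro V.perm) auto
      moreover have "(uw ([0, 0, 1] @ (c # e)), UMul T (uw (c # e))) \<in> \<nu>"
        using V.cat_append[of "map UVar [0, 0, 1]" "map UVar (c # e)"] by (simp add: T_def)
      ultimately have "V.q T = V.qm T (uw (c # e))" using T V.trans V.q_eq V.q_mul by metis
      moreover have "V.qm T (UVar c) = Q"
      proof -
        have "set (a @ b) \<subseteq> {0, 1}" using r'set ab by auto
        then have "c = 0 \<or> c = 1" using ce by auto
        then have "UVar c = x \<or> UVar c = y" by (auto simp: x_y_def)
        moreover have "V.qm T (UVar c) = V.qm (V.qm x (V.qm x y)) (UVar c)" using qT by (metis V.q_simps(1))
        ultimately show ?thesis using Q3 by (auto simp: Q_def V.qac)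
      qed
      moreover have "V.qm T (uw (c # e)) = Q"
      proof (cases "e = []")
        case True then show ?thesis using calculation(2) by simp
      next
        case False
        have "set e \<subseteq> {0, 1}" using r'set ab ce by (metis Un_subset_iff list.set(2) set_append set_subset_Cons subset_trans set_ConsD insert_subset)
        then show ?thesis using Qw[of e] False calculation(2)
          by (simp add: ucat_Cons V.qm_UMul) (metis V.assoc)
      qed
      ultimately show ?thesis by simp
    qed
  qed
  show ?thesis
  proof
    show "(UInv s, upow s k) \<in> \<nu>" for s by (rule inv)
    fix s t :: uterm
    let ?\<sigma> = "\<lambda>i. if i = (0::nat) then s else t"
    have "V.q T = V.q (UMul (UMul x x) (UMul y y))" using TQ by (simp add: Q_def V.q_mul V.qm_UMul V.assoc)
    moreover have "V.q T = V.q (UMul (UMul x x) y)" using qT by (simp add: V.q_mul V.qm_UMul V.assoc)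
    ultimately have "(UMul (UMul x x) y, UMul (UMul x x) (UMul y y)) \<in> \<nu>" using V.q_eq by simp
    from V.sub[OF this, of ?\<sigma>] show "(UMul (UMul s s) t, UMul (UMul s s) (UMul t t)) \<in> \<nu>"
      by (simp add: x_y_def)
  qed
qed

section \<open>Pseudoinverses in epigroups\<close>

locale semigroup_on =
  fixes S :: "('a, 'b) magma_scheme" (structure)
  assumes sg: "is_semigroup S"
begin

lemma mul_closed [intro, simp]: "x \<in> carrier S \<Longrightarrow> y \<in> carrier S \<Longrightarrow> x \<cdot> y \<in> carrier S"
  using sg by (auto simp: is_semigroup_def magma_closed_def)

lemma massoc: "x \<in> carrier S \<Longrightarrow> y \<in> carrier S \<Longrightarrow> z \<in> carrier S \<Longrightarrow> (x \<cdot> y) \<cdot> z = x \<cdot> (y \<cdot> z)"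
  using sg by (auto simp: is_semigroup_def)

text \<open>Extending the multiplication to the whole type makes the carrier-free locale \<open>semigrp\<close> applicable.\<close>

definition base :: 'a where "base = (SOME x. x \<in> carrier S)"

lemma base: "base \<in> carrier S"
  using sg unfolding base_def is_semigroup_def magma_closed_def by (metis ex_in_conv someI_ex)

definition pr :: "'a \<Rightarrow> 'a" where "pr x = (if x \<in> carrier S then x else base)"
definition tmul :: "'a \<Rightarrow> 'a \<Rightarrow> 'a" where "tmul x y = pr x \<cdot> pr y"

lemma pr_in [simp]: "pr x \<in> carrier S" by (simp add: pr_def base)
lemma pr_id [simp]: "x \<in> carrier S \<Longrightarrow> pr x = x" by (simp add: pr_def)
lemma tmul_eq: "x \<in> carrier S \<Longrightarrow> y \<in> carrier S \<Longrightarrow> tmul x y = x \<cdot> y" by (simp add: tmul_def)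

sublocale T: semigrp tmul
  by unfold_locales (simp add: tmul_def massoc)

definition mpw :: "'a \<Rightarrow> nat \<Rightarrow> 'a" where "mpw x n = spow S x (Suc n)"

lemma mpw_simps [simp]: "mpw x 0 = x" "mpw x (Suc n) = mpw x n \<cdot> x"
  by (auto simp: mpw_def spow_def)

lemma mpw_in [intro, simp]: "x \<in> carrier S \<Longrightarrow> mpw x n \<in> carrier S" by (induction n) auto

lemma mpw_T: "x \<in> carrier S \<Longrightarrow> mpw x n = T.pw x n"
proof (induction n)
  case (Suc n)
  then show ?case using tmul_eq[of "mpw x n" x] mpw_in[of x n] by simp
qed simp

definition pinv_laws :: "'a \<Rightarrow> 'a \<Rightarrow> nat \<Rightarrow> bool" where
  "pinv_laws x y n \<longleftrightarrow> x \<cdot> y = y \<cdot> x \<and> y \<cdot> x \<cdot> y = y \<and> mpw x n \<cdot> (x \<cdot> y) = mpw x n"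

lemma pinv_laws_unique:
  assumes "x \<in> carrier S" "y \<in> carrier S" "z \<in> carrier S" "pinv_laws x y n" "pinv_laws x z m"
  shows "y = z"
proof -
  have "T.pw x n = mpw x n" "T.pw x m = mpw x m" using mpw_T assms by auto
  then show ?thesis using assms
    by (intro T.pinv_unique[of x y n z m]) (auto simp: pinv_laws_def tmul_eq)
qed

text \<open>The group of units of the local monoid \<open>e S e\<close>, that is, the class of the
  idempotent \<open>e\<close> under Green's relation H.\<close>

definition H_class :: "'a \<Rightarrow> 'a set" where
  "H_class e = {a \<in> carrier S. a \<cdot> e = a \<and> e \<cdot> a = a \<and>
     (\<exists>b\<in>carrier S. b \<cdot> e = b \<and> e \<cdot> b = b \<and> a \<cdot> b = e \<and> b \<cdot> a = e)}"

lemma H_class_group: assumes e: "e \<in> carrier S" "e \<cdot> e = e"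
  shows "sg_subgroup S (H_class e) e"
proof -
  have "group (group_on S (H_class e) e)"
  proof (rule groupI)
    fix x y assume "x \<in> carrier (group_on S (H_class e) e)" "y \<in> carrier (group_on S (H_class e) e)"
    then have xy: "x \<in> H_class e" "y \<in> H_class e" by (auto simp: group_on_def)
    then obtain x' y' where i: "x \<in> carrier S" "x \<cdot> e = x" "e \<cdot> x = x" "x' \<in> carrier S" "x' \<cdot> e = x'" "e \<cdot> x' = x'" "x \<cdot> x' = e" "x' \<cdot> x = e"
      "y \<in> carrier S" "y \<cdot> e = y" "e \<cdot> y = y" "y' \<in> carrier S" "y' \<cdot> e = y'" "e \<cdot> y' = y'" "y \<cdot> y' = e" "y' \<cdot> y = e"
      by (auto simp: H_class_def)
    have "(x \<cdot> y) \<cdot> (y' \<cdot> x') = x \<cdot> ((y \<cdot> y') \<cdot> x')" using i(1,4,9,12) by (simp add: massoc)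
    then have 1: "(x \<cdot> y) \<cdot> (y' \<cdot> x') = e" using i by simp
    have "(y' \<cdot> x') \<cdot> (x \<cdot> y) = y' \<cdot> ((x' \<cdot> x) \<cdot> y)" using i(1,4,9,12) by (simp add: massoc)
    then have 2: "(y' \<cdot> x') \<cdot> (x \<cdot> y) = e" using i by simp
    have 3: "(x \<cdot> y) \<cdot> e = x \<cdot> y" "(y' \<cdot> x') \<cdot> e = y' \<cdot> x'" using i e by (simp_all add: massoc)
    have 4: "e \<cdot> (x \<cdot> y) = x \<cdot> y" "e \<cdot> (y' \<cdot> x') = y' \<cdot> x'" using i e by (simp_all add: massoc[symmetric])
    have "x \<cdot> y \<in> H_class e" unfolding H_class_def using i 1 2 3 4 by (intro CollectI conjI bexI[of _ "y' \<cdot> x'"]) auto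
    then show "x \<otimes>\<^bsub>group_on S (H_class e) e\<^esub> y \<in> carrier (group_on S (H_class e) e)" by (simp add: group_on_def)
    have "\<exists>z\<in>H_class e. z \<cdot> x = e" using i by (intro bexI[of _ x']) (auto simp: H_class_def)
    then show "\<exists>z\<in>carrier (group_on S (H_class e) e). z \<otimes>\<^bsub>group_on S (H_class e) e\<^esub> x = \<one>\<^bsub>group_on S (H_class e) e\<^esub>"
      by (simp add: group_on_def)
  qed (use e in \<open>auto simp: group_on_def H_class_def massoc\<close>)
  then show ?thesis by (auto simp: sg_subgroup_def H_class_def)
qed

lemma subgroup_H_class: assumes "sg_subgroup S G e"
  shows "e \<in> G" "G \<subseteq> H_class e" "e \<cdot> e = e" "e \<in> carrier S"
proof -
  interpret G: group "group_on S G e" using assms by (simp add: sg_subgroup_def)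
  have GS: "G \<subseteq> carrier S" using assms by (simp add: sg_subgroup_def)
  show eG: "e \<in> G" using G.one_closed by (simp add: group_on_def)
  then show "e \<in> carrier S" using GS by blast
  show "e \<cdot> e = e" using G.l_one[OF G.one_closed] by (simp add: group_on_def)
  show "G \<subseteq> H_class e"
  proof
    fix a assume a: "a \<in> G"
    let ?b = "inv\<^bsub>group_on S G e\<^esub> a"
    have "?b \<in> G" "a \<cdot> ?b = e" "?b \<cdot> a = e" "a \<cdot> e = a" "e \<cdot> a = a" "?b \<cdot> e = ?b" "e \<cdot> ?b = ?b"
      using G.inv_closed[of a] G.r_inv[of a] G.l_inv[of a] G.r_one[of a] G.l_one[of a] G.r_one[of ?b] G.l_one[of ?b] a
      by (auto simp: group_on_def)
    then show "a \<in> H_class e" unfolding H_class_def using a GS by blast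
  qed
qed

text \<open>An idempotent in a group is its unit. So a subgroup containing \<open>H_class e\<close>
  has the unit \<open>e\<close> and consists of units of \<open>e S e\<close>.\<close>

lemma maximal_iff: "maximal_subgroup S G e \<longleftrightarrow> e \<in> carrier S \<and> e \<cdot> e = e \<and> G = H_class e"
proof
  assume a: "maximal_subgroup S G e"
  then have "sg_subgroup S G e" by (simp add: maximal_subgroup_def)
  note h = subgroup_H_class[OF this]
  then show "e \<in> carrier S \<and> e \<cdot> e = e \<and> G = H_class e"
    using a H_class_group unfolding maximal_subgroup_def by blast
next
  assume a: "e \<in> carrier S \<and> e \<cdot> e = e \<and> G = H_class e"
  then have sgr: "sg_subgroup S (H_class e) e" using H_class_group by blast
  have "H = H_class e" if H: "sg_subgroup S H f" "H_class e \<subseteq> H" for H f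
  proof -
    interpret H: group "group_on S H f" using H by (simp add: sg_subgroup_def)
    have "e \<in> H" using H subgroup_H_class(1)[OF sgr] by blast
    moreover have "e \<cdot> e = e" using a by simp
    ultimately have "e = f" using H.l_cancel_one[of e e] H.one_closed by (auto simp: group_on_def)
    then show ?thesis using subgroup_H_class(2)[OF H(1)] H(2) by blast
  qed
  then show "maximal_subgroup S G e" unfolding maximal_subgroup_def using a sgr by blast
qed

text \<open>The unit \<open>e\<close> is the product of a power of \<open>x\<close> with the group
  inverse of that power, on either side; this makes \<open>e\<close> commute with \<open>x\<close>.
  The laws then hold with that power as exponent.\<close>

lemma pseudoinverse_imp_laws:
  assumes x: "x \<in> carrier S" and p: "is_pseudoinverse S x y"
  shows "y \<in> carrier S" "\<exists>n. pinv_laws x y n"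
proof -
  obtain e n where e: "e \<in> carrier S" "e \<cdot> e = e" and n: "n \<ge> 1" "spow S x n \<in> H_class e"
    and y: "y = inv\<^bsub>group_on S (H_class e) e\<^esub> (x \<cdot> e)"
    using p unfolding is_pseudoinverse_def maximal_iff by blast
  define k where "k = n - 1"
  define z where "z = mpw x k"
  have zH: "z \<in> H_class e" using n by (simp add: z_def mpw_def k_def)
  then obtain w where w: "w \<in> carrier S" "w \<cdot> e = w" "e \<cdot> w = w" "z \<cdot> w = e" "w \<cdot> z = e"
    and z: "z \<in> carrier S" "z \<cdot> e = z" "e \<cdot> z = z" by (auto simp: H_class_def)
  have zx: "z \<cdot> x = x \<cdot> z" unfolding z_def
    using mpw_T[OF x] T.pw_comm[of x k] x by (metis mpw_in tmul_eq)
  have xe: "x \<cdot> e = e \<cdot> (x \<cdot> e)"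
  proof -
    have "x \<cdot> e = x \<cdot> (z \<cdot> w)" using w by simp
    also have "\<dots> = (x \<cdot> z) \<cdot> w" using x w(1) z(1) by (simp add: massoc)
    also have "\<dots> = z \<cdot> (x \<cdot> w)" using zx x w z by (metis massoc)
    finally have "x \<cdot> e = z \<cdot> (x \<cdot> w)" .
    then show ?thesis using z x w e by (metis mul_closed massoc)
  qed
  have ex: "e \<cdot> x = (e \<cdot> x) \<cdot> e"
  proof -
    have "e \<cdot> x = (w \<cdot> z) \<cdot> x" using w by simp
    also have "\<dots> = (w \<cdot> x) \<cdot> z" using zx x w(1) z(1) by (simp add: massoc)
    finally have "e \<cdot> x = (w \<cdot> x) \<cdot> z" .
    then show ?thesis using z x w e by (metis mul_closed massoc)
  qed
  have comm: "x \<cdot> e = e \<cdot> x" using xe ex x e by (simp add: massoc)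
  define u where "u = x \<cdot> e"
  have u: "u \<in> carrier S" "u \<cdot> e = u" "e \<cdot> u = u" using x e xe by (auto simp: u_def massoc)
  have zu: "z \<cdot> u = u \<cdot> z" using zx x e z comm unfolding u_def by (metis massoc)
  have wu: "w \<cdot> u = u \<cdot> w"
  proof -
    have "w \<cdot> u = w \<cdot> (u \<cdot> (z \<cdot> w))" using w u by simp
    also have "\<dots> = w \<cdot> ((u \<cdot> z) \<cdot> w)" using w(1) u(1) z(1) by (simp add: massoc)
    also have "\<dots> = w \<cdot> ((z \<cdot> u) \<cdot> w)" using zu by simp
    also have "\<dots> = (w \<cdot> z) \<cdot> (u \<cdot> w)" using w(1) u(1) z(1) by (simp add: massoc)
    finally show ?thesis using w u massoc[of e u w] e by simp
  qed
  have uH: "u \<in> H_class e"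
  proof -
    text \<open>An inverse of \<open>x e\<close> is \<open>x\<^sup>k w\<close> where \<open>w\<close> inverts \<open>x\<^sup>k\<^sup>+\<^sup>1\<close>; to avoid the empty power, use \<open>x\<^sup>2\<^sup>k\<^sup>+\<^sup>1 w w\<close>.\<close>
    define v where "v = mpw x (k + k) \<cdot> (w \<cdot> w)"
    have pz: "x \<cdot> mpw x (k + k) = z \<cdot> z"
      using x T.pw_add[of x k k] T.pw_comm[of x "k + k"] mpw_T[OF x] unfolding z_def
      by (metis mpw_in pwr.simps(2) tmul_eq)
    have pc: "mpw x (k + k) \<cdot> x = x \<cdot> mpw x (k + k)"
      using x T.pw_comm[of x "k + k"] mpw_T[OF x] by (metis mpw_in tmul_eq)
    have ww: "z \<cdot> z \<cdot> (w \<cdot> w) = e"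
    proof -
      have "z \<cdot> z \<cdot> (w \<cdot> w) = z \<cdot> ((z \<cdot> w) \<cdot> w)" using w(1) z(1) by (simp add: massoc)
      then show ?thesis using w by simp
    qed
    let ?p = "mpw x (k + k)"
    have p: "?p \<in> carrier S" using x by simp
    have pe: "e \<cdot> ?p = ?p \<cdot> e"
    proof -
      have "e \<cdot> mpw x i = mpw x i \<cdot> e" for i
      proof (induction i)
        case (Suc i)
        have "e \<cdot> mpw x (Suc i) = (e \<cdot> mpw x i) \<cdot> x" using x e by (simp add: massoc)
        also have "\<dots> = mpw x i \<cdot> (e \<cdot> x)" using Suc x e by (simp add: massoc)
        also have "\<dots> = mpw x i \<cdot> (x \<cdot> e)" using comm by simp
        finally show ?case using x e by (simp add: massoc)
      qed (use comm in simp)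
      then show ?thesis .
    qed
    have v: "v \<in> carrier S" "v \<cdot> e = v" "e \<cdot> v = v"
    proof -
      show "v \<in> carrier S" using w p by (simp add: v_def)
      show "v \<cdot> e = v" using w p e by (simp add: v_def massoc)
      have "e \<cdot> v = (e \<cdot> ?p) \<cdot> (w \<cdot> w)" using w p e by (simp add: v_def massoc)
      also have "\<dots> = ?p \<cdot> ((e \<cdot> w) \<cdot> w)" unfolding pe using w(1) p e(1) by (simp add: massoc)
      finally show "e \<cdot> v = v" using w by (simp add: v_def)
    qed
    have "u \<cdot> v = x \<cdot> (e \<cdot> v)" using x e v by (simp add: u_def massoc)
    also have "\<dots> = (x \<cdot> ?p) \<cdot> (w \<cdot> w)" using x p w v by (simp add: v_def massoc)
    also have "\<dots> = e" using pz ww by simp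
    finally have uv: "u \<cdot> v = e" .
    have "w \<cdot> (w \<cdot> u) = u \<cdot> (w \<cdot> w)" using wu w u by (metis massoc)
    then have "v \<cdot> u = ?p \<cdot> (u \<cdot> (w \<cdot> w))" using w u p by (simp add: v_def massoc)
    also have "\<dots> = ?p \<cdot> (x \<cdot> (e \<cdot> (w \<cdot> w)))" using w x e p by (simp add: u_def massoc)
    also have "e \<cdot> (w \<cdot> w) = w \<cdot> w" using w e by (simp add: massoc[symmetric])
    also have "?p \<cdot> (x \<cdot> (w \<cdot> w)) = (?p \<cdot> x) \<cdot> (w \<cdot> w)" using p x w by (simp add: massoc)
    also have "\<dots> = e" using pz pc ww by simp
    finally have "v \<cdot> u = e" .
    then show ?thesis unfolding H_class_def using u v uv by blast
  qed
  interpret G: group "group_on S (H_class e) e" using H_class_group[OF e] by (simp add: sg_subgroup_def)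
  have "y \<in> H_class e" "u \<cdot> y = e" "y \<cdot> u = e"
    using G.inv_closed[of u] G.r_inv[of u] G.l_inv[of u] uH unfolding y u_def[symmetric] by (auto simp: group_on_def)
  then have yy: "y \<in> carrier S" "y \<cdot> e = y" "e \<cdot> y = y" "u \<cdot> y = e" "y \<cdot> u = e" by (auto simp: H_class_def)
  show "y \<in> carrier S" by fact
  have xy: "x \<cdot> y = e" using yy x e massoc[of x e y] by (simp add: u_def)
  have yx: "y \<cdot> x = e" using yy x e comm massoc[of y e x] by (simp add: u_def)
  have "pinv_laws x y k" unfolding pinv_laws_def using xy yx yy z by (simp add: z_def)
  then show "\<exists>n. pinv_laws x y n" by blast
qed

text \<open>In the group of \<open>e = x y\<close> the powers of \<open>x\<close> and of
  \<open>y\<close> with the same exponent \<open>n + 1\<close> are mutually inverse, because the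
  last law says that \<open>e\<close> fixes the power of \<open>x\<close>.\<close>

lemma laws_imp_pseudoinverse:
  assumes x: "x \<in> carrier S" and y: "y \<in> carrier S" and a: "pinv_laws x y n"
  shows "is_pseudoinverse S x y" "\<exists>n\<ge>1. \<exists>G e. sg_subgroup S G e \<and> spow S x n \<in> G"
proof -
  define e where "e = x \<cdot> y"
  have e: "e \<in> carrier S" using x y by (simp add: e_def)
  have c: "x \<cdot> y = y \<cdot> x" "y \<cdot> x \<cdot> y = y" "mpw x n \<cdot> (x \<cdot> y) = mpw x n" using a unfolding pinv_laws_def by blast+
  have yxe: "y \<cdot> x = e" using c(1) unfolding e_def by (rule sym)
  have ey: "e \<cdot> y = y" using c(2) unfolding yxe .
  have ye: "y \<cdot> e = y" using ey x y unfolding e_def using massoc yxe e_def by metis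
  have ee: "e \<cdot> e = e" using ye x y e massoc[of x y e] by (simp add: e_def)
  have xe: "x \<cdot> e = e \<cdot> x" using yxe x y massoc[of x y x] by (simp add: e_def)
  have ze: "mpw x n \<cdot> e = mpw x n" using c(3) unfolding e_def .
  have pxe: "e \<cdot> mpw x i = mpw x i \<cdot> e" for i
  proof (induction i)
    case (Suc i)
    have "e \<cdot> mpw x (Suc i) = (e \<cdot> mpw x i) \<cdot> x" using x e by (simp add: massoc)
    also have "\<dots> = mpw x i \<cdot> (x \<cdot> e)" using Suc x e xe by (simp add: massoc)
    finally show ?case using x e by (simp add: massoc)
  qed (use xe in simp)
  have pye: "mpw y i \<cdot> e = mpw y i" "e \<cdot> mpw y i = mpw y i" for i
    by (induction i) (use y e ey ye in \<open>auto simp: massoc, metis mul_closed massoc mpw_in\<close>)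
  have comm: "mpw b i \<cdot> b = b \<cdot> mpw b i" if "b \<in> carrier S" for b i
    using mpw_T[OF that] T.pw_comm[of b i] that by (metis mpw_in tmul_eq)
  have inv: "mpw a i \<cdot> mpw b i = e" if ab: "a \<in> carrier S" "b \<in> carrier S" "a \<cdot> b = e" "\<And>i. e \<cdot> mpw b i = mpw b i" for a b i
  proof (induction i)
    case (Suc i)
    have "mpw a (Suc i) \<cdot> mpw b (Suc i) = mpw a i \<cdot> ((a \<cdot> b) \<cdot> mpw b i)"
      using ab(1,2) comm[OF ab(2)] by (simp add: massoc)
    also have "\<dots> = mpw a i \<cdot> mpw b i" using ab by simp
    finally show ?case using Suc ab by simp
  qed (use ab in simp)
  have 1: "mpw x n \<cdot> mpw y n = e" using inv[OF x y _ pye(2)] by (simp add: e_def)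
  have 2: "mpw y n \<cdot> mpw x n = e"
  proof -
    have c: "mpw x i \<cdot> y = y \<cdot> mpw x i" for i
    proof (induction i)
      case (Suc i)
      have "mpw x (Suc i) \<cdot> y = mpw x i \<cdot> (y \<cdot> x)" using x y yxe by (simp add: massoc e_def)
      also have "\<dots> = (mpw x i \<cdot> y) \<cdot> x" using x y by (simp add: massoc)
      finally show ?case using Suc x y by (simp add: massoc)
    qed (use yxe e_def in simp)
    have "mpw x n \<cdot> mpw y i = mpw y i \<cdot> mpw x n" for i
    proof (induction i)
      case (Suc i)
      have "mpw x n \<cdot> mpw y (Suc i) = (mpw x n \<cdot> mpw y i) \<cdot> y" using x y by (simp add: massoc)
      also have "\<dots> = mpw y i \<cdot> (mpw x n \<cdot> y)" using Suc x y by (simp add: massoc)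
      finally show ?case using c x y by (simp add: massoc)
    qed (use c in simp)
    then show ?thesis using 1 by simp
  qed
  have zH: "mpw x n \<in> H_class e" unfolding H_class_def using x y ze pxe pye 1 2 by (intro CollectI conjI bexI[of _ "mpw y n"]) auto
  have m: "maximal_subgroup S (H_class e) e" using maximal_iff e ee by blast
  have ue: "(x \<cdot> e) \<cdot> y = e" "y \<cdot> (x \<cdot> e) = e"
    using massoc[OF x e y] massoc[OF y x e] ey yxe ee e_def by simp_all
  have xee: "(x \<cdot> e) \<cdot> e = x \<cdot> e" using massoc[OF x e e] ee by simp
  have exe: "e \<cdot> (x \<cdot> e) = x \<cdot> e" using massoc[OF e x e] xe xee by simp
  have xeS: "x \<cdot> e \<in> carrier S" using x e by simp
  have uH: "x \<cdot> e \<in> H_class e" "y \<in> H_class e"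
    unfolding H_class_def using xeS y xee exe ue ey ye by blast+
  interpret G: group "group_on S (H_class e) e" using H_class_group[OF e ee] by (simp add: sg_subgroup_def)
  have "inv\<^bsub>group_on S (H_class e) e\<^esub> (x \<cdot> e) = y"
    by (rule G.inv_equality) (use ue uH in \<open>auto simp: group_on_def\<close>)
  then show "is_pseudoinverse S x y" unfolding is_pseudoinverse_def using m zH
    by (intro exI[of _ "H_class e"] exI[of _ e] conjI exI[of _ "Suc n"]) (auto simp: mpw_def)
  show "\<exists>n\<ge>1. \<exists>G e. sg_subgroup S G e \<and> spow S x n \<in> G"
    using zH H_class_group[OF e ee] by (intro exI[of _ "Suc n"]) (auto simp: mpw_def)
qed

end

section \<open>Intersections and joins of theories\<close>

lemma rtrancl_map:
  assumes "(s, t) \<in> r\<^sup>*" "\<And>s t. (s, t) \<in> r \<Longrightarrow> (f s, f t) \<in> r"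
  shows "(f s, f t) \<in> r\<^sup>*"
  using assms(1) by induction (use assms(2) in \<open>auto intro: rtrancl_into_rtrancl\<close>)

lemma equational_theory_inter: "equational_theory A \<Longrightarrow> equational_theory B \<Longrightarrow> equational_theory (A \<inter> B)"
proof -
  assume a: "equational_theory A" "equational_theory B"
  interpret A: equational_theory A by fact
  interpret B: equational_theory B by fact
  show ?thesis
  proof
    show "(s, r) \<in> A \<inter> B" if "(s, t) \<in> A \<inter> B" "(t, r) \<in> A \<inter> B" for s t r
      using that A.trans B.trans by blast
    show "(t, s) \<in> A \<inter> B" if "(s, t) \<in> A \<inter> B" for s t
      using that A.sym B.sym by blast
  qed (auto intro: A.cmul B.cmul A.cinv B.cinv A.sub B.sub A.asc B.asc)
qed

lemma equational_theory_join: assumes "equational_theory A" "equational_theory B" shows "equational_theory ((A \<union> B)\<^sup>*)"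
proof -
  interpret A: equational_theory A by fact
  interpret B: equational_theory B by fact
  let ?J = "(A \<union> B)\<^sup>*"
  show ?thesis
  proof
    have "sym (A \<union> B)" using A.sym B.sym unfolding sym_def by blast
    then have "sym ?J" by (rule sym_rtrancl)
    then show "(t, s) \<in> ?J" if "(s, t) \<in> ?J" for s t using that by (meson symD)
    show "(s, r) \<in> ?J" if "(s, t) \<in> ?J" "(t, r) \<in> ?J" for s t r using that by simp
    show "(UMul s s', UMul t t') \<in> ?J" if "(s, t) \<in> ?J" "(s', t') \<in> ?J" for s t s' t'
    proof -
      have "(UMul s s', UMul t s') \<in> ?J"
        by (rule rtrancl_map[OF that(1), of "\<lambda>x. UMul x s'"]) (auto intro: A.cmul B.cmul)
      moreover have "(UMul t s', UMul t t') \<in> ?J"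
        by (rule rtrancl_map[OF that(2)]) (auto intro: A.cmul B.cmul)
      ultimately show ?thesis by simp
    qed
    show "(UInv s, UInv t) \<in> ?J" if "(s, t) \<in> ?J" for s t
      by (rule rtrancl_map[OF that]) (auto intro: A.cinv B.cinv)
    show "(usub \<sigma> s, usub \<sigma> t) \<in> ?J" if "(s, t) \<in> ?J" for s t \<sigma>
      by (rule rtrancl_map[OF that]) (auto intro: A.sub B.sub)
    show "(UMul (UMul s t) r, UMul s (UMul t r)) \<in> ?J" for s t r using A.asc by blast
  qed simp
qed

lemma epigroup_theory_super: "epigroup_theory A n \<Longrightarrow> equational_theory B \<Longrightarrow> A \<subseteq> B \<Longrightarrow> epigroup_theory B n"
  unfolding epigroup_theory_def epigroup_theory_axioms_def by blast

lemma (in epigroup_theory) epigroup_theory_mono: "n0 \<le> m \<Longrightarrow> epigroup_theory \<theta> m"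
proof -
  assume m: "n0 \<le> m"
  have "(UMul (upow s m) (uom s), upow s m) \<in> \<theta>" for s
  proof (cases "m = n0")
    case True then show ?thesis using e3 by simp
  next
    case False
    then obtain j where j: "m = Suc j" "n0 \<le> j" using m by (cases m) auto
    have "q (UMul (upow s m) (uom s)) = qm (pw s m) (om s)"
      using q_upow_Suc[of s j] by (simp only: j q_mul qm_UMul) (metis q_inv q_mul q_simps qm_UMul(2))
    also have "\<dots> = q (upow s m)" using pw_om[of m s] q_upow_Suc[of s j] j by simp
    finally show ?thesis by (simp add: q_eq)
  qed
  then show ?thesis using e1 e2 by unfold_locales auto
qed

lemma epi_theories_inter: "A \<in> epi_theories \<Longrightarrow> B \<in> epi_theories \<Longrightarrow> A \<inter> B \<in> epi_theories"
proof -
  assume "A \<in> epi_theories" "B \<in> epi_theories"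
  then obtain n m where "epigroup_theory A n" "epigroup_theory B m" by (auto simp: epi_theories_def)
  then have AB: "epigroup_theory A (max n m)" "epigroup_theory B (max n m)" using epigroup_theory.epigroup_theory_mono by simp_all
  then have "equational_theory (A \<inter> B)" by (intro equational_theory_inter) (auto simp: epigroup_theory_def)
  then have "epigroup_theory (A \<inter> B) (max n m)" using AB unfolding epigroup_theory_def epigroup_theory_axioms_def by simp
  then show ?thesis by (auto simp: epi_theories_def)
qed

lemma epi_theories_join: "A \<in> epi_theories \<Longrightarrow> B \<in> epi_theories \<Longrightarrow> (A \<union> B)\<^sup>* \<in> epi_theories"
proof -
  assume "A \<in> epi_theories" "B \<in> epi_theories"
  then obtain n m where AB: "epigroup_theory A n" "epigroup_theory B m" by (auto simp: epi_theories_def)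
  then have "equational_theory ((A \<union> B)\<^sup>*)" by (intro equational_theory_join) (auto simp: epigroup_theory_def)
  then have "epigroup_theory ((A \<union> B)\<^sup>*) n" by (rule epigroup_theory_super[OF AB(1)]) auto
  then show ?thesis by (auto simp: epi_theories_def)
qed

lemma sgrp_theories_inter: "A \<in> sgrp_theories \<Longrightarrow> B \<in> sgrp_theories \<Longrightarrow> A \<inter> B \<in> sgrp_theories"
  by (simp add: sgrp_theories_def equational_theory_inter)

lemma sgrp_theories_join: "A \<in> sgrp_theories \<Longrightarrow> B \<in> sgrp_theories \<Longrightarrow> (A \<union> B)\<^sup>* \<in> sgrp_theories"
  by (auto simp: sgrp_theories_def equational_theory_join)

section \<open>Duality between varieties and theories\<close>

text \<open>An abstract setting from which both lattices obtain the same translation. Joins and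
  meets are defined by choosing a least upper or greatest lower bound; order reversal makes these
  unique and computes their theories.\<close>

locale duality =
  fixes C :: "'v set set" and \<Phi> :: "'v set \<Rightarrow> (uterm \<times> uterm) set" and F :: "(uterm \<times> uterm) set set"
  assumes into: "V \<in> C \<Longrightarrow> \<Phi> V \<in> F"
    and onto: "\<theta> \<in> F \<Longrightarrow> \<exists>V\<in>C. \<Phi> V = \<theta>"
    and anti: "V \<in> C \<Longrightarrow> W \<in> C \<Longrightarrow> V \<subseteq> W \<longleftrightarrow> \<Phi> W \<subseteq> \<Phi> V"
    and inter: "A \<in> F \<Longrightarrow> B \<in> F \<Longrightarrow> A \<inter> B \<in> F"
    and union: "A \<in> F \<Longrightarrow> B \<in> F \<Longrightarrow> (A \<union> B)\<^sup>* \<in> F"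
    and eqths: "A \<in> F \<Longrightarrow> equational_theory A"
begin

definition L :: "'v set gorder" where "L = \<lparr>carrier = C, eq = (=), le = (\<subseteq>)\<rparr>"

lemma L_simps [simp]: "carrier L = C" "V \<sqsubseteq>\<^bsub>L\<^esub> W \<longleftrightarrow> V \<subseteq> W" by (simp_all add: L_def)

lemma inj: "V \<in> C \<Longrightarrow> W \<in> C \<Longrightarrow> \<Phi> V = \<Phi> W \<Longrightarrow> V = W"
  using anti by (simp add: subset_antisym)

lemma closure_le: "A \<subseteq> \<theta> \<Longrightarrow> B \<subseteq> \<theta> \<Longrightarrow> \<theta> \<in> F \<Longrightarrow> (A \<union> B)\<^sup>* \<subseteq> \<theta>"
proof -
  assume a: "A \<subseteq> \<theta>" "B \<subseteq> \<theta>" "\<theta> \<in> F"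
  interpret equational_theory \<theta> using eqths a by blast
  show ?thesis
  proof
    fix p assume "p \<in> (A \<union> B)\<^sup>*"
    then have "(fst p, snd p) \<in> (A \<union> B)\<^sup>*" by simp
    then have "(fst p, snd p) \<in> \<theta>"
      by (induction) (use a rfl trans in blast)+
    then show "p \<in> \<theta>" by simp
  qed
qed

lemma join: assumes "V \<in> C" "W \<in> C" shows "V \<squnion>\<^bsub>L\<^esub> W \<in> C" "\<Phi> (V \<squnion>\<^bsub>L\<^esub> W) = \<Phi> V \<inter> \<Phi> W"
proof -
  obtain X where X: "X \<in> C" "\<Phi> X = \<Phi> V \<inter> \<Phi> W" using onto inter into assms by meson
  have up: "Upper L {V, W} = {U \<in> C. V \<subseteq> U \<and> W \<subseteq> U}" using assms by (auto simp: Upper_def)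
  have "least L X (Upper L {V, W})"
    unfolding least_def up using X assms anti by auto
  moreover have "Y = X" if "least L Y (Upper L {V, W})" for Y
    using that calculation unfolding least_def by (simp add: subset_antisym)
  ultimately have "V \<squnion>\<^bsub>L\<^esub> W = X" unfolding join_def sup_def by (metis (mono_tags, lifting) someI_ex)
  then show "V \<squnion>\<^bsub>L\<^esub> W \<in> C" "\<Phi> (V \<squnion>\<^bsub>L\<^esub> W) = \<Phi> V \<inter> \<Phi> W" using X by auto
qed

lemma meet: assumes "V \<in> C" "W \<in> C" shows "V \<sqinter>\<^bsub>L\<^esub> W \<in> C" "\<Phi> (V \<sqinter>\<^bsub>L\<^esub> W) = (\<Phi> V \<union> \<Phi> W)\<^sup>*"
proof -
  obtain X where X: "X \<in> C" "\<Phi> X = (\<Phi> V \<union> \<Phi> W)\<^sup>*" using onto union into assms by meson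
  have lo: "Lower L {V, W} = {U \<in> C. U \<subseteq> V \<and> U \<subseteq> W}" using assms by (auto simp: Lower_def)
  have "greatest L X (Lower L {V, W})"
  proof -
    have "U \<subseteq> X" if "U \<in> C" "U \<subseteq> V" "U \<subseteq> W" for U
    proof -
      have "\<Phi> X \<subseteq> \<Phi> U" unfolding X(2) using that anti assms into by (intro closure_le) auto
      then show ?thesis using anti that(1) X(1) by blast
    qed
    moreover have "X \<subseteq> V" "X \<subseteq> W" using X assms anti by auto
    ultimately show ?thesis unfolding greatest_def lo using X(1) assms by auto
  qed
  moreover have "Y = X" if "greatest L Y (Lower L {V, W})" for Y
    using that calculation unfolding greatest_def by (simp add: subset_antisym)
  ultimately have "V \<sqinter>\<^bsub>L\<^esub> W = X" unfolding meet_def inf_def by (metis (mono_tags, lifting) someI_ex)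
  then show "V \<sqinter>\<^bsub>L\<^esub> W \<in> C" "\<Phi> (V \<sqinter>\<^bsub>L\<^esub> W) = (\<Phi> V \<union> \<Phi> W)\<^sup>*" using X by auto
qed

lemma ball_C: "(\<forall>V\<in>C. P (\<Phi> V)) \<longleftrightarrow> (\<forall>\<theta>\<in>F. P \<theta>)" using into onto by metis

lemma modular_iff: assumes V: "V \<in> C" shows "modular_element L V \<longleftrightarrow> modular_in F (\<Phi> V)"
proof -
  have "(V \<squnion>\<^bsub>L\<^esub> Y) \<sqinter>\<^bsub>L\<^esub> Z = (V \<sqinter>\<^bsub>L\<^esub> Z) \<squnion>\<^bsub>L\<^esub> Y \<longleftrightarrow>
      ((\<Phi> V \<inter> \<Phi> Y) \<union> \<Phi> Z)\<^sup>* = (\<Phi> V \<union> \<Phi> Z)\<^sup>* \<inter> \<Phi> Y" if "Y \<in> C" "Z \<in> C" for Y Z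
    using inj[of "(V \<squnion>\<^bsub>L\<^esub> Y) \<sqinter>\<^bsub>L\<^esub> Z" "(V \<sqinter>\<^bsub>L\<^esub> Z) \<squnion>\<^bsub>L\<^esub> Y"] join meet V that by metis
  then have "modular_element L V \<longleftrightarrow> (\<forall>Y\<in>C. \<forall>Z\<in>C. \<Phi> Z \<subseteq> \<Phi> Y \<longrightarrow>
      ((\<Phi> V \<inter> \<Phi> Y) \<union> \<Phi> Z)\<^sup>* = (\<Phi> V \<union> \<Phi> Z)\<^sup>* \<inter> \<Phi> Y)"
    unfolding modular_element_def using V anti by simp
  also have "\<dots> \<longleftrightarrow> (\<forall>B\<in>F. \<forall>A\<in>F. A \<subseteq> B \<longrightarrow> ((\<Phi> V \<inter> B) \<union> A)\<^sup>* = (\<Phi> V \<union> A)\<^sup>* \<inter> B)"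
    by (simp only: ball_C[of "\<lambda>A. A \<subseteq> \<Phi> Y \<longrightarrow> P A Y" for P Y]
      ball_C[of "\<lambda>B. \<forall>A\<in>F. A \<subseteq> B \<longrightarrow> ((\<Phi> V \<inter> B) \<union> A)\<^sup>* = (\<Phi> V \<union> A)\<^sup>* \<inter> B"]
      ball_C[of "\<lambda>A. A \<subseteq> \<Phi> Y \<longrightarrow> ((\<Phi> V \<inter> \<Phi> Y) \<union> A)\<^sup>* = (\<Phi> V \<union> A)\<^sup>* \<inter> \<Phi> Y" for Y])
  finally show ?thesis unfolding modular_in_def by auto
qed

lemma cancellable_iff: assumes V: "V \<in> C" shows "cancellable_element L V \<longleftrightarrow> cancellable_in F (\<Phi> V)"
proof -
  have 1: "V \<squnion>\<^bsub>L\<^esub> Y = V \<squnion>\<^bsub>L\<^esub> Z \<longleftrightarrow> \<Phi> V \<inter> \<Phi> Y = \<Phi> V \<inter> \<Phi> Z"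
    "V \<sqinter>\<^bsub>L\<^esub> Y = V \<sqinter>\<^bsub>L\<^esub> Z \<longleftrightarrow> (\<Phi> V \<union> \<Phi> Y)\<^sup>* = (\<Phi> V \<union> \<Phi> Z)\<^sup>*"
    "Y = Z \<longleftrightarrow> \<Phi> Y = \<Phi> Z" if "Y \<in> C" "Z \<in> C" for Y Z
    using inj join meet V that by metis+
  have "cancellable_element L V \<longleftrightarrow> (\<forall>Y\<in>C. \<forall>Z\<in>C. \<Phi> V \<inter> \<Phi> Y = \<Phi> V \<inter> \<Phi> Z \<and>
      (\<Phi> V \<union> \<Phi> Y)\<^sup>* = (\<Phi> V \<union> \<Phi> Z)\<^sup>* \<longrightarrow> \<Phi> Y = \<Phi> Z)"
    unfolding cancellable_element_def using V 1 by simp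
  also have "\<dots> \<longleftrightarrow> cancellable_in F (\<Phi> V)"
    unfolding cancellable_in_def
    by (simp only: ball_C[of "\<lambda>B. \<Phi> V \<inter> \<Phi> Y = \<Phi> V \<inter> B \<and> (\<Phi> V \<union> \<Phi> Y)\<^sup>* = (\<Phi> V \<union> B)\<^sup>* \<longrightarrow> \<Phi> Y = B" for Y]
      ball_C[of "\<lambda>A. \<forall>B\<in>F. \<Phi> V \<inter> A = \<Phi> V \<inter> B \<and> (\<Phi> V \<union> A)\<^sup>* = (\<Phi> V \<union> B)\<^sup>* \<longrightarrow> A = B"])
  finally show ?thesis .
qed

text \<open>The two sides of the modular law are comparable and have the same intersection and the
  same join with \<open>\<nu>\<close>; cancellation then makes them equal.\<close>

lemma cancel_mod: assumes \<nu>: "\<nu> \<in> F" and c: "cancellable_in F \<nu>" shows "modular_in F \<nu>"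
  unfolding modular_in_def
proof (intro ballI impI)
  fix A B assume AB: "A \<in> F" "B \<in> F" "A \<subseteq> B"
  let ?P = "((\<nu> \<inter> B) \<union> A)\<^sup>*" and ?R = "(\<nu> \<union> A)\<^sup>* \<inter> B"
  have F: "?P \<in> F" "?R \<in> F" using AB \<nu> inter union by auto
  have PR: "?P \<subseteq> ?R" by (rule closure_le[OF _ _ F(2)]) (use AB in auto)
  have PB: "\<nu> \<inter> B \<subseteq> ?P" "A \<subseteq> ?P" "A \<subseteq> ?R" using AB by auto
  have "\<nu> \<inter> ?P = \<nu> \<inter> ?R" using PR PB by blast
  moreover have "(\<nu> \<union> ?P)\<^sup>* = (\<nu> \<union> ?R)\<^sup>*"
  proof
    show "(\<nu> \<union> ?P)\<^sup>* \<subseteq> (\<nu> \<union> ?R)\<^sup>*" using PR by (intro rtrancl_mono) auto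
    have "(\<nu> \<union> A)\<^sup>* \<subseteq> (\<nu> \<union> ?P)\<^sup>*" using PB by (intro rtrancl_mono) auto
    then show "(\<nu> \<union> ?R)\<^sup>* \<subseteq> (\<nu> \<union> ?P)\<^sup>*" using \<nu> F union by (intro closure_le) auto
  qed
  ultimately show "?R = ?P" using c F unfolding cancellable_in_def by metis
qed

end

section \<open>Varieties, their theories and their free algebras\<close>

primrec er :: "uterm \<Rightarrow> mterm" where
  "er (UVar i) = MVar i" | "er (UMul s t) = MMul (er s) (er t)" | "er (UInv s) = er s"

primrec em :: "mterm \<Rightarrow> uterm" where
  "em (MVar i) = UVar i" | "em (MMul s t) = UMul (em s) (em t)"

lemma er_em [simp]: "er (em t) = t" by (induction t) auto

lemma meval_usub: "meval S \<rho> (er (usub \<sigma> t)) = meval S (\<lambda>i. meval S \<rho> (er (\<sigma> i))) (er t)"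
  by (induction t) auto
lemma ueval_usub: "ueval S \<rho> (usub \<sigma> t) = ueval S (\<lambda>i. ueval S \<rho> (\<sigma> i)) t"
  by (induction t) auto
lemma meval_in: "magma_closed S \<Longrightarrow> range \<rho> \<subseteq> carrier S \<Longrightarrow> meval S \<rho> t \<in> carrier S"
  by (induction t) (auto simp: magma_closed_def)
lemma ueval_in: "unary_magma_closed S \<Longrightarrow> range \<rho> \<subseteq> carrier S \<Longrightarrow> ueval S \<rho> t \<in> carrier S"
  by (induction t) (auto simp: unary_magma_closed_def magma_closed_def)

text \<open>Erasing \<open>UInv\<close> puts the theories of semigroup varieties on the same terms
  as those of epigroup varieties, with \<open>UInv s = s\<close> holding automatically.\<close>

definition thS :: "'a magma set \<Rightarrow> (uterm \<times> uterm) set" where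
  "thS V = {(s, t). \<forall>S\<in>V. msatisfies S (er s, er t)}"
definition moS :: "(uterm \<times> uterm) set \<Rightarrow> 'a magma set" where
  "moS \<theta> = {S. magma_closed S \<and> (\<forall>(s, t)\<in>\<theta>. msatisfies S (er s, er t))}"
definition thE :: "'a unary_magma set \<Rightarrow> (uterm \<times> uterm) set" where
  "thE W = {st. \<forall>S\<in>W. usatisfies S st}"
definition moE :: "(uterm \<times> uterm) set \<Rightarrow> 'a unary_magma set" where
  "moE \<theta> = {S. unary_magma_closed S \<and> (\<forall>st\<in>\<theta>. usatisfies S st)}"

lemma moS_thS: assumes "magma_variety V" shows "moS (thS V) = V"
proof -
  obtain \<Sigma> where V: "V = {S. magma_closed S \<and> (\<forall>st\<in>\<Sigma>. msatisfies S st)}" using assms by (auto simp: magma_variety_def)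
  have "(em s, em t) \<in> thS V" if "(s, t) \<in> \<Sigma>" for s t using that by (auto simp: V thS_def)
  then have "moS (thS V) \<subseteq> V" unfolding moS_def V by (fastforce simp: V)
  moreover have "V \<subseteq> moS (thS V)" unfolding moS_def thS_def V by auto
  ultimately show ?thesis by blast
qed

lemma moE_thE: assumes "unary_magma_variety W" shows "moE (thE W) = W"
proof -
  obtain \<Sigma> where V: "W = {S. unary_magma_closed S \<and> (\<forall>st\<in>\<Sigma>. usatisfies S st)}" using assms by (auto simp: unary_magma_variety_def)
  have "\<Sigma> \<subseteq> thE W" by (auto simp: V thE_def)
  then have "moE (thE W) \<subseteq> W" unfolding moE_def V by auto
  moreover have "W \<subseteq> moE (thE W)" unfolding moE_def thE_def V by auto
  ultimately show ?thesis by blast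
qed

lemma thS_sgrp_theories: fixes V :: "'a magma set" assumes "\<And>S. S \<in> V \<Longrightarrow> is_semigroup S" shows "thS V \<in> sgrp_theories"
proof -
  have cl: "magma_closed S" if "S \<in> V" for S using assms[OF that] by (simp add: is_semigroup_def)
  have "equational_theory (thS V)"
  proof
    show "(usub \<sigma> s, usub \<sigma> t) \<in> thS V" if h: "(s, t) \<in> thS V" for s t \<sigma>
      unfolding thS_def
    proof (intro CollectI case_prodI ballI)
      fix S assume S: "S \<in> V"
      show "msatisfies S (er (usub \<sigma> s), er (usub \<sigma> t))" unfolding msatisfies_def
      proof (intro allI impI)
        fix \<rho> :: "nat \<Rightarrow> 'a" assume r: "range \<rho> \<subseteq> carrier S"
        have "range (\<lambda>i. meval S \<rho> (er (\<sigma> i))) \<subseteq> carrier S" using meval_in[OF cl[OF S] r] by blast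
        then show "meval S \<rho> (fst (er (usub \<sigma> s), er (usub \<sigma> t))) = meval S \<rho> (snd (er (usub \<sigma> s), er (usub \<sigma> t)))"
          using h S by (simp add: meval_usub thS_def msatisfies_def)
      qed
    qed
    show "(UMul (UMul s t) r, UMul s (UMul t r)) \<in> thS V" for s t r
      using assms meval_in[OF cl] by (auto simp: thS_def msatisfies_def is_semigroup_def)
  qed (auto simp: thS_def msatisfies_def)
  moreover have "(UInv s, s) \<in> thS V" for s by (simp add: thS_def msatisfies_def)
  ultimately show ?thesis by (simp add: sgrp_theories_def)
qed

lemma thE_equational_theory: fixes W :: "'a unary_magma set" assumes "\<And>S. S \<in> W \<Longrightarrow> is_semigroup S \<and> unary_magma_closed S" shows "equational_theory (thE W)"
proof
  have cl: "unary_magma_closed S" if "S \<in> W" for S using assms[OF that] by simp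
  show "(usub \<sigma> s, usub \<sigma> t) \<in> thE W" if h: "(s, t) \<in> thE W" for s t \<sigma>
    unfolding thE_def
  proof (intro CollectI ballI)
    fix S assume S: "S \<in> W"
    show "usatisfies S (usub \<sigma> s, usub \<sigma> t)" unfolding usatisfies_def
    proof (intro allI impI)
      fix \<rho> :: "nat \<Rightarrow> 'a" assume r: "range \<rho> \<subseteq> carrier S"
      have "range (\<lambda>i. ueval S \<rho> (\<sigma> i)) \<subseteq> carrier S" using ueval_in[OF cl[OF S] r] by blast
      then show "ueval S \<rho> (fst (usub \<sigma> s, usub \<sigma> t)) = ueval S \<rho> (snd (usub \<sigma> s, usub \<sigma> t))"
        using h S by (simp add: ueval_usub thE_def usatisfies_def)
    qed
  qed
  show "(UMul (UMul s t) r, UMul s (UMul t r)) \<in> thE W" for s t r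
    using assms ueval_in[OF cl] by (auto simp: thE_def usatisfies_def is_semigroup_def)
qed (auto simp: thE_def usatisfies_def)

text \<open>The free algebras are realised inside the infinite type \<open>'a\<close> by means of an injection of the terms.\<close>

instance uterm :: countable by countable_datatype

definition emb :: "uterm \<Rightarrow> 'a::infinite" where "emb = (SOME f. inj f)"

lemma inj_emb: "inj (emb :: uterm \<Rightarrow> 'a::infinite)"
proof -
  obtain g :: "nat \<Rightarrow> 'a" where "inj g"
    using infinite_countable_subset[OF infinite_UNIV] by blast
  then have "inj (g \<circ> to_nat :: uterm \<Rightarrow> 'a)" by (intro inj_compose) auto
  then show ?thesis unfolding emb_def by (metis someI_ex)
qed

context equational_theory begin

definition rep :: "uterm \<Rightarrow> 'a::infinite" where "rep s = emb (q s)"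
definition pick :: "'a::infinite \<Rightarrow> uterm" where "pick a = (SOME s. rep s = a)"
definition freeU :: "'a::infinite unary_magma" where
  "freeU = \<lparr>carrier = range rep, mul = (\<lambda>a b. rep (UMul (pick a) (pick b))), pinv = (\<lambda>a. rep (UInv (pick a)))\<rparr>"
definition freeM :: "'a::infinite magma" where
  "freeM = \<lparr>carrier = range rep, mul = (\<lambda>a b. rep (UMul (pick a) (pick b)))\<rparr>"

lemma rep_eq: "(rep s :: 'a::infinite) = rep t \<longleftrightarrow> (s, t) \<in> \<theta>"
  unfolding rep_def using inj_emb q_eq by (metis injD)

lemma pick_rep: "(pick (rep s :: 'a::infinite), s) \<in> \<theta>"
proof -
  have "rep (pick (rep s :: 'a)) = (rep s :: 'a)" unfolding pick_def by (rule someI[of _ s]) simp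
  then show ?thesis using rep_eq by blast
qed

lemma rep_pick: "a \<in> range rep \<Longrightarrow> rep (pick a) = a"
  using pick_rep rep_eq by blast

lemma rep_mul: "(rep (UMul (pick (rep s :: 'a::infinite)) (pick (rep t :: 'a))) :: 'a) = rep (UMul s t)"
  unfolding rep_eq by (intro cmul pick_rep)
lemma rep_inv: "(rep (UInv (pick (rep s :: 'a::infinite))) :: 'a) = rep (UInv s)"
  unfolding rep_eq by (intro cinv pick_rep)

lemma freeU_eval: "ueval freeU (\<lambda>i. rep (\<sigma> i)) t = (rep (usub \<sigma> t) :: 'a::infinite)"
  by (induction t) (auto simp: freeU_def rep_mul rep_inv)

lemma freeM_eval: "(\<And>s. (UInv s, s) \<in> \<theta>) \<Longrightarrow> meval freeM (\<lambda>i. rep (\<sigma> i)) (er t) = (rep (usub \<sigma> t) :: 'a::infinite)"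
  by (induction t) (auto simp: freeM_def rep_mul rep_eq sym)

lemma range_rep: assumes "range \<rho> \<subseteq> range (rep :: uterm \<Rightarrow> 'a::infinite)" obtains \<sigma> where "\<rho> = (\<lambda>i. rep (\<sigma> i))"
proof -
  have "\<rho> = (\<lambda>i. rep (pick (\<rho> i)))" using assms rep_pick by (metis range_subsetD)
  then show thesis by (rule that)
qed

text \<open>Sending every letter to its own class makes evaluation the passage to classes, so the
  algebra satisfies an identity only if the theory contains it; the converse is closure under
  substitution.\<close>

lemma freeU_sat: "usatisfies (freeU :: 'a::infinite unary_magma) (s, t) \<longleftrightarrow> (s, t) \<in> \<theta>"
proof
  assume a: "usatisfies (freeU :: 'a unary_magma) (s, t)"
  have "range (\<lambda>i. rep (UVar i)) \<subseteq> carrier (freeU :: 'a unary_magma)" by (auto simp: freeU_def)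
  then have "ueval freeU (\<lambda>i. rep (UVar i)) s = (ueval freeU (\<lambda>i. rep (UVar i)) t :: 'a)" using a unfolding usatisfies_def by auto
  then have "(rep s :: 'a) = rep t" unfolding freeU_eval by simp
  then show "(s, t) \<in> \<theta>" unfolding rep_eq .
next
  assume st: "(s, t) \<in> \<theta>"
  show "usatisfies (freeU :: 'a unary_magma) (s, t)" unfolding usatisfies_def
  proof (intro allI impI)
    fix \<rho> :: "nat \<Rightarrow> 'a" assume "range \<rho> \<subseteq> carrier freeU"
    then have "range \<rho> \<subseteq> range rep" by (simp add: freeU_def)
    then obtain \<sigma> where r: "\<rho> = (\<lambda>i. rep (\<sigma> i))" by (rule range_rep)
    show "ueval freeU \<rho> (fst (s, t)) = ueval freeU \<rho> (snd (s, t))" unfolding r using sub[OF st] by (simp add: freeU_eval rep_eq)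
  qed
qed

lemma freeM_sat: assumes id: "\<And>s. (UInv s, s) \<in> \<theta>"
  shows "msatisfies (freeM :: 'a::infinite magma) (er s, er t) \<longleftrightarrow> (s, t) \<in> \<theta>"
proof
  assume a: "msatisfies (freeM :: 'a magma) (er s, er t)"
  have "range (\<lambda>i. rep (UVar i)) \<subseteq> carrier (freeM :: 'a magma)" by (auto simp: freeM_def)
  then have "meval freeM (\<lambda>i. rep (UVar i)) (er s) = (meval freeM (\<lambda>i. rep (UVar i)) (er t) :: 'a)" using a unfolding msatisfies_def by auto
  then have "(rep s :: 'a) = rep t" unfolding freeM_eval[OF id] by simp
  then show "(s, t) \<in> \<theta>" unfolding rep_eq .
next
  assume st: "(s, t) \<in> \<theta>"
  show "msatisfies (freeM :: 'a magma) (er s, er t)" unfolding msatisfies_def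
  proof (intro allI impI)
    fix \<rho> :: "nat \<Rightarrow> 'a" assume "range \<rho> \<subseteq> carrier freeM"
    then have "range \<rho> \<subseteq> range rep" by (simp add: freeM_def)
    then obtain \<sigma> where r: "\<rho> = (\<lambda>i. rep (\<sigma> i))" by (rule range_rep)
    show "meval freeM \<rho> (fst (er s, er t)) = meval freeM \<rho> (snd (er s, er t))"
      unfolding r using sub[OF st] by (simp add: freeM_eval[OF id] rep_eq)
  qed
qed

lemma freeU_mo: "(freeU :: 'a::infinite unary_magma) \<in> moE \<theta>"
  using freeU_sat by (auto simp: moE_def unary_magma_closed_def magma_closed_def) (auto simp: freeU_def)

lemma freeM_mo: "(\<And>s. (UInv s, s) \<in> \<theta>) \<Longrightarrow> (freeM :: 'a::infinite magma) \<in> moS \<theta>"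
  using freeM_sat by (auto simp: moS_def magma_closed_def) (auto simp: freeM_def)

lemma thE_moE: "thE (moE \<theta> :: 'a::infinite unary_magma set) = \<theta>"
proof
  show "thE (moE \<theta> :: 'a unary_magma set) \<subseteq> \<theta>"
    using freeU_mo[where 'a='a] freeU_sat[where 'a='a] by (fastforce simp: thE_def)
qed (auto simp: thE_def moE_def)

lemma thS_moS: "(\<And>s. (UInv s, s) \<in> \<theta>) \<Longrightarrow> thS (moS \<theta> :: 'a::infinite magma set) = \<theta>"
proof
  assume id: "\<And>s. (UInv s, s) \<in> \<theta>"
  show "thS (moS \<theta> :: 'a magma set) \<subseteq> \<theta>"
    using freeM_mo[OF id, where 'a='a] freeM_sat[OF id, where 'a='a] by (fastforce simp: thS_def)
  show "\<theta> \<subseteq> thS (moS \<theta> :: 'a magma set)" by (auto simp: thS_def moS_def)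
qed

end

lemma moS_variety: "\<theta> \<in> sgrp_theories \<Longrightarrow> semigroup_variety (moS \<theta> :: 'a magma set)"
proof -
  assume "\<theta> \<in> sgrp_theories"
  then interpret equational_theory \<theta> by (simp add: sgrp_theories_def)
  have "magma_variety (moS \<theta> :: 'a magma set)"
    unfolding magma_variety_def moS_def by (intro exI[of _ "(\<lambda>(s, t). (er s, er t)) ` \<theta>"]) auto
  moreover have "is_semigroup S" if S: "S \<in> moS \<theta>" for S :: "'a magma"
  proof -
    have a: "msatisfies S (er (UMul (UMul (UVar 0) (UVar 1)) (UVar 2)), er (UMul (UVar 0) (UMul (UVar 1) (UVar 2))))"
      using S asc[of "UVar 0" "UVar 1" "UVar 2"] unfolding moS_def by blast
    have "(x \<cdot>\<^bsub>S\<^esub> y) \<cdot>\<^bsub>S\<^esub> z = x \<cdot>\<^bsub>S\<^esub> (y \<cdot>\<^bsub>S\<^esub> z)" if "x \<in> carrier S" "y \<in> carrier S" "z \<in> carrier S" for x y z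
    proof -
      let ?\<rho> = "\<lambda>i::nat. if i = 0 then x else if i = 1 then y else z"
      have "range ?\<rho> \<subseteq> carrier S" using that by auto
      from a[unfolded msatisfies_def, THEN spec[of _ ?\<rho>], THEN mp, OF this] show ?thesis by simp
    qed
    then show ?thesis using S by (simp add: is_semigroup_def moS_def)
  qed
  ultimately show ?thesis by (simp add: semigroup_variety_def)
qed

lemma meval_upow: "meval S \<rho> (er (upow t n)) = spow S (meval S \<rho> (er t)) (Suc n)"
  by (induction n) (auto simp: spow_def)

lemma ueval_upow: "ueval S \<rho> (upow t n) = spow S (ueval S \<rho> t) (Suc n)"
  by (induction n) (auto simp: spow_def)

lemma moE_sat: "S \<in> moE \<theta> \<Longrightarrow> (s, t) \<in> \<theta> \<Longrightarrow> range \<rho> \<subseteq> carrier S \<Longrightarrow> ueval S \<rho> s = ueval S \<rho> t"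
  by (auto simp: moE_def usatisfies_def)

lemma moE_semigroup:
  assumes "equational_theory \<theta>" "S \<in> moE \<theta>" shows "is_semigroup S"
proof -
  interpret equational_theory \<theta> by fact
  have "(x \<cdot>\<^bsub>S\<^esub> y) \<cdot>\<^bsub>S\<^esub> z = x \<cdot>\<^bsub>S\<^esub> (y \<cdot>\<^bsub>S\<^esub> z)" if "x \<in> carrier S" "y \<in> carrier S" "z \<in> carrier S" for x y z
  proof -
    have "range (\<lambda>i::nat. if i = 0 then x else if i = 1 then y else z) \<subseteq> carrier S" using that by auto
    from moE_sat[OF assms(2) asc[of "UVar 0" "UVar 1" "UVar 2"] this] show ?thesis by simp
  qed
  then show ?thesis using assms by (simp add: is_semigroup_def moE_def unary_magma_closed_def)
qed

lemma moE_pinv_laws: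
  assumes "epigroup_theory \<theta> n" "S \<in> moE \<theta>" "x \<in> carrier S"
  shows "semigroup_on.pinv_laws S x (pinv S x) n"
proof -
  interpret epigroup_theory \<theta> n by fact
  interpret semigroup_on S using moE_semigroup[OF equational_theory_axioms assms(2)] by unfold_locales
  have r: "range (\<lambda>_::nat. x) \<subseteq> carrier S" using assms(3) by auto
  show ?thesis
    using moE_sat[OF assms(2) e1[of "UVar 0"] r] moE_sat[OF assms(2) e2[of "UVar 0"] r] moE_sat[OF assms(2) e3[of "UVar 0"] r]
    by (simp add: pinv_laws_def ueval_upow mpw_def)
qed

lemma moE_pinv: "S \<in> moE \<theta> \<Longrightarrow> x \<in> carrier S \<Longrightarrow> pinv S x \<in> carrier S"
  by (auto simp: moE_def unary_magma_closed_def)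

lemma moE_variety: "\<theta> \<in> epi_theories \<Longrightarrow> epigroup_variety (moE \<theta> :: 'a unary_magma set)"
proof -
  assume "\<theta> \<in> epi_theories"
  then obtain n where e: "epigroup_theory \<theta> n" by (auto simp: epi_theories_def)
  then interpret epigroup_theory \<theta> n .
  have "unary_magma_variety (moE \<theta> :: 'a unary_magma set)"
    unfolding unary_magma_variety_def moE_def by blast
  moreover have "epigroup S \<and> pinv_is_pseudoinversion S" if S: "S \<in> moE \<theta>" for S :: "'a unary_magma"
  proof -
    interpret G: semigroup_on S using moE_semigroup[OF equational_theory_axioms S] by unfold_locales
    show ?thesis
      using G.laws_imp_pseudoinverse[OF _ moE_pinv[OF S] moE_pinv_laws[OF e S]] G.sg
      by (simp add: epigroup_def pinv_is_pseudoinversion_def)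
  qed
  ultimately show ?thesis by (simp add: epigroup_variety_def)
qed

text \<open>The bound on the index is uniform because of the free algebra: its generator has some
  index, and a law holding for a free generator holds for every term.\<close>

lemma thE_epi_theories:
  fixes W :: "'a::infinite unary_magma set"
  assumes W: "epigroup_variety W" shows "thE W \<in> epi_theories"
proof -
  have mo: "moE (thE W) = W" using W by (intro moE_thE) (simp add: epigroup_variety_def)
  have cl: "is_semigroup S \<and> unary_magma_closed S" if "S \<in> W" for S
    using W that unfolding epigroup_variety_def unary_magma_variety_def epigroup_def by auto
  interpret E: equational_theory "thE W" by (rule thE_equational_theory[OF cl])
  let ?F = "E.freeU :: 'a unary_magma"
  have FW: "?F \<in> W" using E.freeU_mo mo by blast
  then have ps: "pinv_is_pseudoinversion ?F" using W by (simp add: epigroup_variety_def)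
  interpret G: semigroup_on ?F using cl[OF FW] by unfold_locales simp
  define x where "x = (E.rep (UVar 0) :: 'a)"
  have x: "x \<in> carrier ?F" by (simp add: x_def E.freeU_def)
  then obtain n where n: "G.pinv_laws x (pinv ?F x) n"
    using G.pseudoinverse_imp_laws[OF x, of "pinv ?F x"] ps unfolding pinv_is_pseudoinversion_def by blast
  have mul: "mul ?F (E.rep s) (E.rep t) = E.rep (UMul s t)" for s t by (simp add: E.freeU_def E.rep_mul)
  have inv: "pinv ?F (E.rep s) = E.rep (UInv s)" for s by (simp add: E.freeU_def E.rep_inv)
  have pw: "G.mpw (E.rep s) m = E.rep (upow s m)" for s m by (induction m) (auto simp: mul)
  have 1: "(UMul (UVar 0) (UInv (UVar 0)), UMul (UInv (UVar 0)) (UVar 0)) \<in> thE W"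
    "(UMul (UMul (UInv (UVar 0)) (UVar 0)) (UInv (UVar 0)), UInv (UVar 0)) \<in> thE W"
    "(UMul (upow (UVar 0) n) (uom (UVar 0)), upow (UVar 0) n) \<in> thE W"
    using n by (simp_all add: G.pinv_laws_def x_def mul inv pw E.rep_eq)
  have "epigroup_theory (thE W) n"
  proof
    fix s
    show "(uom s, UMul (UInv s) s) \<in> thE W" using E.sub[OF 1(1), of "\<lambda>_. s"] by simp
    show "(UMul (UMul (UInv s) s) (UInv s), UInv s) \<in> thE W" using E.sub[OF 1(2), of "\<lambda>_. s"] by simp
    show "(UMul (upow s n) (uom s), upow s n) \<in> thE W" using E.sub[OF 1(3), of "\<lambda>_. s"] by (simp add: usub_upow)
  qed
  then show ?thesis by (auto simp: epi_theories_def)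
qed

interpretation S: duality "{V :: 'a::infinite magma set. semigroup_variety V}" thS sgrp_theories
proof (rule duality.intro)
  fix V W :: "'a magma set"
  assume V: "V \<in> {V. semigroup_variety V}"
  then show "thS V \<in> sgrp_theories" by (intro thS_sgrp_theories) (simp add: semigroup_variety_def)
  assume W: "W \<in> {V. semigroup_variety V}"
  have "moS (thS V) = V" "moS (thS W) = W" using V W by (simp_all add: moS_thS semigroup_variety_def)
  moreover have "moS \<theta> \<subseteq> (moS \<theta>' :: 'a magma set)" if "\<theta>' \<subseteq> \<theta>" for \<theta> \<theta>' using that unfolding moS_def by blast
  moreover have "thS W \<subseteq> thS V" if "V \<subseteq> W" using that by (auto simp: thS_def)
  ultimately show "V \<subseteq> W \<longleftrightarrow> thS W \<subseteq> thS V" by metis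
next
  fix \<theta> assume t: "\<theta> \<in> sgrp_theories"
  then interpret equational_theory \<theta> by (simp add: sgrp_theories_def)
  have "thS (moS \<theta> :: 'a magma set) = \<theta>" using t by (intro thS_moS) (simp add: sgrp_theories_def)
  then show "\<exists>V\<in>{V :: 'a magma set. semigroup_variety V}. thS V = \<theta>" using moS_variety[OF t] by blast
next
  show "equational_theory \<theta>" if "\<theta> \<in> sgrp_theories" for \<theta> using that by (simp add: sgrp_theories_def)
qed (auto intro: sgrp_theories_inter sgrp_theories_join)

interpretation E: duality "{V :: 'a::infinite unary_magma set. epigroup_variety V}" thE epi_theories
proof (rule duality.intro)
  fix V W :: "'a unary_magma set"
  assume V: "V \<in> {V. epigroup_variety V}"
  then show "thE V \<in> epi_theories" by (intro thE_epi_theories) simp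
  assume W: "W \<in> {V. epigroup_variety V}"
  have "moE (thE V) = V" "moE (thE W) = W" using V W by (simp_all add: moE_thE epigroup_variety_def)
  moreover have "moE \<theta> \<subseteq> (moE \<theta>' :: 'a unary_magma set)" if "\<theta>' \<subseteq> \<theta>" for \<theta> \<theta>' using that unfolding moE_def by blast
  moreover have "thE W \<subseteq> thE V" if "V \<subseteq> W" using that by (auto simp: thE_def)
  ultimately show "V \<subseteq> W \<longleftrightarrow> thE W \<subseteq> thE V" by metis
next
  fix \<theta> assume t: "\<theta> \<in> epi_theories"
  then interpret equational_theory \<theta> by (auto simp: epi_theories_def epigroup_theory_def)
  have "thE (moE \<theta> :: 'a unary_magma set) = \<theta>" by (rule thE_moE)
  then show "\<exists>V\<in>{V :: 'a unary_magma set. epigroup_variety V}. thE V = \<theta>" using moE_variety[OF t] by blast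
next
  show "equational_theory \<theta>" if "\<theta> \<in> epi_theories" for \<theta> using that by (auto simp: epi_theories_def epigroup_theory_def)
qed (auto intro: epi_theories_inter epi_theories_join)

lemma SEM_L: "SEM = S.L" by (simp add: SEM_def S.L_def)
lemma EPI_L: "EPI = E.L" by (simp add: EPI_def E.L_def)

section \<open>Periodic semigroup varieties as epigroup varieties\<close>

lemma truncate_simps [simp]: "carrier (magma.truncate X) = carrier X" "mul (magma.truncate X) = mul X"
  by (simp_all add: magma.truncate_def)

lemma is_semigroup_truncate: "is_semigroup (magma.truncate X) = is_semigroup X"
  by (simp add: is_semigroup_def magma_closed_def)

text \<open>The free generator lies in a finite subsemigroup, so two of its powers coincide;
  freeness makes this an identity of the whole variety.\<close>

lemma periodic_exponents:
  fixes V :: "'a::infinite magma set"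
  assumes "periodic_variety V"
  obtains P Q where "Q \<ge> 1" "\<And>s. (upow s P, upow s (P + Q)) \<in> thS V"
proof -
  have V: "semigroup_variety V" "\<And>S. S \<in> V \<Longrightarrow> periodic S" using assms by (auto simp: periodic_variety_def)
  have sgrp_theories: "thS V \<in> sgrp_theories" using V(1) S.into by blast
  then interpret T: equational_theory "thS V" by (simp add: sgrp_theories_def)
  have id: "(UInv s, s) \<in> thS V" for s using sgrp_theories by (simp add: sgrp_theories_def)
  let ?F = "T.freeM :: 'a magma"
  have "?F \<in> V" using T.freeM_mo[OF id, where 'a='a] V(1) moS_thS by (auto simp: semigroup_variety_def)
  define x where "x = (T.rep (UVar 0) :: 'a)"
  have x: "x \<in> carrier ?F" by (simp add: x_def T.freeM_def)
  let ?H = "subsemigroup ?F hull {x}"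
  have fin: "finite ?H" using V(2)[OF \<open>?F \<in> V\<close>] x by (simp add: periodic_def)
  have mul: "mul ?F (T.rep s) (T.rep t) = T.rep (UMul s t)" for s t by (simp add: T.freeM_def T.rep_mul)
  have pow: "T.rep (upow (UVar 0) n) \<in> ?H" for n
  proof (induction n)
    case 0 show ?case by (simp add: hull_inc x_def)
  next
    case (Suc n)
    have "mul ?F (T.rep (upow (UVar 0) n)) x \<in> ?H"
      unfolding hull_def
    proof (intro InterI)
      fix T assume "T \<in> {T. subsemigroup ?F T \<and> {x} \<subseteq> T}"
      moreover from this have "T.rep (upow (UVar 0) n) \<in> T" using Suc unfolding hull_def by blast
      ultimately show "mul ?F (T.rep (upow (UVar 0) n)) x \<in> T" by (simp add: subsemigroup_def)
    qed
    then show ?case by (simp add: x_def mul)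
  qed
  then have "range (\<lambda>n. T.rep (upow (UVar 0) n) :: 'a) \<subseteq> ?H" by blast
  then have "finite (range (\<lambda>n. T.rep (upow (UVar 0) n) :: 'a))" using fin finite_subset by blast
  then have "\<not> inj (\<lambda>n. T.rep (upow (UVar 0) n) :: 'a)" using finite_imageD infinite_UNIV_nat by blast
  then obtain a b where "a \<noteq> b" "(T.rep (upow (UVar 0) a) :: 'a) = T.rep (upow (UVar 0) b)" by (auto simp: inj_def)
  then obtain a b where ab: "a < b" "(T.rep (upow (UVar 0) a) :: 'a) = T.rep (upow (UVar 0) b)" by (metis linorder_neqE_nat)
  then have 1: "(upow (UVar 0) a, upow (UVar 0) b) \<in> thS V" using T.rep_eq by blast
  have "(upow s a, upow s b) \<in> thS V" for s using T.sub[OF 1, of "\<lambda>_. s"] by (simp add: usub_upow)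
  then show thesis using that[of "b - a" a] ab(1) by simp
qed

text \<open>In a member of \<open>V\<close> the power with exponent \<open>K + 1\<close> obeys the
  laws of pseudoinversion, and these laws determine the pseudoinverse. Equipping a member with its
  pseudoinversion therefore means interpreting \<open>UInv\<close> as that power.\<close>

lemma as_epigroup_variety_eq:
  fixes V :: "'a::infinite magma set"
  assumes V: "semigroup_variety V" and e: "epigroup_theory (pull K (thS V)) P"
  shows "as_epigroup_variety V = moE (pull K (thS V))"
proof -
  have sgrp_theories: "thS V \<in> sgrp_theories" using V S.into by blast
  interpret T: equational_theory "thS V" using sgrp_theories by (simp add: sgrp_theories_def)
  have moV: "moS (thS V) = V" using V by (intro moS_thS) (simp add: semigroup_variety_def)
  interpret E: epigroup_theory "pull K (thS V)" P by fact
  have ipow: "(UInv s, upow s K) \<in> pull K (thS V)" for s by (simp add: pull_def tr_upow)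
  show ?thesis
  proof
    show "as_epigroup_variety V \<subseteq> moE (pull K (thS V))"
    proof
      fix X assume "X \<in> as_epigroup_variety V"
      then have X: "magma.truncate X \<in> V" "pinv_is_pseudoinversion X" by (auto simp: as_epigroup_variety_def)
      have sgX: "is_semigroup X" using X(1) V is_semigroup_truncate[of X] by (simp add: semigroup_variety_def)
      interpret G: semigroup_on X using sgX by unfold_locales
      have sat: "meval (magma.truncate X) \<rho> (er s) = meval (magma.truncate X) \<rho> (er t)"
        if "(s, t) \<in> thS V" "range \<rho> \<subseteq> carrier X" for s t \<rho>
        using that X(1) by (auto simp: thS_def msatisfies_def)
      have mp: "spow (magma.truncate X) x n = spow X x n" for x n by (simp add: spow_def)
      have axK: "G.pinv_laws x (G.mpw x K) P" if x: "x \<in> carrier X" for x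
      proof -
        have r: "range (\<lambda>_::nat. x) \<subseteq> carrier X" using x by auto
        have "(tr K s, tr K t) \<in> thS V" if "(s, t) \<in> pull K (thS V)" for s t using that by (simp add: pull_def)
        note h = sat[OF this r]
        show ?thesis using h[OF E.e1[of "UVar 0"]] h[OF E.e2[of "UVar 0"]] h[OF E.e3[of "UVar 0"]]
          by (simp add: tr_upow G.pinv_laws_def G.mpw_def meval_upow mp)
      qed
      have pinvK: "pinv X x = G.mpw x K" if x: "x \<in> carrier X" for x
        using G.pseudoinverse_imp_laws[OF x, of "pinv X x"] X(2) x G.pinv_laws_unique[OF x _ _ _ axK[OF x]] by (auto simp: pinv_is_pseudoinversion_def)
      have clX: "unary_magma_closed X"
        using sgX pinvK by (auto simp: unary_magma_closed_def is_semigroup_def)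
      have ev: "ueval X \<rho> t = meval (magma.truncate X) \<rho> (er (tr K t))" if r: "range \<rho> \<subseteq> carrier X" for \<rho> t
      proof (induction t)
        case (UInv t)
        have "ueval X \<rho> (UInv t) = G.mpw (ueval X \<rho> t) K" using pinvK ueval_in[OF clX r] by simp
        then show ?case using UInv by (simp add: meval_upow mp G.mpw_def)
      qed auto
      show "X \<in> moE (pull K (thS V))" unfolding moE_def usatisfies_def
        using clX ev sat by (auto simp: pull_def)
    qed
    show "moE (pull K (thS V)) \<subseteq> as_epigroup_variety V"
    proof
      fix X :: "'a unary_magma" assume X: "X \<in> moE (pull K (thS V))"
      have "pull K (thS V) \<in> epi_theories" using e by (auto simp: epi_theories_def)
      then have ps: "pinv_is_pseudoinversion X" using moE_variety[of "pull K (thS V)"] X by (auto simp: epigroup_variety_def)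
      have ev: "ueval X \<rho> (tr 0 t) = meval (magma.truncate X) \<rho> (er t)" for \<rho> t by (induction t) auto
      have R: "(tr 0 s, tr 0 t) \<in> pull K (thS V)" if "(s, t) \<in> thS V" for s t
      proof -
        have "(r, tr 0 r) \<in> thS V" for r using sgrp_theories by (intro T.rel_tr) (auto simp: sgrp_theories_def)
        then have "(tr 0 s, tr 0 t) \<in> thS V" using that T.sym T.trans by meson
        then show ?thesis by (simp add: pull_def)
      qed
      have "magma.truncate X \<in> moS (thS V)"
        unfolding moS_def
      proof (intro CollectI conjI ballI)
        show "magma_closed (magma.truncate X)" using X by (simp add: moE_def unary_magma_closed_def magma_closed_def)
        fix st assume "st \<in> thS V"
        then have "(tr 0 (fst st), tr 0 (snd st)) \<in> pull K (thS V)" using R by (cases st) simp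
        from moE_sat[OF X this] show "case st of (s, t) \<Rightarrow> msatisfies (magma.truncate X) (er s, er t)"
          by (simp add: msatisfies_def ev split_beta)
      qed
      then show "X \<in> as_epigroup_variety V" using ps moV by (simp add: as_epigroup_variety_def)
    qed
  qed
qed

theorem corollary1p2:
  fixes V :: "'a::infinite magma set"
  assumes "periodic_variety V" and "commutative_variety V"
  shows "(cancellable_element EPI (as_epigroup_variety V)
            \<longleftrightarrow> modular_element EPI (as_epigroup_variety V))
       \<and> (modular_element EPI (as_epigroup_variety V)
            \<longleftrightarrow> cancellable_element SEM V)
       \<and> (cancellable_element SEM V
            \<longleftrightarrow> modular_element SEM V)"
proof -
  let ?\<theta> = "thS V"
  have V: "semigroup_variety V" using assms(1) by (simp add: periodic_variety_def)
  then have \<theta>: "?\<theta> \<in> sgrp_theories" using S.into by blast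
  then interpret T: equational_theory ?\<theta> by (simp add: sgrp_theories_def)
  have Tcom: "(UMul s t, UMul t s) \<in> ?\<theta>" for s t
  proof -
    have "meval S \<rho> (er (UMul s t)) = meval S \<rho> (er (UMul t s))" if "S \<in> V" "range \<rho> \<subseteq> carrier S" for S \<rho>
    proof -
      have "commutative S" "magma_closed S" using assms(2) V that(1)
        by (auto simp: commutative_variety_def semigroup_variety_def is_semigroup_def)
      then show ?thesis using meval_in[of S \<rho>] that(2) by (simp add: commutative_def)
    qed
    then show ?thesis by (auto simp: thS_def msatisfies_def)
  qed
  obtain P Q where PQ: "Q \<ge> 1" "\<And>s. (upow s P, upow s (P + Q)) \<in> ?\<theta>" using periodic_exponents[OF assms(1)] by blast
  \<comment> \<open>\<open>K + 2\<close> has to be a multiple of the period. The summand 5 gives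
    \<open>K \<ge> 3\<close>, so that with this exponent the congruences of the necessity part
    become epigroup theories too.\<close>
  define K where "K = (P + 5) * Q - 2"
  have "P + 5 \<le> (P + 5) * Q" using PQ(1) mult_le_mono2[of 1 Q "P + 5"] by simp
  then have K: "K + 2 = (P + 5) * Q" "K \<ge> P" "K \<ge> 3" unfolding K_def by linarith+
  have ep: "epigroup_theory (pull K ?\<theta>) P" using T.pull_epigroup_theory[OF PQ(2) _ K(2)] K(1) by (metis dvd_triv_right)
  let ?\<nu> = "pull K ?\<theta>"
  interpret N: epigroup_theory ?\<nu> P by fact
  have \<nu>: "?\<nu> \<in> epi_theories" using ep by (auto simp: epi_theories_def)
  have as: "as_epigroup_variety V = moE ?\<nu>" by (rule as_epigroup_variety_eq[OF V ep])
  have ev: "epigroup_variety (as_epigroup_variety V)" unfolding as by (rule moE_variety[OF \<nu>])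
  have th: "thE (as_epigroup_variety V) = ?\<nu>" unfolding as by (rule N.thE_moE)
  have cT: "commutative_theory ?\<theta>" using Tcom by unfold_locales
  have cN: "commutative_theory ?\<nu>" using Tcom by unfold_locales (simp add: pull_def)
  have invT: "(UInv s, upow s 0) \<in> ?\<theta>" for s using \<theta> by (simp add: sgrp_theories_def)
  have invN: "(UInv s, upow s K) \<in> ?\<nu>" for s by (simp add: pull_def tr_upow)
  \<comment> \<open>The square condition contains no inverse, hence is the same under both readings
    of \<open>UInv\<close>. All four properties will be shown equivalent to it.\<close>
  have TN: "square_cond ?\<theta> 0 \<longleftrightarrow> square_cond ?\<nu> K"
  proof
    assume "square_cond ?\<theta> 0"
    then interpret C: square_cond ?\<theta> 0 .
    have "(UMul (UMul s s) t, UMul (UMul s s) (UMul t t)) \<in> ?\<nu>" for s t using C.sqq by (simp add: pull_def)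
    then show "square_cond ?\<nu> K" using cN invN by (simp add: square_cond_def square_cond_axioms_def)
  next
    assume "square_cond ?\<nu> K"
    then interpret C: square_cond ?\<nu> K .
    have "(UMul (UMul s s) t, UMul (UMul s s) (UMul t t)) \<in> ?\<theta>" for s t
    proof -
      have "(UMul (UMul (UVar 0) (UVar 0)) (UVar 1), UMul (UMul (UVar 0) (UVar 0)) (UMul (UVar 1) (UVar 1))) \<in> ?\<theta>"
        using C.sqq[of "UVar 0" "UVar 1"] by (simp add: pull_def)
      from T.sub[OF this, of "\<lambda>i. if i = 0 then s else t"] show ?thesis by simp
    qed
    then show "square_cond ?\<theta> 0" using cT invT by (simp add: square_cond_def square_cond_axioms_def)
  qed
  have S: "modular_in sgrp_theories ?\<theta> \<longleftrightarrow> square_cond ?\<theta> 0" "cancellable_in sgrp_theories ?\<theta> \<longleftrightarrow> square_cond ?\<theta> 0"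
    using modular_imp_square_cond[OF cT invT _ word_cong.pull_wrel_sgrp_theories] cancellable_semigroup_on_theories[OF _ \<theta>] S.cancel_mod[OF \<theta>] by blast+
  have E: "modular_in epi_theories ?\<nu> \<longleftrightarrow> square_cond ?\<nu> K" "cancellable_in epi_theories ?\<nu> \<longleftrightarrow> square_cond ?\<nu> K"
    using modular_imp_square_cond[OF cN invN _ word_cong.pull_wrel_epi_theories[OF _ K(3)]] cancellable_epi_semigrp_theories[of ?\<nu> K] K(3) E.cancel_mod[OF \<nu>] by fastforce+
  have "cancellable_element SEM V \<longleftrightarrow> square_cond ?\<theta> 0" "modular_element SEM V \<longleftrightarrow> square_cond ?\<theta> 0"
    unfolding SEM_L using S.cancellable_iff[of V] S.modular_iff[of V] V S by auto
  moreover have "cancellable_element EPI (as_epigroup_variety V) \<longleftrightarrow> square_cond ?\<nu> K"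
    "modular_element EPI (as_epigroup_variety V) \<longleftrightarrow> square_cond ?\<nu> K"
    unfolding EPI_L using E.cancellable_iff[of "as_epigroup_variety V"] E.modular_iff[of "as_epigroup_variety V"] ev th E by auto
  ultimately show ?thesis using TN by simp
qed

end
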